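(* Let $k$ be a field and let $(B,\mathfrak{g})$ be a finitely generated almost commutative $k$-algebra. Then for every simple left $B[X]$-module $M$ the map $\varphi\colon M\to M$, $\varphi(m)=X\cdot m$, is algebraic over $k$ (i.e. $p(\varphi)=0$ for some non-zero polynomial $p$ with coefficients in $k$). In particular, $B$ is a Jacobson algebra (every semiprime ideal of $B$ is semiprimitive), and for every simple left $B$-module $M$ the commutant $\operatorname{End}_B(M)$ is algebraic over $k$ (every element of it is algebraic over $k$).
   Context: Rings and algebras are associative and unital, not necessarily commutative; "ideal" means two-sided ideal; modules are left modules, and simple modules are non-zero. $B[X]$ is the ring of polynomials in one central indeterminate $X$ with coefficients in $B$. A finitely generated almost commutative $k$-algebra is a pair $(B,\mathfrak{g})$ consisting of a unital $k$-algebra $B$ and a finite-dimensional $k$-linear subspace $\mathfrak{g}\subset B$ such that $xy-yx\in\mathfrak{g}$ for all $x,y\in\mathfrak{g}$ and $B=\sum_{n=0}^\infty\mathfrak{g}^n$, where $\mathfrak{g}^0=k\cdot 1$ and $\mathfrak{g}^n$ is the $k$-span of all products of $n$ elements of $\mathfrak{g}$. A proper ideal $P$ of $B$ is prime if for all ideals $J_1,J_2$ of $B$, $J_1J_2\subset P$ implies $J_1\subset P$ or $J_2\subset P$. A proper ideal $I$ is semiprime if it equals the intersection of all prime ideals containing it. An ideal is primitive if it is the annihilator of a simple $B$-module. An ideal is semiprimitive if it is an intersection of primitive ideals. *)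

theory Defs
  imports "HOL-Algebra.UnivPoly" "HOL-Algebra.Ideal_Product"
begin

section \<open>Left modules over noncommutative rings\<close>

text \<open>
  The locale \<open>module\<close> of the library insists on a commutative ring of scalars. Apart from that,
  the axioms below are the same, on the same record type; as there, the
  \<open>mult\<close> and \<open>one\<close> fields of a module record carry no meaning. The predicate \<open>submodule\<close> of the
  library makes no assumption on the ring and is used as it is.
\<close>

locale left_module = R?: ring R + M?: abelian_group M
  for R (structure) and M (structure) +
  assumes smult_closed [simp, intro]:
      "\<lbrakk>a \<in> carrier R; x \<in> carrier M\<rbrakk> \<Longrightarrow> a \<odot>\<^bsub>M\<^esub> x \<in> carrier M"
    and smult_l_distr:
      "\<lbrakk>a \<in> carrier R; b \<in> carrier R; x \<in> carrier M\<rbrakk> \<Longrightarrow>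
        (a \<oplus> b) \<odot>\<^bsub>M\<^esub> x = a \<odot>\<^bsub>M\<^esub> x \<oplus>\<^bsub>M\<^esub> b \<odot>\<^bsub>M\<^esub> x"
    and smult_r_distr:
      "\<lbrakk>a \<in> carrier R; x \<in> carrier M; y \<in> carrier M\<rbrakk> \<Longrightarrow>
        a \<odot>\<^bsub>M\<^esub> (x \<oplus>\<^bsub>M\<^esub> y) = a \<odot>\<^bsub>M\<^esub> x \<oplus>\<^bsub>M\<^esub> a \<odot>\<^bsub>M\<^esub> y"
    and smult_assoc1:
      "\<lbrakk>a \<in> carrier R; b \<in> carrier R; x \<in> carrier M\<rbrakk> \<Longrightarrow>
        (a \<otimes> b) \<odot>\<^bsub>M\<^esub> x = a \<odot>\<^bsub>M\<^esub> (b \<odot>\<^bsub>M\<^esub> x)"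
    and smult_one [simp]:
      "x \<in> carrier M \<Longrightarrow> \<one> \<odot>\<^bsub>M\<^esub> x = x"

locale simple_module = left_module +
  assumes nonzero: "carrier M \<noteq> {\<zero>\<^bsub>M\<^esub>}"
    and submodule_trivial: "submodule N R M \<Longrightarrow> N = {\<zero>\<^bsub>M\<^esub>} \<or> N = carrier M"

definition annihilator :: "('a, 'r) ring_scheme \<Rightarrow> ('a, 'm, 's) module_scheme \<Rightarrow> 'a set" where
  "annihilator R M = {a \<in> carrier R. \<forall>x \<in> carrier M. a \<odot>\<^bsub>M\<^esub> x = \<zero>\<^bsub>M\<^esub>}"

text \<open>
  The commutant of \<open>M\<close>. Endomorphisms are not normalised outside \<open>carrier M\<close>
  (like \<open>hom\<close> in the library).
\<close>

definition module_End :: "('a, 'r) ring_scheme \<Rightarrow> ('a, 'm, 's) module_scheme \<Rightarrow> ('m \<Rightarrow> 'm) set" where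
  "module_End R M = {f \<in> carrier M \<rightarrow> carrier M.
     (\<forall>x \<in> carrier M. \<forall>y \<in> carrier M. f (x \<oplus>\<^bsub>M\<^esub> y) = f x \<oplus>\<^bsub>M\<^esub> f y) \<and>
     (\<forall>a \<in> carrier R. \<forall>x \<in> carrier M. f (a \<odot>\<^bsub>M\<^esub> x) = a \<odot>\<^bsub>M\<^esub> f x)}"

definition restrict_scalars ::
    "('k \<Rightarrow> 'a) \<Rightarrow> ('a, 'm, 's) module_scheme \<Rightarrow> ('k, 'm) module" where
  "restrict_scalars h M = \<lparr>carrier = carrier M, mult = mult M, one = one M,
     zero = zero M, add = add M, smult = (\<lambda>c x. h c \<odot>\<^bsub>M\<^esub> x)\<rparr>"


section \<open>Prime, semiprime, primitive and semiprimitive ideals\<close>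

text \<open>The locale \<open>primeideal\<close> of the library is for commutative rings only.\<close>

definition nc_prime_ideal :: "('a, 'r) ring_scheme \<Rightarrow> 'a set \<Rightarrow> bool" where
  "nc_prime_ideal R P \<longleftrightarrow> ideal P R \<and> P \<noteq> carrier R \<and>
     (\<forall>J1 J2. ideal J1 R \<longrightarrow> ideal J2 R \<longrightarrow> J1 \<cdot>\<^bsub>R\<^esub> J2 \<subseteq> P \<longrightarrow> J1 \<subseteq> P \<or> J2 \<subseteq> P)"

text \<open>
  In the next definitions, intersecting with \<open>carrier R\<close> only matters for the empty
  family of ideals, whose intersection is the whole ring.
\<close>

definition semiprime_ideal :: "('a, 'r) ring_scheme \<Rightarrow> 'a set \<Rightarrow> bool" where
  "semiprime_ideal R I \<longleftrightarrow> ideal I R \<and> I \<noteq> carrier R \<and>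
     I = carrier R \<inter> \<Inter>{P. nc_prime_ideal R P \<and> I \<subseteq> P}"

text \<open>
  A definition cannot quantify over all types of module elements. Every simple module is
  isomorphic to a module of cosets of a left ideal, so that modules on the type \<open>'a set\<close> suffice;
  \<open>primitive_ideal_annihilator\<close> below confirms that nothing is lost.
\<close>

definition primitive_ideal :: "('a, 'r) ring_scheme \<Rightarrow> 'a set \<Rightarrow> bool" where
  "primitive_ideal R I \<longleftrightarrow>
     (\<exists>M :: ('a, 'a set) module. simple_module R M \<and> I = annihilator R M)"

definition semiprimitive_ideal :: "('a, 'r) ring_scheme \<Rightarrow> 'a set \<Rightarrow> bool" where
  "semiprimitive_ideal R I \<longleftrightarrow>
     (\<exists>\<S>. (\<forall>P \<in> \<S>. primitive_ideal R P) \<and> I = carrier R \<inter> \<Inter>\<S>)"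

definition jacobson_algebra :: "('a, 'r) ring_scheme \<Rightarrow> bool" where
  "jacobson_algebra R \<longleftrightarrow> (\<forall>I. semiprime_ideal R I \<longrightarrow> semiprimitive_ideal R I)"


section \<open>Almost commutative algebras\<close>

text \<open>The locale \<open>algebra\<close> of the library is for commutative algebras only.\<close>

locale k_algebra = K?: field K + B?: ring B + module K B
  for K (structure) and B (structure) +
  assumes smult_mult_l:
      "\<lbrakk>c \<in> carrier K; x \<in> carrier B; y \<in> carrier B\<rbrakk> \<Longrightarrow>
        (c \<odot>\<^bsub>B\<^esub> x) \<otimes>\<^bsub>B\<^esub> y = c \<odot>\<^bsub>B\<^esub> (x \<otimes>\<^bsub>B\<^esub> y)"
    and smult_mult_r:
      "\<lbrakk>c \<in> carrier K; x \<in> carrier B; y \<in> carrier B\<rbrakk> \<Longrightarrow>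
        x \<otimes>\<^bsub>B\<^esub> (c \<odot>\<^bsub>B\<^esub> y) = c \<odot>\<^bsub>B\<^esub> (x \<otimes>\<^bsub>B\<^esub> y)"

definition lin_span ::
    "('k, 'r) ring_scheme \<Rightarrow> ('k, 'b, 's) module_scheme \<Rightarrow> 'b set \<Rightarrow> 'b set" where
  "lin_span K V S = \<Inter>{N. submodule N K V \<and> S \<subseteq> N}"

definition finite_dim_subspace ::
    "('k, 'r) ring_scheme \<Rightarrow> ('k, 'b, 's) module_scheme \<Rightarrow> 'b set \<Rightarrow> bool" where
  "finite_dim_subspace K V W \<longleftrightarrow>
     submodule W K V \<and> (\<exists>S. finite S \<and> S \<subseteq> carrier V \<and> W = lin_span K V S)"

text \<open>For \<open>n = 0\<close> the only product is the empty one, which gives the span of the unit.\<close>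

definition subspace_power ::
    "('k, 'r) ring_scheme \<Rightarrow> ('k, 'b, 's) module_scheme \<Rightarrow> 'b set \<Rightarrow> nat \<Rightarrow> 'b set" where
  "subspace_power K B \<gg> n =
     lin_span K B {foldr (\<otimes>\<^bsub>B\<^esub>) xs \<one>\<^bsub>B\<^esub> | xs. set xs \<subseteq> \<gg> \<and> length xs = n}"

locale almost_commutative_algebra = k_algebra K B
  for K (structure) and B (structure) and \<gg> +
  assumes finite_dim: "finite_dim_subspace K B \<gg>"
    and commutator_closed:
      "\<lbrakk>x \<in> \<gg>; y \<in> \<gg>\<rbrakk> \<Longrightarrow> x \<otimes>\<^bsub>B\<^esub> y \<ominus>\<^bsub>B\<^esub> y \<otimes>\<^bsub>B\<^esub> x \<in> \<gg>"
    and generates: "carrier B = lin_span K B (\<Union>n. subspace_power K B \<gg> n)"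


section \<open>Algebraic endomorphisms\<close>

definition algebraic_map ::
    "('k, 'r) ring_scheme \<Rightarrow> ('k, 'v, 's) module_scheme \<Rightarrow> ('v \<Rightarrow> 'v) \<Rightarrow> bool" where
  "algebraic_map K V f \<longleftrightarrow>
     (\<exists>p \<in> carrier (UP K). p \<noteq> \<zero>\<^bsub>UP K\<^esub> \<and>
       (\<forall>x \<in> carrier V.
         (\<Oplus>\<^bsub>V\<^esub>i \<in> {..deg K p}. coeff (UP K) p i \<odot>\<^bsub>V\<^esub> (f ^^ i) x) = \<zero>\<^bsub>V\<^esub>))"

text \<open>The structure maps of a \<open>k\<close>-algebra \<open>B\<close> and of the \<open>k\<close>-algebra \<open>B[X]\<close>.\<close>

definition scalar :: "('k, 'b, 's) module_scheme \<Rightarrow> 'k \<Rightarrow> 'b" where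
  "scalar B c = c \<odot>\<^bsub>B\<^esub> \<one>\<^bsub>B\<^esub>"

definition poly_scalar :: "('k, 'b, 's) module_scheme \<Rightarrow> 'k \<Rightarrow> nat \<Rightarrow> 'b" where
  "poly_scalar B c = monom (UP B) (scalar B c) 0"

definition poly_var :: "('b, 's) ring_scheme \<Rightarrow> nat \<Rightarrow> 'b" where
  "poly_var B = monom (UP B) \<one>\<^bsub>B\<^esub> 1"


section \<open>Primitive ideals and modules on arbitrary types\<close>

lemma (in left_module) simple_module_transport:
  fixes N :: "('a, 'n) module"
  assumes simple: "simple_module R M"
    and inj: "inj_on \<psi> (carrier M)"
    and N_carrier: "carrier N = \<psi> ` carrier M"
    and N_zero: "\<zero>\<^bsub>N\<^esub> = \<psi> \<zero>\<^bsub>M\<^esub>"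
    and N_add: "\<And>x y. \<lbrakk>x \<in> carrier M; y \<in> carrier M\<rbrakk> \<Longrightarrow> \<psi> x \<oplus>\<^bsub>N\<^esub> \<psi> y = \<psi> (x \<oplus>\<^bsub>M\<^esub> y)"
    and N_smult: "\<And>a x. \<lbrakk>a \<in> carrier R; x \<in> carrier M\<rbrakk> \<Longrightarrow> a \<odot>\<^bsub>N\<^esub> \<psi> x = \<psi> (a \<odot>\<^bsub>M\<^esub> x)"
  shows "simple_module R N" and "annihilator R N = annihilator R M"
proof -
  have ag: "abelian_group N"
  proof (rule abelian_groupI)
    fix u assume "u \<in> carrier N"
    then obtain x where x: "x \<in> carrier M" "u = \<psi> x" using N_carrier by auto
    have "\<psi> (\<ominus>\<^bsub>M\<^esub> x) \<oplus>\<^bsub>N\<^esub> u = \<zero>\<^bsub>N\<^esub>"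
      using x by (simp add: N_add N_zero M.l_neg)
    then show "\<exists>v\<in>carrier N. v \<oplus>\<^bsub>N\<^esub> u = \<zero>\<^bsub>N\<^esub>"
      using x N_carrier by blast
  qed (auto simp: N_carrier N_zero N_add M.a_ac)
  have lm: "left_module R N"
    by (intro left_module.intro left_module_axioms.intro ag R.ring_axioms)
      (auto simp: N_carrier N_add N_smult smult_l_distr smult_r_distr smult_assoc1)
  interpret N: left_module R N by (rule lm)
  have zero_iff: "\<psi> x = \<zero>\<^bsub>N\<^esub> \<longleftrightarrow> x = \<zero>\<^bsub>M\<^esub>" if "x \<in> carrier M" for x
    using that inj by (simp add: N_zero inj_on_eq_iff)
  show "annihilator R N = annihilator R M"
    by (auto simp: annihilator_def N_carrier N_smult zero_iff)
  have neg: "\<ominus>\<^bsub>N\<^esub> (\<psi> x) = \<psi> (\<ominus>\<^bsub>M\<^esub> x)" if "x \<in> carrier M" for x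
  proof (rule N.minus_equality)
    show "\<psi> (\<ominus>\<^bsub>M\<^esub> x) \<oplus>\<^bsub>N\<^esub> \<psi> x = \<zero>\<^bsub>N\<^esub>"
      using that by (simp add: N_add N_zero M.l_neg)
  qed (use that N_carrier in auto)
  show "simple_module R N"
  proof (intro simple_module.intro simple_module_axioms.intro lm)
    show "carrier N \<noteq> {\<zero>\<^bsub>N\<^esub>}"
    proof
      assume "carrier N = {\<zero>\<^bsub>N\<^esub>}"
      then have "x = \<zero>\<^bsub>M\<^esub>" if "x \<in> carrier M" for x
        using that zero_iff N_carrier by blast
      then have "carrier M = {\<zero>\<^bsub>M\<^esub>}" by auto
      then show False using simple_module.nonzero[OF simple] by contradiction
    qed
  next
    fix U assume U: "submodule U R N"
    interpret U: submodule U R N by (rule U)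
    define W where "W = {x \<in> carrier M. \<psi> x \<in> U}"
    have U_sub: "U \<subseteq> carrier N" using U.subset by simp
    have U_eq: "U = \<psi> ` W"
      using U_sub by (auto simp: W_def N_carrier)
    have "submodule W R M"
    proof (intro submodule.intro submodule_axioms.intro subgroup.intro)
      show "W \<subseteq> carrier (add_monoid M)" by (auto simp: W_def)
      show "x \<otimes>\<^bsub>add_monoid M\<^esub> y \<in> W" if "x \<in> W" "y \<in> W" for x y
        using that U.m_closed[of "\<psi> x" "\<psi> y"] by (auto simp: W_def N_add)
      show "\<one>\<^bsub>add_monoid M\<^esub> \<in> W"
        using U.one_closed by (auto simp: W_def N_zero)
      show "inv\<^bsub>add_monoid M\<^esub> x \<in> W" if "x \<in> W" for x
        using that U.m_inv_closed[of "\<psi> x"] neg[of x]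
        by (auto simp: W_def simp flip: a_inv_def)
      show "a \<odot>\<^bsub>M\<^esub> x \<in> W" if "a \<in> carrier R" "x \<in> W" for a x
        using that U.smult_closed[of a "\<psi> x"] by (auto simp: W_def N_smult)
    qed
    then have "W = {\<zero>\<^bsub>M\<^esub>} \<or> W = carrier M"
      by (rule simple_module.submodule_trivial[OF simple])
    then show "U = {\<zero>\<^bsub>N\<^esub>} \<or> U = carrier N"
      by (auto simp: U_eq N_zero N_carrier)
  qed
qed

lemma primitive_ideal_annihilator:
  fixes M :: "('a, 'm, 's) module_scheme"
  assumes simple: "simple_module R M"
  shows "primitive_ideal R (annihilator R M)"
proof -
  interpret simple_module R M by (rule simple)
  obtain v where v: "v \<in> carrier M" "v \<noteq> \<zero>\<^bsub>M\<^esub>"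
    using nonzero M.zero_closed by blast
  define \<psi> where "\<psi> x = {b \<in> carrier R. b \<odot>\<^bsub>M\<^esub> v = x}" for x
  have l_null: "\<zero>\<^bsub>R\<^esub> \<odot>\<^bsub>M\<^esub> v = \<zero>\<^bsub>M\<^esub>"
    using smult_l_distr[of "\<zero>\<^bsub>R\<^esub>" "\<zero>\<^bsub>R\<^esub>" v] v(1)
    by (metis M.add.r_cancel_one' R.l_zero R.zero_closed smult_closed)
  have l_minus: "(\<ominus>\<^bsub>R\<^esub> b) \<odot>\<^bsub>M\<^esub> v = \<ominus>\<^bsub>M\<^esub> (b \<odot>\<^bsub>M\<^esub> v)" if "b \<in> carrier R" for b
    using smult_l_distr[of "\<ominus>\<^bsub>R\<^esub> b" b v] that v(1) l_null
    by (metis M.minus_equality R.a_inv_closed R.l_neg smult_closed)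
  define W where "W = (\<lambda>b. b \<odot>\<^bsub>M\<^esub> v) ` carrier R"
  have "submodule W R M"
  proof (intro submodule.intro submodule_axioms.intro subgroup.intro)
    show "W \<subseteq> carrier (add_monoid M)" using v by (auto simp: W_def)
    show "x \<otimes>\<^bsub>add_monoid M\<^esub> y \<in> W" if "x \<in> W" "y \<in> W" for x y
      using that v by (auto simp: W_def simp flip: smult_l_distr)
    show "\<one>\<^bsub>add_monoid M\<^esub> \<in> W"
      using l_null by (auto simp: W_def intro!: image_eqI[where x = "\<zero>\<^bsub>R\<^esub>"])
    show "inv\<^bsub>add_monoid M\<^esub> x \<in> W" if "x \<in> W" for x
      using that by (auto simp: W_def simp flip: a_inv_def l_minus)
    show "a \<odot>\<^bsub>M\<^esub> x \<in> W" if "a \<in> carrier R" "x \<in> W" for a x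
      using that v by (auto simp: W_def simp flip: smult_assoc1)
  qed
  moreover have "v \<in> W"
    using v by (auto simp: W_def intro!: image_eqI[where x = "\<one>\<^bsub>R\<^esub>"])
  ultimately have W: "W = carrier M"
    using submodule_trivial v(2) by blast
  have inj: "inj_on \<psi> (carrier M)"
  proof (rule inj_onI)
    fix x y assume xy: "x \<in> carrier M" "y \<in> carrier M" "\<psi> x = \<psi> y"
    from xy(1) obtain b where "b \<in> carrier R" "b \<odot>\<^bsub>M\<^esub> v = x"
      by (auto simp: W_def simp flip: W)
    then have "b \<in> \<psi> x" and b: "b \<odot>\<^bsub>M\<^esub> v = x" by (simp_all add: \<psi>_def)
    then have "b \<in> \<psi> y" using xy(3) by simp
    then show "x = y" using b by (simp add: \<psi>_def)
  qed
  define \<phi> where "\<phi> = the_inv_into (carrier M) \<psi>"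
  have \<phi>: "\<phi> (\<psi> x) = x" if "x \<in> carrier M" for x
    using the_inv_into_f_f[OF inj that] by (simp add: \<phi>_def)
  define N :: "('a, 'a set) module" where
    "N = \<lparr>carrier = \<psi> ` carrier M, mult = undefined, one = undefined, zero = \<psi> \<zero>\<^bsub>M\<^esub>,
      add = (\<lambda>s t. \<psi> (\<phi> s \<oplus>\<^bsub>M\<^esub> \<phi> t)), smult = (\<lambda>a s. \<psi> (a \<odot>\<^bsub>M\<^esub> \<phi> s))\<rparr>"
  have "simple_module R N" and "annihilator R N = annihilator R M"
    by (rule simple_module_transport[OF simple inj]; simp add: N_def \<phi>)+
  then show ?thesis
    unfolding primitive_ideal_def by metis
qed

end

theory Submission
  imports Defs "HOL.Topological_Spaces" "HOL-Library.Multiset_Order" "HOL-Library.Product_Lexorder"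
begin

text \<open>
  Let \<open>x\<^sub>1, \<dots>, x\<^sub>d\<close> span \<open>\<gg>\<close>. On a module generated by \<open>v\<close> over \<open>B\<close> and a commutative domain \<open>A\<close> commuting
  with \<open>B\<close>, the ordered monomials \<open>x\<^sup>a v\<close> span over \<open>A\<close>, and \<open>p x\<^sup>a v\<close> being a combination of smaller
  monomials is inherited by all multiples of \<open>x\<^sup>a\<close>, because reordering a product only costs shorter
  products. By Dickson's lemma a single \<open>h \<noteq> 0\<close> in \<open>A\<close> witnesses every such relation, so after inverting
  \<open>h\<close> the module is free on the remaining monomials (generic freeness).

  Let \<open>\<phi>\<close> be the action of \<open>X\<close> on a simple \<open>B[X]\<close>-module and \<open>A = k[X]\<close>. If \<open>\<phi>\<close> is not algebraic, every
  non-zero \<open>q(\<phi>)\<close> is bijective, so every non-zero \<open>q\<close> divides a power of \<open>h\<close>; but \<open>1 + X h\<close> does not.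

  With \<open>A = k\<close> the same argument shows that \<open>B\<close> is left noetherian. For a prime \<open>P\<close>, the Rabinowitsch
  trick makes the intersection of the primitive ideals containing \<open>P\<close> nil modulo \<open>P\<close>, and by Utumi's
  argument a prime left noetherian ring has no non-zero nil ideal.
\<close>

section \<open>Spans in left modules\<close>

text \<open>The arguments concern a module \<open>V\<close> together with a stable submodule
  \<open>N\<close> instead of \<open>V / N\<close>. One text then serves \<open>N = 0\<close>
  (simple modules), \<open>N\<close> a maximal left ideal of \<open>B[X]\<close> (Rabinowitsch
  trick) and \<open>N\<close> a left ideal of \<open>B\<close> (noetherianity). A quotient module is
  built only once, to exhibit a primitive ideal.

  The obstacle in the first claim is that \<open>k\<close> is arbitrary. Generic freeness supplies
  the missing finiteness: that field would have to arise from \<open>k[X]\<close> by inverting a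
  single \<open>h\<close>. The polynomial \<open>1 + X h\<close> refutes this over every field,
  finite ones included, being coprime to \<open>h\<close> and of positive degree.

  The trick yields a module that is simple over \<open>B[X]\<close>, whereas primitive ideals need
  modules that are simple over \<open>B\<close>. Algebraicity of \<open>X\<close> bridges the gap:
  the module is finitely generated over \<open>B\<close>, hence has maximal
  \<open>B\<close>-submodules, and the information lost in passing to one of them is recovered from
  the largest \<open>X\<close>-stable submodule inside it.\<close>

lemma (in abelian_group) eq_if_diff_zero:
  assumes "a \<ominus> b = \<zero>" "a \<in> carrier G" "b \<in> carrier G"
  shows "a = b"
  using minus_equality[of a "\<ominus> b"] assms by (simp add: minus_eq)

lemma (in abelian_group) diff_add_diff:
  assumes "a \<in> carrier G" "b \<in> carrier G" "c \<in> carrier G" "d \<in> carrier G"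
  shows "(a \<ominus> b) \<oplus> (c \<ominus> d) = (a \<oplus> c) \<ominus> (b \<oplus> d)"
  using assms by (simp add: minus_eq minus_add a_ac)

context left_module
begin

lemma minus_zero_M [simp]: "\<ominus>\<^bsub>M\<^esub> \<zero>\<^bsub>M\<^esub> = \<zero>\<^bsub>M\<^esub>"
  by (rule M.minus_equality) auto

lemma smult_zero_left [simp]: "x \<in> carrier M \<Longrightarrow> \<zero> \<odot>\<^bsub>M\<^esub> x = \<zero>\<^bsub>M\<^esub>"
  using smult_l_distr[of \<zero> \<zero> x]
  by (metis M.add.r_cancel_one' R.l_zero R.zero_closed smult_closed)

lemma smult_zero_right [simp]: "a \<in> carrier R \<Longrightarrow> a \<odot>\<^bsub>M\<^esub> \<zero>\<^bsub>M\<^esub> = \<zero>\<^bsub>M\<^esub>"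
  using smult_r_distr[of a "\<zero>\<^bsub>M\<^esub>" "\<zero>\<^bsub>M\<^esub>"]
  by (metis M.add.r_cancel_one' M.l_zero M.zero_closed smult_closed)

lemma smult_minus_left:
  "\<lbrakk>a \<in> carrier R; x \<in> carrier M\<rbrakk> \<Longrightarrow> (\<ominus> a) \<odot>\<^bsub>M\<^esub> x = \<ominus>\<^bsub>M\<^esub> (a \<odot>\<^bsub>M\<^esub> x)"
  using smult_l_distr[of "\<ominus> a" a x]
  by (metis M.minus_equality R.a_inv_closed R.l_neg smult_closed smult_zero_left)

lemma smult_minus_right:
  "\<lbrakk>a \<in> carrier R; x \<in> carrier M\<rbrakk> \<Longrightarrow> a \<odot>\<^bsub>M\<^esub> (\<ominus>\<^bsub>M\<^esub> x) = \<ominus>\<^bsub>M\<^esub> (a \<odot>\<^bsub>M\<^esub> x)"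
  using smult_r_distr[of a "\<ominus>\<^bsub>M\<^esub> x" x]
  by (metis M.minus_equality M.a_inv_closed M.l_neg smult_closed smult_zero_right)

lemma smult_diff_left:
  "\<lbrakk>a \<in> carrier R; b \<in> carrier R; x \<in> carrier M\<rbrakk> \<Longrightarrow>
    (a \<ominus> b) \<odot>\<^bsub>M\<^esub> x = a \<odot>\<^bsub>M\<^esub> x \<ominus>\<^bsub>M\<^esub> b \<odot>\<^bsub>M\<^esub> x"
  by (simp add: R.minus_eq M.minus_eq smult_l_distr smult_minus_left)

lemma smult_diff_right:
  "\<lbrakk>a \<in> carrier R; x \<in> carrier M; y \<in> carrier M\<rbrakk> \<Longrightarrow>
    a \<odot>\<^bsub>M\<^esub> (x \<ominus>\<^bsub>M\<^esub> y) = a \<odot>\<^bsub>M\<^esub> x \<ominus>\<^bsub>M\<^esub> a \<odot>\<^bsub>M\<^esub> y"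
  by (simp add: M.minus_eq smult_r_distr smult_minus_right)

lemma submoduleI:
  assumes "N \<subseteq> carrier M" and "\<zero>\<^bsub>M\<^esub> \<in> N"
    and "\<And>x y. \<lbrakk>x \<in> N; y \<in> N\<rbrakk> \<Longrightarrow> x \<oplus>\<^bsub>M\<^esub> y \<in> N"
    and smult: "\<And>a x. \<lbrakk>a \<in> carrier R; x \<in> N\<rbrakk> \<Longrightarrow> a \<odot>\<^bsub>M\<^esub> x \<in> N"
  shows "submodule N R M"
proof (intro submodule.intro submodule_axioms.intro subgroup.intro)
  show "inv\<^bsub>add_monoid M\<^esub> x \<in> N" if "x \<in> N" for x
    using smult[of "\<ominus> \<one>" x] that assms(1) smult_minus_left[of \<one> x]
    by (auto simp flip: a_inv_def)
qed (use assms in auto)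

context
  fixes N
  assumes N: "submodule N R M"
begin

lemma submodule_subset: "N \<subseteq> carrier M"
  using subgroup.subset[OF submodule.axioms(1)[OF N]] by simp

lemma submodule_carrier: "x \<in> N \<Longrightarrow> x \<in> carrier M"
  using submodule_subset by blast

lemma submodule_zero: "\<zero>\<^bsub>M\<^esub> \<in> N"
  using subgroup.one_closed[OF submodule.axioms(1)[OF N]] by simp

lemma submodule_add: "\<lbrakk>x \<in> N; y \<in> N\<rbrakk> \<Longrightarrow> x \<oplus>\<^bsub>M\<^esub> y \<in> N"
  using subgroup.m_closed[OF submodule.axioms(1)[OF N]] by simp

lemma submodule_smult: "\<lbrakk>a \<in> carrier R; x \<in> N\<rbrakk> \<Longrightarrow> a \<odot>\<^bsub>M\<^esub> x \<in> N"
  by (rule submodule.smult_closed[OF N])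

lemma submodule_minus: "x \<in> N \<Longrightarrow> \<ominus>\<^bsub>M\<^esub> x \<in> N"
  using submodule_smult[of "\<ominus> \<one>" x] submodule_carrier smult_minus_left[of \<one> x] by auto

lemma submodule_diff: "\<lbrakk>x \<in> N; y \<in> N\<rbrakk> \<Longrightarrow> x \<ominus>\<^bsub>M\<^esub> y \<in> N"
  by (simp add: M.minus_eq submodule_add submodule_minus)

lemma submodule_diff_sym:
  assumes "x \<ominus>\<^bsub>M\<^esub> y \<in> N" "x \<in> carrier M" "y \<in> carrier M"
  shows "y \<ominus>\<^bsub>M\<^esub> x \<in> N"
proof -
  have "\<ominus>\<^bsub>M\<^esub> (x \<ominus>\<^bsub>M\<^esub> y) = y \<ominus>\<^bsub>M\<^esub> x"
    using assms by (simp add: M.minus_eq M.minus_add M.a_comm)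
  then show ?thesis using submodule_minus[OF assms(1)] by simp
qed

lemma submodule_diff_trans:
  assumes "x \<ominus>\<^bsub>M\<^esub> y \<in> N" "y \<ominus>\<^bsub>M\<^esub> z \<in> N" "x \<in> carrier M" "y \<in> carrier M" "z \<in> carrier M"
  shows "x \<ominus>\<^bsub>M\<^esub> z \<in> N"
proof -
  have "(x \<ominus>\<^bsub>M\<^esub> y) \<oplus>\<^bsub>M\<^esub> (y \<ominus>\<^bsub>M\<^esub> z) = x \<ominus>\<^bsub>M\<^esub> z"
    using assms by (simp add: M.minus_eq M.a_assoc M.r_neg1)
  then show ?thesis using submodule_add[OF assms(1,2)] by simp
qed

lemma submodule_diff_iff:
  assumes "x \<ominus>\<^bsub>M\<^esub> y \<in> N" "x \<in> carrier M" "y \<in> carrier M"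
  shows "x \<in> N \<longleftrightarrow> y \<in> N"
  using submodule_diff_trans[of x y "\<zero>\<^bsub>M\<^esub>"] submodule_diff_trans[of y x "\<zero>\<^bsub>M\<^esub>"]
    submodule_diff_sym assms
  by (auto simp: M.minus_eq minus_zero_M)

end

lemma submodule_carrier_self: "submodule (carrier M) R M"
  by (rule submoduleI) auto

lemma submodule_zero_set: "submodule {\<zero>\<^bsub>M\<^esub>} R M"
  by (rule submoduleI) auto

lemma lin_span_least: "\<lbrakk>submodule N R M; S \<subseteq> N\<rbrakk> \<Longrightarrow> lin_span R M S \<subseteq> N"
  by (auto simp: lin_span_def)

lemma lin_span_superset: "S \<subseteq> lin_span R M S"
  by (auto simp: lin_span_def)

lemma lin_span_mono: "S \<subseteq> T \<Longrightarrow> lin_span R M S \<subseteq> lin_span R M T"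
  by (auto simp: lin_span_def)

lemma submodule_lin_span:
  assumes "S \<subseteq> carrier M"
  shows "submodule (lin_span R M S) R M"
proof (rule submoduleI)
  show "lin_span R M S \<subseteq> carrier M"
    by (rule lin_span_least[OF submodule_carrier_self assms])
qed (auto simp: lin_span_def submodule_zero submodule_add submodule_smult)

lemma lin_span_induct [consumes 2, case_names base zero add smult]:
  assumes "S \<subseteq> carrier M" and y: "y \<in> lin_span R M S"
    and "\<And>s. s \<in> S \<Longrightarrow> P s" and "P \<zero>\<^bsub>M\<^esub>"
    and "\<And>x y. \<lbrakk>x \<in> carrier M; y \<in> carrier M; P x; P y\<rbrakk> \<Longrightarrow> P (x \<oplus>\<^bsub>M\<^esub> y)"
    and "\<And>a x. \<lbrakk>a \<in> carrier R; x \<in> carrier M; P x\<rbrakk> \<Longrightarrow> P (a \<odot>\<^bsub>M\<^esub> x)"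
  shows "P y"
proof -
  have "submodule {m \<in> carrier M. P m} R M"
    by (rule submoduleI) (use assms in auto)
  then have "lin_span R M S \<subseteq> {m \<in> carrier M. P m}"
    by (rule lin_span_least) (use assms in auto)
  then show ?thesis using y by auto
qed

lemma lin_span_insertE:
  assumes "s \<in> carrier M" "T \<subseteq> carrier M" "y \<in> lin_span R M (insert s T)"
  obtains a t where "a \<in> carrier R" "t \<in> lin_span R M T" "y = a \<odot>\<^bsub>M\<^esub> s \<oplus>\<^bsub>M\<^esub> t"
proof -
  note T = submodule_lin_span[OF assms(2)]
  note [simp] = submodule_carrier[OF T] submodule_zero[OF T]
  have "insert s T \<subseteq> carrier M" using assms by simp
  from this assms(3)
  have "\<exists>a \<in> carrier R. \<exists>t \<in> lin_span R M T. y = a \<odot>\<^bsub>M\<^esub> s \<oplus>\<^bsub>M\<^esub> t"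
  proof (induction rule: lin_span_induct)
    case (base u)
    show ?case
    proof (cases "u = s")
      case True
      then show ?thesis using assms(1) by (intro bexI[of _ \<one>] bexI[of _ "\<zero>\<^bsub>M\<^esub>"]) auto
    next
      case False
      then have "u \<in> lin_span R M T" using base lin_span_superset[of T] by auto
      then show ?thesis using assms(1) by (intro bexI[of _ \<zero>] bexI[of _ u]) auto
    qed
  next
    case zero
    show ?case using assms(1) by (intro bexI[of _ \<zero>] bexI[of _ "\<zero>\<^bsub>M\<^esub>"]) auto
  next
    case (add x y)
    then obtain a t b u where *: "a \<in> carrier R" "t \<in> lin_span R M T" "x = a \<odot>\<^bsub>M\<^esub> s \<oplus>\<^bsub>M\<^esub> t"
      "b \<in> carrier R" "u \<in> lin_span R M T" "y = b \<odot>\<^bsub>M\<^esub> s \<oplus>\<^bsub>M\<^esub> u" by blast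
    have "x \<oplus>\<^bsub>M\<^esub> y = (a \<oplus> b) \<odot>\<^bsub>M\<^esub> s \<oplus>\<^bsub>M\<^esub> (t \<oplus>\<^bsub>M\<^esub> u)"
      unfolding *(3,6) using *(1,2,4,5) assms(1) by (simp add: smult_l_distr M.a_ac)
    then show ?case using *(1,4) submodule_add[OF T *(2,5)] R.a_closed by blast
  next
    case (smult c x)
    then obtain a t where *: "a \<in> carrier R" "t \<in> lin_span R M T" "x = a \<odot>\<^bsub>M\<^esub> s \<oplus>\<^bsub>M\<^esub> t"
      by blast
    have "c \<odot>\<^bsub>M\<^esub> x = (c \<otimes> a) \<odot>\<^bsub>M\<^esub> s \<oplus>\<^bsub>M\<^esub> c \<odot>\<^bsub>M\<^esub> t"
      using smult_r_distr[OF smult(1) smult_closed[OF *(1) assms(1)] submodule_carrier[OF T *(2)]]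
        smult_assoc1[OF smult(1) *(1) assms(1)] *(3) by (simp only:)
    then show ?case using *(1) smult(1) submodule_smult[OF T smult(1) *(2)] R.m_closed by blast
  qed
  then show thesis by (elim bexE) (rule that)
qed

text \<open>Prepares the arguments on leading terms, which run by induction over a finite set of
  monomials.\<close>

lemma lin_span_finite_support:
  assumes "N \<subseteq> carrier M" "g ` S \<subseteq> carrier M" "y \<in> lin_span R M (N \<union> g ` S)"
  obtains F where "finite F" "F \<subseteq> S" "y \<in> lin_span R M (N \<union> g ` F)"
proof -
  have NS: "N \<union> g ` S \<subseteq> carrier M" using assms by simp
  have sm: "submodule (lin_span R M (N \<union> g ` F)) R M" if "F \<subseteq> S" for F
    by (rule submodule_lin_span) (use assms that in auto)
  from NS assms(3) have "\<exists>F. finite F \<and> F \<subseteq> S \<and> y \<in> lin_span R M (N \<union> g ` F)"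
  proof (induction rule: lin_span_induct)
    case (base s)
    then show ?case
    proof
      assume "s \<in> N"
      then have "s \<in> lin_span R M (N \<union> g ` {})" using lin_span_superset[of N] by auto
      then show ?thesis by (intro exI[of _ "{}"]) auto
    next
      assume "s \<in> g ` S"
      then obtain c where "c \<in> S" "s = g c" by auto
      then have "s \<in> lin_span R M (N \<union> g ` {c})" using lin_span_superset[of "N \<union> g ` {c}"] by auto
      then show ?thesis using \<open>c \<in> S\<close> by (intro exI[of _ "{c}"]) auto
    qed
  next
    case zero
    show ?case using submodule_zero[OF sm, of "{}"] by (intro exI[of _ "{}"]) auto
  next
    case (add x y)
    then obtain F G where *: "finite F" "F \<subseteq> S" "x \<in> lin_span R M (N \<union> g ` F)"
      "finite G" "G \<subseteq> S" "y \<in> lin_span R M (N \<union> g ` G)" by blast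
    have "x \<in> lin_span R M (N \<union> g ` (F \<union> G))" "y \<in> lin_span R M (N \<union> g ` (F \<union> G))"
      using *(3,6) lin_span_mono[of "N \<union> g ` F" "N \<union> g ` (F \<union> G)"]
        lin_span_mono[of "N \<union> g ` G" "N \<union> g ` (F \<union> G)"] by blast+
    then show ?case using * submodule_add[OF sm, of "F \<union> G" x y]
      by (intro exI[of _ "F \<union> G"]) auto
  next
    case (smult c x)
    then show ?case using submodule_smult[OF sm] by blast
  qed
  then show thesis by (elim exE conjE) (rule that)
qed

end

section \<open>Dickson's lemma\<close>

lemma nat_seq_mono_subseq:
  fixes s :: "nat \<Rightarrow> nat"
  obtains \<phi> :: "nat \<Rightarrow> nat" where "strict_mono \<phi>" "\<And>i j. i \<le> j \<Longrightarrow> s (\<phi> i) \<le> s (\<phi> j)"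
proof -
  obtain f where f: "strict_mono (f :: nat \<Rightarrow> nat)" "monoseq (\<lambda>n. s (f n))"
    using seq_monosub by blast
  from f(2) consider (inc) "\<forall>m. \<forall>n\<ge>m. s (f m) \<le> s (f n)" | (dec) "\<forall>m. \<forall>n\<ge>m. s (f n) \<le> s (f m)"
    by (auto simp: monoseq_def)
  then show thesis
  proof cases
    case inc
    then show ?thesis by (intro that[OF f(1)]) simp
  next
    case dec
    \<comment> \<open>A weakly decreasing sequence of naturals is constant from the place
      \<open>n0\<close> of its least value on, so shifting by \<open>n0\<close> makes it increasing
      as well.\<close>
    obtain n0 where n0: "\<And>m. s (f n0) \<le> s (f m)"
      using ex_has_least_nat[of "\<lambda>_. True" 0 "\<lambda>n. s (f n)"] by auto
    have eq: "s (f n) = s (f n0)" if "n \<ge> n0" for n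
      by (rule order_antisym[OF dec[rule_format, OF that] n0])
    have "strict_mono (\<lambda>n. f (n + n0))"
    proof (rule strict_monoI)
      fix x y :: nat
      assume "x < y"
      then show "f (x + n0) < f (y + n0)" by (intro strict_monoD[OF f(1)] add_strict_right_mono)
    qed
    then show ?thesis
    proof (rule that)
      show "s (f (i + n0)) \<le> s (f (j + n0))" for i j
        using eq[of "i + n0"] eq[of "j + n0"] by simp
    qed
  qed
qed

text \<open>Subsequences are extracted for one element of \<open>D\<close> after the other;
  multiplicities already made monotone stay so on passing to a further subsequence.\<close>

lemma multiset_seq_mono_subseq:
  fixes s :: "nat \<Rightarrow> 'x multiset"
  assumes "finite D" and s: "\<And>i. set_mset (s i) \<subseteq> D"
  obtains \<phi> :: "nat \<Rightarrow> nat" where "strict_mono \<phi>" "\<And>i j. i \<le> j \<Longrightarrow> s (\<phi> i) \<subseteq># s (\<phi> j)"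
proof -
  from assms(1)
  have "\<exists>\<phi> :: nat \<Rightarrow> nat. strict_mono \<phi> \<and> (\<forall>x \<in> D. \<forall>i j. i \<le> j \<longrightarrow> count (s (\<phi> i)) x \<le> count (s (\<phi> j)) x)"
  proof (induction D)
    case empty
    show ?case by (rule exI[of _ "\<lambda>i. i"]) (simp add: strict_mono_def)
  next
    case (insert x D)
    then obtain \<phi> :: "nat \<Rightarrow> nat" where \<phi>: "strict_mono \<phi>"
      "\<forall>x \<in> D. \<forall>i j. i \<le> j \<longrightarrow> count (s (\<phi> i)) x \<le> count (s (\<phi> j)) x" by blast
    obtain \<psi> :: "nat \<Rightarrow> nat" where \<psi>: "strict_mono \<psi>"
      "\<And>i j. i \<le> j \<Longrightarrow> count (s (\<phi> (\<psi> i))) x \<le> count (s (\<phi> (\<psi> j))) x"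
      using nat_seq_mono_subseq[of "\<lambda>n. count (s (\<phi> n)) x"] by blast
    have "strict_mono (\<phi> \<circ> \<psi>)" using \<phi>(1) \<psi>(1) by (rule strict_mono_o)
    then show ?case
    proof (intro exI conjI ballI allI impI)
      fix y and i j :: nat
      assume "y \<in> insert x D" "i \<le> j"
      moreover have "\<psi> i \<le> \<psi> j" using \<psi>(1) \<open>i \<le> j\<close> by (simp add: strict_mono_less_eq)
      ultimately show "count (s ((\<phi> \<circ> \<psi>) i)) y \<le> count (s ((\<phi> \<circ> \<psi>) j)) y"
        using \<phi>(2) \<psi>(2)[of i j] by auto
    qed
  qed
  then obtain \<phi> :: "nat \<Rightarrow> nat" where \<phi>: "strict_mono \<phi>"
    "\<And>x i j. \<lbrakk>x \<in> D; i \<le> j\<rbrakk> \<Longrightarrow> count (s (\<phi> i)) x \<le> count (s (\<phi> j)) x" by blast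
  have "s (\<phi> i) \<subseteq># s (\<phi> j)" if "i \<le> j" for i j
  proof (rule mset_subset_eqI)
    fix x
    show "count (s (\<phi> i)) x \<le> count (s (\<phi> j)) x"
    proof (cases "x \<in> D")
      case False
      then have "x \<notin># s (\<phi> i)" using s by blast
      then show ?thesis by (simp add: not_in_iff)
    qed (use \<phi>(2) that in auto)
  qed
  with \<phi>(1) show thesis by (rule that)
qed

corollary dickson_sequence:
  fixes s :: "nat \<Rightarrow> 'x multiset"
  assumes "finite D" "\<And>i. set_mset (s i) \<subseteq> D"
  obtains i j :: nat where "i < j" "s i \<subseteq># s j"
proof -
  obtain \<phi> :: "nat \<Rightarrow> nat" where "strict_mono \<phi>" "\<And>i j. i \<le> j \<Longrightarrow> s (\<phi> i) \<subseteq># s (\<phi> j)"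
    using multiset_seq_mono_subseq[where s = s, OF assms] by blast
  then show thesis using that[of "\<phi> 0" "\<phi> 1"] by (simp add: strict_mono_less)
qed

text \<open>The basis consists of the minimal elements of \<open>U\<close>. They form an antichain,
  and \<open>dickson_sequence\<close> forbids an infinite one.\<close>

lemma dickson_finite_basis:
  fixes U :: "'x multiset set"
  assumes "finite D" "\<And>a. a \<in> U \<Longrightarrow> set_mset a \<subseteq> D"
  obtains F where "finite F" "F \<subseteq> U" "\<And>a. a \<in> U \<Longrightarrow> \<exists>b \<in> F. b \<subseteq># a"
proof -
  define F where "F = {a \<in> U. \<forall>b \<in> U. b \<subseteq># a \<longrightarrow> b = a}"
  have "finite F"
  proof (rule ccontr)
    assume "infinite F"
    then obtain s :: "nat \<Rightarrow> 'x multiset" where s: "inj s" "range s \<subseteq> F"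
      using infinite_countable_subset by blast
    then have "set_mset (s i) \<subseteq> D" for i using assms(2) by (auto simp: F_def)
    then obtain i j where ij: "i < j" "s i \<subseteq># s j"
      by (rule dickson_sequence[OF assms(1)])
    have "s i \<in> F" "s j \<in> F" using s(2) by auto
    then have "s i = s j" using ij(2) unfolding F_def by blast
    then show False using injD[OF s(1)] ij(1) by blast
  qed
  moreover have "\<exists>b \<in> F. b \<subseteq># a" if "a \<in> U" for a
    using that
  proof (induction a rule: measure_induct_rule[where f = size])
    case (less a)
    show ?case
    proof (cases "a \<in> F")
      case False
      then obtain b where b: "b \<in> U" "b \<subset># a"
        using less.prems unfolding F_def by (auto simp: subset_mset.less_le)
      then obtain c where "c \<in> F" "c \<subseteq># b" using less.IH[of b] mset_subset_size by blast
      then show ?thesis using b(2) subset_mset.order_trans[of c b a] by (auto simp: subset_mset.less_le)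
    qed auto
  qed
  moreover have "F \<subseteq> U" by (auto simp: F_def)
  ultimately show thesis using that by blast
qed

text \<open>Ascending chain condition for upward closed sets of exponents, the combinatorial source
  of noetherianity. In a strictly ascending chain pick \<open>s i\<close> new at stage
  \<open>i + 1\<close>; a divisibility \<open>s i \<subseteq># s j\<close> with \<open>i < j\<close>
  would put \<open>s j\<close> into stage \<open>j\<close> already.\<close>

lemma dickson_maximal:
  fixes \<U> :: "'x multiset set set"
  assumes "finite D" and D: "\<And>U a. \<lbrakk>U \<in> \<U>; a \<in> U\<rbrakk> \<Longrightarrow> set_mset a \<subseteq> D"
    and up: "\<And>U a b. \<lbrakk>U \<in> \<U>; a \<in> U; a \<subseteq># b; set_mset b \<subseteq> D\<rbrakk> \<Longrightarrow> b \<in> U"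
    and ne: "U0 \<in> \<U>"
  obtains U where "U \<in> \<U>" "\<And>V. \<lbrakk>V \<in> \<U>; U \<subseteq> V\<rbrakk> \<Longrightarrow> V = U"
proof -
  let ?r = "{(V, U). U \<in> \<U> \<and> V \<in> \<U> \<and> U \<subset> V}"
  have "wf ?r"
    unfolding wf_iff_no_infinite_down_chain
  proof
    assume "\<exists>f. \<forall>i. (f (Suc i), f i) \<in> ?r"
    then obtain f where "\<forall>i. (f (Suc i), f i) \<in> ?r" ..
    then have f: "f i \<in> \<U>" "f i \<subset> f (Suc i)" for i by auto
    have mono: "f i \<subseteq> f j" if "i \<le> j" for i j
      by (rule lift_Suc_mono_le[OF _ that]) (rule psubset_imp_subset[OF f(2)])
    have "\<forall>i. \<exists>a. a \<in> f (Suc i) \<and> a \<notin> f i" using f(2) by blast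
    from choice[OF this] obtain s where "\<forall>i. s i \<in> f (Suc i) \<and> s i \<notin> f i" ..
    then have s: "s i \<in> f (Suc i)" "s i \<notin> f i" for i by auto
    have sD: "set_mset (s i) \<subseteq> D" for i using D f(1) s(1) by blast
    obtain i j where ij: "i < j" "s i \<subseteq># s j"
      by (rule dickson_sequence[where s = s, OF assms(1) sD])
    have "s i \<in> f j" using mono[of "Suc i" j] s(1) ij(1) by auto
    then have "s j \<in> f j" using up[OF f(1) _ ij(2) sD] by blast
    then show False using s(2) by blast
  qed
  then have "\<exists>U \<in> \<U>. \<forall>V. (V, U) \<in> ?r \<longrightarrow> V \<notin> \<U>"
    using ne unfolding wf_eq_minimal by blast
  then obtain U where U: "U \<in> \<U>" "\<forall>V. (V, U) \<in> ?r \<longrightarrow> V \<notin> \<U>" ..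
  have "V = U" if "V \<in> \<U>" "U \<subseteq> V" for V
    using U that by blast
  with U(1) show thesis by (rule that)
qed

section \<open>Almost commuting operators\<close>

text \<open>Abstracts from \<open>B\<close>: only the operators by which a spanning family of
  \<open_g> acts are kept, and they are linear over the commutative domain \<open>R\<close>. The
  commutator condition is pointwise, which is weaker than a fixed expression of the commutator but
  enough for rewriting words.\<close>

locale almost_commuting = R?: domain R + left_module R M
  for R (structure) and M (structure) +
  fixes d :: nat and x :: "nat \<Rightarrow> 'c \<Rightarrow> 'c"
  assumes x_closed [simp]: "\<lbrakk>i < d; m \<in> carrier M\<rbrakk> \<Longrightarrow> x i m \<in> carrier M"
    and x_add: "\<lbrakk>i < d; m \<in> carrier M; n \<in> carrier M\<rbrakk> \<Longrightarrow> x i (m \<oplus>\<^bsub>M\<^esub> n) = x i m \<oplus>\<^bsub>M\<^esub> x i n"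
    and x_smult: "\<lbrakk>i < d; p \<in> carrier R; m \<in> carrier M\<rbrakk> \<Longrightarrow> x i (p \<odot>\<^bsub>M\<^esub> m) = p \<odot>\<^bsub>M\<^esub> x i m"
    and x_commutator: "\<lbrakk>i < d; j < d; m \<in> carrier M\<rbrakk> \<Longrightarrow>
      x i (x j m) \<ominus>\<^bsub>M\<^esub> x j (x i m) \<in> lin_span R M ((\<lambda>l. x l m) ` {..<d})"
begin

lemma x_zero [simp]: "i < d \<Longrightarrow> x i \<zero>\<^bsub>M\<^esub> = \<zero>\<^bsub>M\<^esub>"
  using x_smult[of i \<zero> "\<zero>\<^bsub>M\<^esub>"] by simp

lemma x_diff:
  assumes "i < d" "m \<in> carrier M" "n \<in> carrier M"
  shows "x i (m \<ominus>\<^bsub>M\<^esub> n) = x i m \<ominus>\<^bsub>M\<^esub> x i n"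
proof -
  have "x i (\<ominus>\<^bsub>M\<^esub> n) = \<ominus>\<^bsub>M\<^esub> x i n"
    using x_smult[of i "\<ominus> \<one>" n] assms by (simp add: smult_minus_left)
  then show ?thesis using assms by (simp add: M.minus_eq x_add)
qed

definition act :: "nat list \<Rightarrow> 'c \<Rightarrow> 'c" where
  "act is = foldr x is"

lemma act_simps [simp]: "act [] v = v" "act (i # is) v = x i (act is v)"
  by (simp_all add: act_def)

lemma act_closed [simp]: "\<lbrakk>set is \<subseteq> {..<d}; v \<in> carrier M\<rbrakk> \<Longrightarrow> act is v \<in> carrier M"
  by (induction "is") auto

end

text \<open>
  Throughout, monomials \<open>x\<^sub>1\<^bsup>a\<^sub>1\<^esup> \<dots> x\<^sub>d\<^bsup>a\<^sub>d\<^esup> v\<close> are indexed by multisets of generators and ordered by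
  \<open>(size a, a)\<close>: the multiset order is a total order compatible with addition, and putting the size
  first makes lower terms of commutators small.
\<close>

locale stable_submodule = almost_commuting +
  fixes v and N
  assumes v_closed [simp]: "v \<in> carrier M"
    and N: "submodule N R M"
    and N_stable: "\<lbrakk>i < d; m \<in> N\<rbrakk> \<Longrightarrow> x i m \<in> N"
begin

section \<open>Rewriting words as ordered monomials, in the manner of Poincare, Birkhoff and
  Witt\<close>

definition words :: "nat \<Rightarrow> 'c set" where
  "words n = {act is v | is. set is \<subseteq> {..<d} \<and> length is < n}"

definition mon :: "nat multiset \<Rightarrow> 'c" where
  "mon a = act (sorted_list_of_multiset a) v"

definition exps :: "nat multiset set" where
  "exps = {a. set_mset a \<subseteq> {..<d}}"

definition smaller :: "nat multiset \<Rightarrow> nat multiset set" where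
  "smaller a = {b \<in> exps. (size b, b) < (size a, a)}"

definition below :: "nat multiset \<Rightarrow> 'c set" where
  "below a = lin_span R M (N \<union> mon ` smaller a)"

text \<open>The length filtration modulo \<open>N\<close>. The bound in \<open>words\<close> is
  strict, so \<open>W 0\<close> is \<open>N\<close> and \<open>W n\<close> collects the admissible
  errors when words of length exactly \<open>n\<close> are compared.\<close>

definition W :: "nat \<Rightarrow> 'c set" where
  "W n = lin_span R M (N \<union> words n)"

lemma mon_closed [simp]: "a \<in> exps \<Longrightarrow> mon a \<in> carrier M"
  by (simp add: mon_def exps_def)

lemma words_closed: "words n \<subseteq> carrier M"
  by (auto simp: words_def)

lemma smaller_closed: "mon ` smaller a \<subseteq> carrier M"
  by (auto simp: smaller_def)

lemma N_closed: "N \<subseteq> carrier M"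
  by (rule submodule_subset[OF N])

lemma submodule_below: "submodule (below a) R M"
  unfolding below_def using N_closed smaller_closed by (intro submodule_lin_span) simp

lemma submodule_W: "submodule (W n) R M"
  unfolding W_def using N_closed words_closed by (intro submodule_lin_span) simp

lemma smaller_mono:
  assumes "(size a, a) \<le> (size b, b)"
  shows "smaller a \<subseteq> smaller b"
proof
  fix c assume "c \<in> smaller a"
  then have c: "c \<in> exps" "(size c, c) < (size a, a)" unfolding smaller_def by blast+
  then show "c \<in> smaller b" using order.strict_trans2[OF c(2) assms] unfolding smaller_def by blast
qed

lemma below_mono: "(size a, a) \<le> (size b, b) \<Longrightarrow> below a \<subseteq> below b"
  unfolding below_def by (rule lin_span_mono[OF Un_mono[OF order_refl image_mono[OF smaller_mono]]])

lemma mon_in_below: "\<lbrakk>b \<in> exps; (size b, b) < (size a, a)\<rbrakk> \<Longrightarrow> mon b \<in> below a"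
  unfolding below_def smaller_def by (rule subsetD[OF lin_span_superset]) blast

lemma N_below: "N \<subseteq> below a"
  unfolding below_def by (rule order_trans[OF Un_upper1 lin_span_superset])

lemma N_W: "N \<subseteq> W n"
  unfolding W_def by (rule order_trans[OF Un_upper1 lin_span_superset])

lemma act_in_W: "\<lbrakk>set is \<subseteq> {..<d}; length is < n\<rbrakk> \<Longrightarrow> act is v \<in> W n"
  unfolding W_def words_def by (rule subsetD[OF lin_span_superset]) blast

lemma x_lin_span:
  assumes "i < d" and S: "S \<subseteq> carrier M" and T: "submodule T R M"
    and ST: "\<And>s. s \<in> S \<Longrightarrow> x i s \<in> T"
    and m: "m \<in> lin_span R M S"
  shows "x i m \<in> T"
  using S m
proof (induction rule: lin_span_induct)
  case zero
  show ?case using submodule_zero[OF T] assms(1) by simp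
next
  case (add y z)
  then show ?case using submodule_add[OF T] assms(1) by (simp add: x_add)
next
  case (smult c y)
  then show ?case using submodule_smult[OF T] assms(1) by (simp add: x_smult)
qed (rule ST)

lemma x_W:
  assumes "i < d" "m \<in> W n"
  shows "x i m \<in> W (Suc n)"
proof (rule x_lin_span[OF assms(1) _ submodule_W])
  show "N \<union> words n \<subseteq> carrier M" using N_closed words_closed by simp
  show "m \<in> lin_span R M (N \<union> words n)" using assms(2) by (simp add: W_def)
  fix s assume "s \<in> N \<union> words n"
  then show "x i s \<in> W (Suc n)"
  proof
    assume "s \<in> N"
    then have "x i s \<in> N" by (rule N_stable[OF assms(1)])
    then show ?thesis using N_W by blast
  next
    assume "s \<in> words n"
    then obtain "is" where "set is \<subseteq> {..<d}" "length is < n" "s = act is v"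
      by (auto simp: words_def)
    then show ?thesis using act_in_W[of "i # is" "Suc n"] assms(1) by simp
  qed
qed

text \<open>A commutator costs one letter: it replaces two generators by a combination of single
  ones, so the error consists of words of length \<open>length is + 1\<close>.\<close>

lemma swap_W:
  assumes "i < d" "j < d" "set is \<subseteq> {..<d}"
  shows "act (i # j # is) v \<ominus>\<^bsub>M\<^esub> act (j # i # is) v \<in> W (Suc (Suc (length is)))"
proof -
  have "(\<lambda>l. x l (act is v)) ` {..<d} \<subseteq> W (Suc (Suc (length is)))"
    using act_in_W[of "l # is" "Suc (Suc (length is))" for l] assms(3) by auto
  then have "lin_span R M ((\<lambda>l. x l (act is v)) ` {..<d}) \<subseteq> W (Suc (Suc (length is)))"
    by (rule lin_span_least[OF submodule_W])
  then show ?thesis using x_commutator[of i j "act is v"] assms by auto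
qed

text \<open>The letter \<open>i\<close> travels to the front by successive swaps; the error of each
  swap is multiplied by the letters to its left and keeps its defect of one in length.\<close>

lemma move_W:
  assumes "i < d" "set is \<subseteq> {..<d}" "set js \<subseteq> {..<d}"
  shows "act (is @ i # js) v \<ominus>\<^bsub>M\<^esub> act (i # is @ js) v \<in> W (Suc (length is + length js))"
  using assms(2)
proof (induction "is")
  case Nil
  show ?case using submodule_zero[OF submodule_W] assms by (simp add: M.minus_eq M.r_neg)
next
  case (Cons k ks)
  let ?n = "Suc (length (k # ks) + length js)"
  let ?u = "act (ks @ i # js) v" and ?w = "act (i # ks @ js) v"
  have c: "?u \<in> carrier M" "?w \<in> carrier M" "act (k # i # ks @ js) v \<in> carrier M"
    "act (i # k # ks @ js) v \<in> carrier M"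
    using Cons.prems assms by simp_all
  have "x k (?u \<ominus>\<^bsub>M\<^esub> ?w) \<in> W ?n"
    using x_W[OF _ Cons.IH] Cons.prems by simp
  then have "act (k # ks @ i # js) v \<ominus>\<^bsub>M\<^esub> act (k # i # ks @ js) v \<in> W ?n"
    using c Cons.prems by (simp add: x_diff del: append.simps)
  moreover have "act (k # i # ks @ js) v \<ominus>\<^bsub>M\<^esub> act (i # k # ks @ js) v \<in> W ?n"
    using swap_W[of k i "ks @ js"] Cons.prems assms by simp
  ultimately have "act (k # ks @ i # js) v \<ominus>\<^bsub>M\<^esub> act (i # k # ks @ js) v \<in> W ?n"
    by (rule submodule_diff_trans[OF submodule_W]) (use c Cons.prems in simp_all)
  then show ?case by simp
qed

text \<open>Induction on the first word: its head is located in the second one, brought to the front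
  by \<open>move_W\<close>, and the tails are compared recursively.\<close>

lemma permute_W:
  assumes "mset is = mset js" "set is \<subseteq> {..<d}"
  shows "act is v \<ominus>\<^bsub>M\<^esub> act js v \<in> W (length is)"
  using assms
proof (induction "is" arbitrary: js)
  case Nil
  then show ?case using submodule_zero[OF submodule_W] by (simp add: M.minus_eq M.r_neg)
next
  case (Cons i "is")
  have "i \<in> set js" using Cons.prems(1) by (metis list.set_intros(1) mset_eq_setD)
  then obtain us ws where js: "js = us @ i # ws" by (auto dest: split_list)
  have eq: "mset is = mset (us @ ws)" using Cons.prems(1) js by simp
  have d: "i < d" "set is \<subseteq> {..<d}" using Cons.prems(2) by simp_all
  have uw: "set us \<subseteq> {..<d}" "set ws \<subseteq> {..<d}" using mset_eq_setD[OF eq] d(2) by auto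
  have len: "length is = length us + length ws" using mset_eq_length[OF eq] by simp
  have c: "act is v \<in> carrier M" "act (us @ ws) v \<in> carrier M" "act (i # is) v \<in> carrier M"
    "act (i # us @ ws) v \<in> carrier M" "act js v \<in> carrier M"
    using d uw by (simp_all add: js)
  have "x i (act is v \<ominus>\<^bsub>M\<^esub> act (us @ ws) v) \<in> W (length (i # is))"
    using x_W[OF d(1) Cons.IH[OF eq d(2)]] by simp
  then have 1: "act (i # is) v \<ominus>\<^bsub>M\<^esub> act (i # us @ ws) v \<in> W (length (i # is))"
    using c(1,2) d(1) by (simp add: x_diff)
  have "act js v \<ominus>\<^bsub>M\<^esub> act (i # us @ ws) v \<in> W (length (i # is))"
    using move_W[OF d(1) uw] by (simp add: js len)
  then have 2: "act (i # us @ ws) v \<ominus>\<^bsub>M\<^esub> act js v \<in> W (length (i # is))"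
    using submodule_diff_sym[OF submodule_W] c(4,5) by blast
  show ?case by (rule submodule_diff_trans[OF submodule_W 1 2]) (rule c)+
qed

lemma act_mon:
  assumes "set is \<subseteq> {..<d}"
  shows "act is v \<ominus>\<^bsub>M\<^esub> mon (mset is) \<in> W (length is)"
  unfolding mon_def by (rule permute_W) (use assms in simp_all)

text \<open>Links the length filtration to the monomial order. A shorter word equals its sorted
  monomial up to still shorter words, and both are smaller since the key compares sizes
  first.\<close>

lemma W_below: "W (size a) \<subseteq> below a"
proof (induction "size a" arbitrary: a rule: less_induct)
  case less
  have "words (size a) \<subseteq> below a"
  proof
    fix w assume "w \<in> words (size a)"
    then obtain "is" where w: "set is \<subseteq> {..<d}" "length is < size a" "w = act is v"
      by (auto simp: words_def)
    have e: "mset is \<in> exps" using w(1) by (simp add: exps_def)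
    have lt: "(size (mset is), mset is) < (size a, a)" using w(2) by simp
    have "W (length is) \<subseteq> below (mset is)" using less.hyps[of "mset is"] w(2) by simp
    then have "act is v \<ominus>\<^bsub>M\<^esub> mon (mset is) \<in> below a"
      using act_mon[OF w(1)] below_mono[OF less_imp_le[OF lt]] by blast
    then show "w \<in> below a"
      using submodule_diff_iff[OF submodule_below] mon_in_below[OF e lt] e w by simp
  qed
  then show "W (size a) \<subseteq> below a"
    unfolding W_def using N_below by (intro lin_span_least[OF submodule_below]) simp
qed

text \<open>On leading terms the operators behave like commuting variables: \<open>x i\<close> adds
  \<open>i\<close> to the exponent.\<close>

lemma x_mon:
  assumes "i < d" "a \<in> exps"
  shows "x i (mon a) \<ominus>\<^bsub>M\<^esub> mon (add_mset i a) \<in> below (add_mset i a)"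
proof -
  have "set (i # sorted_list_of_multiset a) \<subseteq> {..<d}" using assms by (simp add: exps_def)
  from act_mon[OF this] have "x i (mon a) \<ominus>\<^bsub>M\<^esub> mon (add_mset i a) \<in> W (size (add_mset i a))"
    by (simp add: mon_def size_mset[symmetric] del: size_mset)
  then show ?thesis using W_below by blast
qed

lemma key_add_mset:
  "(size b, b) < (size a, a) \<Longrightarrow> (size (add_mset i b), add_mset i b) < (size (add_mset i a), add_mset i a)"
  by (auto simp: add_mset_lt_right_lt)

lemma x_below:
  assumes "i < d" "m \<in> below a"
  shows "x i m \<in> below (add_mset i a)"
proof (rule x_lin_span[OF assms(1) _ submodule_below])
  show "N \<union> mon ` smaller a \<subseteq> carrier M" using N_closed smaller_closed by simp
  show "m \<in> lin_span R M (N \<union> mon ` smaller a)" using assms(2) by (simp add: below_def)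
  fix s assume "s \<in> N \<union> mon ` smaller a"
  then show "x i s \<in> below (add_mset i a)"
  proof
    assume "s \<in> N"
    then have "x i s \<in> N" by (rule N_stable[OF assms(1)])
    then show ?thesis using N_below by blast
  next
    assume "s \<in> mon ` smaller a"
    then obtain b where b: "s = mon b" "b \<in> exps" "(size b, b) < (size a, a)"
      by (auto simp: smaller_def)
    note lt = key_add_mset[OF b(3), of i]
    have e: "add_mset i b \<in> exps" using b(2) assms(1) by (simp add: exps_def)
    have "x i s \<ominus>\<^bsub>M\<^esub> mon (add_mset i b) \<in> below (add_mset i a)"
      using x_mon[OF assms(1) b(2)] below_mono[OF less_imp_le[OF lt]] b(1) by blast
    then show ?thesis
      using submodule_diff_iff[OF submodule_below] mon_in_below[OF e lt] e b assms(1) by simp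
  qed
qed

section \<open>Leading exponents of \<open>N\<close> and generic freeness\<close>

lemma torsion_step:
  assumes "i < d" "a \<in> exps" "p \<in> carrier R" "p \<odot>\<^bsub>M\<^esub> mon a \<in> below a"
  shows "p \<odot>\<^bsub>M\<^esub> mon (add_mset i a) \<in> below (add_mset i a)"
proof -
  have e: "add_mset i a \<in> exps" using assms by (simp add: exps_def)
  have "p \<odot>\<^bsub>M\<^esub> x i (mon a) \<in> below (add_mset i a)"
    using x_below[OF assms(1,4)] assms by (simp add: x_smult)
  moreover have "p \<odot>\<^bsub>M\<^esub> x i (mon a) \<ominus>\<^bsub>M\<^esub> p \<odot>\<^bsub>M\<^esub> mon (add_mset i a) \<in> below (add_mset i a)"
    using submodule_smult[OF submodule_below assms(3) x_mon[OF assms(1,2)]] assms e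
    by (simp add: smult_diff_right)
  ultimately show ?thesis
    using submodule_diff_iff[OF submodule_below] assms e by simp
qed

text \<open>The coefficient \<open>p\<close> is the same for \<open>a\<close> and for all its
  multiples \<open>b\<close>. This uniformity is what lets finitely many witnesses, hence one
  product of them, serve all exponents.\<close>

lemma torsion_up:
  assumes "a \<subseteq># b" "b \<in> exps" "p \<in> carrier R" "p \<odot>\<^bsub>M\<^esub> mon a \<in> below a"
  shows "p \<odot>\<^bsub>M\<^esub> mon b \<in> below b"
proof -
  obtain c where b: "b = a + c" using assms(1) by (auto simp: subset_mset.le_iff_add)
  have "p \<odot>\<^bsub>M\<^esub> mon (a + c) \<in> below (a + c)" if "a + c \<in> exps" for c
    using that
  proof (induction c)
    case empty
    then show ?case using assms(4) by simp
  next
    case (add i c)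
    then have "i < d" "a + c \<in> exps" by (auto simp: exps_def)
    then show ?case using torsion_step[OF _ _ assms(3)] add.IH by simp
  qed
  then show ?thesis using assms(2) b by simp
qed

definition torsion :: "nat multiset set" where
  "torsion = {a \<in> exps. \<exists>p \<in> carrier R. p \<noteq> \<zero> \<and> p \<odot>\<^bsub>M\<^esub> mon a \<in> below a}"

lemma torsion_exps: "torsion \<subseteq> exps"
  by (auto simp: torsion_def)

lemma torsion_upclosed: "\<lbrakk>a \<in> torsion; a \<subseteq># b; b \<in> exps\<rbrakk> \<Longrightarrow> b \<in> torsion"
  using torsion_up unfolding torsion_def by blast

lemma free_torsion:
  assumes "a \<in> exps - torsion" "p \<in> carrier R" "p \<odot>\<^bsub>M\<^esub> mon a \<in> below a"
  shows "p = \<zero>"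
  using assms unfolding torsion_def by blast

lemma ex_common_annihilator:
  obtains h where "h \<in> carrier R" "h \<noteq> \<zero>" "\<And>a. a \<in> torsion \<Longrightarrow> h \<odot>\<^bsub>M\<^esub> mon a \<in> below a"
proof -
  have "set_mset a \<subseteq> {..<d}" if "a \<in> torsion" for a
    using that torsion_exps by (auto simp: exps_def)
  then obtain F where F: "finite F" "F \<subseteq> torsion" "\<And>a. a \<in> torsion \<Longrightarrow> \<exists>b \<in> F. b \<subseteq># a"
    \<comment> \<open>Witnesses are needed only for the minimal exponents in \<open>F\<close>; their
      product is non-zero because \<open>R\<close> is a domain.\<close>
    using dickson_finite_basis[OF finite_lessThan, of torsion d] by blast
  from F(1,2) have "\<exists>h \<in> carrier R. h \<noteq> \<zero> \<and> (\<forall>b \<in> F. h \<odot>\<^bsub>M\<^esub> mon b \<in> below b)"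
  proof (induction F)
    case empty
    show ?case by (rule bexI[of _ \<one>]) simp_all
  next
    case (insert b F)
    then obtain h where h: "h \<in> carrier R" "h \<noteq> \<zero>" "\<forall>c \<in> F. h \<odot>\<^bsub>M\<^esub> mon c \<in> below c" by auto
    obtain p where p: "p \<in> carrier R" "p \<noteq> \<zero>" "p \<odot>\<^bsub>M\<^esub> mon b \<in> below b"
      using insert.prems by (auto simp: torsion_def)
    have "(p \<otimes> h) \<odot>\<^bsub>M\<^esub> mon c \<in> below c" if "c \<in> insert b F" for c
    proof -
      have c: "c \<in> exps" using that insert.prems torsion_exps by auto
      show ?thesis
      proof (cases "c = b")
        case True
        have "(p \<otimes> h) \<odot>\<^bsub>M\<^esub> mon c = h \<odot>\<^bsub>M\<^esub> (p \<odot>\<^bsub>M\<^esub> mon c)"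
          using p(1) h(1) c by (simp add: m_comm[of p h] smult_assoc1)
        then show ?thesis using submodule_smult[OF submodule_below h(1) p(3)] True by simp
      next
        case False
        then have "h \<odot>\<^bsub>M\<^esub> mon c \<in> below c" using h(3) that by blast
        then show ?thesis
          using submodule_smult[OF submodule_below p(1)] p(1) h(1) c by (simp add: smult_assoc1)
      qed
    qed
    moreover have "p \<otimes> h \<noteq> \<zero>" using integral[of p h] p h by blast
    ultimately show ?case using p(1) h(1) by blast
  qed
  then obtain h where h: "h \<in> carrier R" "h \<noteq> \<zero>" "\<forall>b \<in> F. h \<odot>\<^bsub>M\<^esub> mon b \<in> below b" by blast
  show thesis
  proof (rule that[OF h(1,2)])
    fix a assume a: "a \<in> torsion"
    then obtain b where b: "b \<in> F" "b \<subseteq># a" using F(3) by blast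
    then show "h \<odot>\<^bsub>M\<^esub> mon a \<in> below a"
      using torsion_up[OF b(2) _ h(1)] h(3) a torsion_exps by blast
  qed
qed

text \<open>Multiplying a torsion monomial by \<open>h\<close> rewrites it through smaller ones.
  Since the order of monomials is well-founded, finitely many factors \<open>h\<close> remove all
  torsion monomials from an element.\<close>

lemma pow_mem_lin_span_free:
  assumes h: "h \<in> carrier R" "\<And>a. a \<in> torsion \<Longrightarrow> h \<odot>\<^bsub>M\<^esub> mon a \<in> below a"
    and m: "m \<in> lin_span R M (N \<union> mon ` exps)"
  obtains k :: nat where "h [^] k \<odot>\<^bsub>M\<^esub> m \<in> lin_span R M (N \<union> mon ` (exps - torsion))"
proof -
  define T where "T = lin_span R M (N \<union> mon ` (exps - torsion))"
  \<comment> \<open>The saturation of \<open>T\<close> with respect to \<open>h\<close>. It is a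
    submodule because \<open>R\<close> is commutative and two exponents of \<open>h\<close> can be
    added.\<close>
  define T' where "T' = {m \<in> carrier M. \<exists>k::nat. h [^] k \<odot>\<^bsub>M\<^esub> m \<in> T}"
  have T: "submodule T R M"
    unfolding T_def by (intro submodule_lin_span) (use N_closed in auto)
  have shift: "h [^] (k + l) \<odot>\<^bsub>M\<^esub> y \<in> T" if "h [^] k \<odot>\<^bsub>M\<^esub> y \<in> T" "y \<in> carrier M" for k l :: nat and y
  proof -
    have "h [^] (k + l) \<odot>\<^bsub>M\<^esub> y = h [^] l \<odot>\<^bsub>M\<^esub> (h [^] k \<odot>\<^bsub>M\<^esub> y)"
      using h(1) that(2) by (simp add: nat_pow_mult[symmetric] add.commute[of k l] smult_assoc1)
    then show ?thesis using submodule_smult[OF T _ that(1)] h(1) by simp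
  qed
  have TT': "T \<subseteq> T'"
  proof
    fix y assume y: "y \<in> T"
    then have "h [^] (0::nat) \<odot>\<^bsub>M\<^esub> y \<in> T" using submodule_carrier[OF T y] by simp
    then show "y \<in> T'" using submodule_carrier[OF T y] unfolding T'_def by blast
  qed
  have T': "submodule T' R M"
  proof (rule submoduleI)
    show "T' \<subseteq> carrier M" by (auto simp: T'_def)
    show "\<zero>\<^bsub>M\<^esub> \<in> T'" using submodule_zero[OF T] TT' by blast
  next
    fix y z assume yz: "y \<in> T'" "z \<in> T'"
    then obtain k l :: nat where kl: "h [^] k \<odot>\<^bsub>M\<^esub> y \<in> T" "h [^] l \<odot>\<^bsub>M\<^esub> z \<in> T"
      and c: "y \<in> carrier M" "z \<in> carrier M" by (auto simp: T'_def)
    have "h [^] (k + l) \<odot>\<^bsub>M\<^esub> (y \<oplus>\<^bsub>M\<^esub> z) \<in> T"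
      using submodule_add[OF T shift[OF kl(1) c(1), of l] shift[OF kl(2) c(2), of k]] h(1) c
      by (simp add: smult_r_distr add.commute[of l k])
    then show "y \<oplus>\<^bsub>M\<^esub> z \<in> T'" using c unfolding T'_def by blast
  next
    fix p y assume p: "p \<in> carrier R" and "y \<in> T'"
    then obtain k :: nat where k: "h [^] k \<odot>\<^bsub>M\<^esub> y \<in> T" and y: "y \<in> carrier M" by (auto simp: T'_def)
    have "h [^] k \<odot>\<^bsub>M\<^esub> (p \<odot>\<^bsub>M\<^esub> y) = p \<odot>\<^bsub>M\<^esub> (h [^] k \<odot>\<^bsub>M\<^esub> y)"
      using p y h(1) by (simp add: smult_assoc1[symmetric] m_comm[of p])
    then have "h [^] k \<odot>\<^bsub>M\<^esub> (p \<odot>\<^bsub>M\<^esub> y) \<in> T" using submodule_smult[OF T p k] by simp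
    then show "p \<odot>\<^bsub>M\<^esub> y \<in> T'" using p y unfolding T'_def by blast
  qed
  have NT: "N \<union> mon ` (exps - torsion) \<subseteq> T" unfolding T_def by (rule lin_span_superset)
  have "mon a \<in> T'" if "a \<in> exps" for a
    using that
  proof (induction "(size a, a)" arbitrary: a rule: less_induct)
    case less
    show ?case
    proof (cases "a \<in> torsion")
      case False
      then show ?thesis using less.prems NT TT' by blast
    next
      case True
      have "mon b \<in> T'" if "b \<in> smaller a" for b
        by (rule less.hyps) (use that in \<open>auto simp only: smaller_def mem_Collect_eq\<close>)
      then have "below a \<subseteq> T'"
        unfolding below_def using NT TT' by (intro lin_span_least[OF T']) blast
      then have "h \<odot>\<^bsub>M\<^esub> mon a \<in> T'" using h(2)[OF True] by blast
      then obtain k :: nat where k: "h [^] k \<odot>\<^bsub>M\<^esub> (h \<odot>\<^bsub>M\<^esub> mon a) \<in> T" by (auto simp: T'_def)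
      have "h [^] Suc k \<odot>\<^bsub>M\<^esub> mon a \<in> T"
        using k h(1) less.prems by (simp add: smult_assoc1)
      then show ?thesis using mon_closed[OF less.prems] unfolding T'_def by blast
    qed
  qed
  then have "lin_span R M (N \<union> mon ` exps) \<subseteq> T'"
    using NT TT' by (intro lin_span_least[OF T']) blast
  then have "m \<in> T'" using m by blast
  then have "\<exists>k::nat. h [^] k \<odot>\<^bsub>M\<^esub> m \<in> T" unfolding T'_def by blast
  then obtain k :: nat where "h [^] k \<odot>\<^bsub>M\<^esub> m \<in> T" ..
  then show thesis unfolding T_def by (rule that)
qed

lemma mon_empty: "mon {#} = v"
  by (simp add: mon_def)

lemma submodule_span_mon: "submodule (lin_span R M (N \<union> mon ` exps)) R M"
  by (rule submodule_lin_span) (use N_closed in auto)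

text \<open>Shows that the span is stable under all operators, so that in the applications it is a
  module over the whole of \<open>B\<close> containing \<open>v\<close>.\<close>

lemma x_span_mon:
  assumes "i < d" "m \<in> lin_span R M (N \<union> mon ` exps)"
  shows "x i m \<in> lin_span R M (N \<union> mon ` exps)"
proof (rule x_lin_span[OF assms(1) _ submodule_span_mon _ assms(2)])
  show "N \<union> mon ` exps \<subseteq> carrier M" using N_closed by auto
  fix s assume "s \<in> N \<union> mon ` exps"
  then show "x i s \<in> lin_span R M (N \<union> mon ` exps)"
  proof
    assume "s \<in> N"
    then have "x i s \<in> N \<union> mon ` exps" using N_stable[OF assms(1)] by blast
    then show ?thesis by (rule subsetD[OF lin_span_superset])
  next
    assume "s \<in> mon ` exps"
    then obtain a where a: "s = mon a" "a \<in> exps" by blast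
    have e: "add_mset i a \<in> exps" using a(2) assms(1) by (simp add: exps_def)
    have "N \<union> mon ` smaller (add_mset i a) \<subseteq> N \<union> mon ` exps" unfolding smaller_def by blast
    then have "below (add_mset i a) \<subseteq> lin_span R M (N \<union> mon ` exps)"
      unfolding below_def by (rule lin_span_mono)
    then have "x i s \<ominus>\<^bsub>M\<^esub> mon (add_mset i a) \<in> lin_span R M (N \<union> mon ` exps)"
      using x_mon[OF assms(1) a(2)] a(1) by blast
    moreover have "mon (add_mset i a) \<in> lin_span R M (N \<union> mon ` exps)"
      by (rule subsetD[OF lin_span_superset]) (use e in blast)
    ultimately show ?thesis
      using submodule_diff_iff[OF submodule_span_mon] a e assms(1) by simp
  qed
qed

section \<open>Comparing leading coefficients of free monomials\<close>

lemma lin_span_below: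
  assumes "F \<subseteq> exps" "\<And>b. b \<in> F \<Longrightarrow> (size b, b) < (size a, a)"
  shows "lin_span R M (N \<union> mon ` F) \<subseteq> below a"
proof -
  have "b \<in> smaller a" if "b \<in> F" for b
    unfolding smaller_def using assms(1) assms(2)[OF that] that by blast
  then have "N \<union> mon ` F \<subseteq> N \<union> mon ` smaller a" by blast
  then show ?thesis unfolding below_def by (rule lin_span_mono)
qed

lemma lin_span_insert_mon:
  assumes "c \<in> exps" "F \<subseteq> exps" "y \<in> lin_span R M (N \<union> mon ` insert c F)"
  obtains p z where "p \<in> carrier R" "z \<in> lin_span R M (N \<union> mon ` F)" "y = p \<odot>\<^bsub>M\<^esub> mon c \<oplus>\<^bsub>M\<^esub> z"
proof (rule lin_span_insertE[of "mon c" "N \<union> mon ` F" y])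
  show "N \<union> mon ` F \<subseteq> carrier M" using assms N_closed by auto
qed (use assms that in auto)

lemma key_cases:
  fixes a b :: "nat multiset"
  obtains "a = b" | "(size a, a) < (size b, b)" | "(size b, b) < (size a, a)"
  using less_linear[of "(size a, a)" "(size b, b)"] by (elim disjE) (rule that; simp only: prod.inject)+

lemma add_sub_cancel:
  assumes "r \<in> carrier M" "s \<in> carrier M" "t \<in> carrier M"
  shows "r \<ominus>\<^bsub>M\<^esub> (s \<oplus>\<^bsub>M\<^esub> t) = (r \<ominus>\<^bsub>M\<^esub> s) \<ominus>\<^bsub>M\<^esub> t"
  using assms by (simp add: M.minus_eq M.minus_add M.a_assoc)

text \<open>Compare leading coefficients: the monomials outside the torsion are independent modulo \<open>N\<close>.\<close>

lemma free_divides: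
  assumes "finite F" "F \<subseteq> exps - torsion" "y \<in> lin_span R M (N \<union> mon ` F)"
    and a: "a \<in> exps - torsion" and rq: "r \<in> carrier R" "q \<in> carrier R" "q \<noteq> \<zero>"
    and "r \<odot>\<^bsub>M\<^esub> mon a \<ominus>\<^bsub>M\<^esub> q \<odot>\<^bsub>M\<^esub> y \<in> N"
  shows "\<exists>c \<in> carrier R. r = q \<otimes> c"
  using assms(1,2,3,8)
\<comment> \<open>Monomials are added in increasing order, so the newly inserted \<open>c\<close> is
  the leading exponent of \<open>y\<close>.\<close>
proof (induction arbitrary: y rule: finite_ranking_induct[where f = "\<lambda>b. (size b, b)"])
  case empty
  have "y \<in> N" using empty.prems(2) lin_span_least[OF N, of N] by auto
  then have "q \<odot>\<^bsub>M\<^esub> y \<in> N" by (rule submodule_smult[OF N rq(2)])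
  then have "r \<odot>\<^bsub>M\<^esub> mon a \<in> N"
    using submodule_diff_iff[OF N empty.prems(3)] submodule_carrier[OF N] rq a by simp
  then have "r = \<zero>" using free_torsion[OF a rq(1)] N_below by blast
  then show ?case using rq(2) by (intro bexI[of _ \<zero>]) auto
next
  case (insert c F)
  show ?case
  proof (cases "c \<in> F")
    case True
    then show ?thesis using insert.IH insert.prems by (simp add: insert_absorb)
  next
    case False
    have c: "c \<in> exps - torsion" "c \<in> exps" and F: "F \<subseteq> exps - torsion" "F \<subseteq> exps"
      using insert.prems(1) by auto
    have lt: "(size b, b) < (size c, c)" if "b \<in> F" for b
    proof -
      have "(size b, b) \<noteq> (size c, c)" using that False by auto
      then show ?thesis using insert.hyps(2)[OF that] by (rule order.not_eq_order_implies_strict)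
    qed
    obtain p z where pz: "p \<in> carrier R" "z \<in> lin_span R M (N \<union> mon ` F)"
      "y = p \<odot>\<^bsub>M\<^esub> mon c \<oplus>\<^bsub>M\<^esub> z"
      using lin_span_insert_mon[OF c(2) F(2) insert.prems(2)] by metis
    have zc: "z \<in> below c" using lin_span_below[OF F(2) lt] pz(2) by blast
    have z: "z \<in> carrier M" by (rule submodule_carrier[OF submodule_below zc])
    have a': "a \<in> exps" using a by blast
    have cc: "r \<odot>\<^bsub>M\<^esub> mon a \<in> carrier M" "(q \<otimes> p) \<odot>\<^bsub>M\<^esub> mon c \<in> carrier M" "q \<odot>\<^bsub>M\<^esub> z \<in> carrier M"
      using rq pz(1) z a' c(2) by simp_all
    have "q \<odot>\<^bsub>M\<^esub> y = (q \<otimes> p) \<odot>\<^bsub>M\<^esub> mon c \<oplus>\<^bsub>M\<^esub> q \<odot>\<^bsub>M\<^esub> z"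
      using rq(2) pz(1,3) z c(2) by (simp add: smult_r_distr smult_assoc1)
    then have N0: "(r \<odot>\<^bsub>M\<^esub> mon a \<ominus>\<^bsub>M\<^esub> (q \<otimes> p) \<odot>\<^bsub>M\<^esub> mon c) \<ominus>\<^bsub>M\<^esub> q \<odot>\<^bsub>M\<^esub> z \<in> N"
      using insert.prems(3) add_sub_cancel[OF cc] by simp
    have qz: "q \<odot>\<^bsub>M\<^esub> z \<in> below e" if "z \<in> below e" for e
      by (rule submodule_smult[OF submodule_below rq(2) that])
    have main: "r \<odot>\<^bsub>M\<^esub> mon a \<ominus>\<^bsub>M\<^esub> (q \<otimes> p) \<odot>\<^bsub>M\<^esub> mon c \<in> below e" if "z \<in> below e" for e
      using submodule_diff_iff[OF submodule_below, of "r \<odot>\<^bsub>M\<^esub> mon a \<ominus>\<^bsub>M\<^esub> (q \<otimes> p) \<odot>\<^bsub>M\<^esub> mon c" "q \<odot>\<^bsub>M\<^esub> z" e]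
        N0 N_below qz[OF that] cc by auto
    show ?thesis
    proof (cases rule: key_cases[of a c])
      \<comment> \<open>Both sides lead with the same free monomial, so the coefficients agree and
        \<open>p\<close> is the quotient.\<close>
      case 1
      then have "(r \<ominus> q \<otimes> p) \<odot>\<^bsub>M\<^esub> mon a \<in> below a"
        using main[OF zc] rq pz(1) a' by (simp add: smult_diff_left)
      then have "r \<ominus> q \<otimes> p = \<zero>" using free_torsion[OF a] rq pz(1) by simp
      then have "r = q \<otimes> p" by (rule R.eq_if_diff_zero) (use rq pz(1) in simp_all)
      then show ?thesis using pz(1) by blast
    next
      \<comment> \<open>The term at \<open>c\<close> would be the only leading one; freeness gives
        \<open>q \<otimes> p = \<zero>\<close>, hence \<open>p = \<zero>\<close>, and
        \<open>c\<close> drops out of \<open>y\<close>.\<close>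
      case 2
      have "r \<odot>\<^bsub>M\<^esub> mon a \<in> below c"
        using submodule_smult[OF submodule_below rq(1) mon_in_below[OF a' 2]] .
      then have "(q \<otimes> p) \<odot>\<^bsub>M\<^esub> mon c \<in> below c"
        using submodule_diff_iff[OF submodule_below main[OF zc] cc(1,2)] by blast
      then have "q \<otimes> p = \<zero>" using free_torsion[OF c(1)] rq pz(1) by simp
      from integral[OF this rq(2) pz(1)] have "p = \<zero>" using rq(3) by blast
      then have "y = z" using pz(3) z c(2) by simp
      then show ?thesis using insert.IH[OF F(1), of y] pz(2) insert.prems(3) by blast
    next
      \<comment> \<open>Now \<open>a\<close> exceeds every exponent in \<open>y\<close>, so
        \<open>r\<close> itself is a leading coefficient and vanishes.\<close>
      case 3
      have lta: "(size b, b) < (size a, a)" if "b \<in> F" for b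
        by (rule order.strict_trans[OF lt[OF that] 3])
      have za: "z \<in> below a" using lin_span_below[OF F(2) lta] pz(2) by blast
      have "(q \<otimes> p) \<odot>\<^bsub>M\<^esub> mon c \<in> below a"
        by (rule submodule_smult[OF submodule_below _ mon_in_below[OF c(2) 3]]) (use rq pz(1) in simp)
      then have "r \<odot>\<^bsub>M\<^esub> mon a \<in> below a"
        using submodule_diff_iff[OF submodule_below main[OF za] cc(1,2)] by blast
      then have "r = \<zero>" using free_torsion[OF a rq(1)] by blast
      then show ?thesis using rq(2) by (intro bexI[of _ \<zero>]) auto
    qed
  qed
qed

lemma free_closed: "mon ` (exps - torsion) \<subseteq> carrier M"
  by auto

text \<open>If all non-zero scalars act bijectively modulo \<open>N\<close>, solve
  \<open>mon a = q y\<close> modulo \<open>N\<close> for a fixed free exponent \<open>a\<close>. A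
  power of \<open>h\<close> moves \<open>y\<close> onto the free monomials, and comparing
  coefficients at \<open>a\<close> shows that \<open>q\<close> divides this power.\<close>

theorem divisible_imp_divides_power:
  assumes span: "carrier M = lin_span R M (N \<union> mon ` exps)" and proper: "N \<noteq> carrier M"
    and inj: "\<And>p m. \<lbrakk>p \<in> carrier R; p \<noteq> \<zero>; m \<in> carrier M; p \<odot>\<^bsub>M\<^esub> m \<in> N\<rbrakk> \<Longrightarrow> m \<in> N"
    and surj: "\<And>p m. \<lbrakk>p \<in> carrier R; p \<noteq> \<zero>; m \<in> carrier M\<rbrakk> \<Longrightarrow>
      \<exists>y \<in> carrier M. m \<ominus>\<^bsub>M\<^esub> p \<odot>\<^bsub>M\<^esub> y \<in> N"
  obtains h where "h \<in> carrier R" "h \<noteq> \<zero>"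
    "\<And>q. \<lbrakk>q \<in> carrier R; q \<noteq> \<zero>\<rbrakk> \<Longrightarrow> \<exists>k::nat. \<exists>c \<in> carrier R. h [^] k = q \<otimes> c"
proof -
  obtain h where h: "h \<in> carrier R" "h \<noteq> \<zero>" "\<And>a. a \<in> torsion \<Longrightarrow> h \<odot>\<^bsub>M\<^esub> mon a \<in> below a"
    using ex_common_annihilator by metis
  have hk: "h [^] k \<noteq> \<zero>" "h [^] k \<in> carrier R" for k :: nat
    using h(1,2) by (induction k) (auto dest: integral)
  \<comment> \<open>Without free monomials a power of \<open>h\<close> would send every
    \<open>m\<close> into \<open>N\<close>, and injectivity would give
    \<open>N = carrier M\<close>.\<close>
  have "exps - torsion \<noteq> {}"
  proof
    assume empty: "exps - torsion = {}"
    have "m \<in> N" if m: "m \<in> carrier M" for m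
    proof -
      from m have "m \<in> lin_span R M (N \<union> mon ` exps)" using span by simp
      from pow_mem_lin_span_free[OF h(1,3) this] obtain k :: nat
        where "h [^] k \<odot>\<^bsub>M\<^esub> m \<in> lin_span R M (N \<union> mon ` (exps - torsion))" by metis
      then have "h [^] k \<odot>\<^bsub>M\<^esub> m \<in> N" using lin_span_least[OF N, of N] empty by auto
      then show ?thesis using inj[OF hk(2,1) m] by blast
    qed
    then show False using proper N_closed by blast
  qed
  then obtain a where a: "a \<in> exps - torsion" by blast
  then have am: "mon a \<in> carrier M" by simp
  show thesis
  proof (rule that[OF h(1,2)])
    fix q assume q: "q \<in> carrier R" "q \<noteq> \<zero>"
    obtain y where y: "y \<in> carrier M" "mon a \<ominus>\<^bsub>M\<^esub> q \<odot>\<^bsub>M\<^esub> y \<in> N"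
      using surj[OF q am] by blast
    from y(1) have "y \<in> lin_span R M (N \<union> mon ` exps)" using span by simp
    from pow_mem_lin_span_free[OF h(1,3) this] obtain k :: nat
      where k: "h [^] k \<odot>\<^bsub>M\<^esub> y \<in> lin_span R M (N \<union> mon ` (exps - torsion))" by metis
    obtain F where F: "finite F" "F \<subseteq> exps - torsion"
      "h [^] k \<odot>\<^bsub>M\<^esub> y \<in> lin_span R M (N \<union> mon ` F)"
      using lin_span_finite_support[OF N_closed free_closed k] by metis
    have "h [^] k \<odot>\<^bsub>M\<^esub> (mon a \<ominus>\<^bsub>M\<^esub> q \<odot>\<^bsub>M\<^esub> y) \<in> N"
      by (rule submodule_smult[OF N hk(2) y(2)])
    moreover have "h [^] k \<odot>\<^bsub>M\<^esub> (mon a \<ominus>\<^bsub>M\<^esub> q \<odot>\<^bsub>M\<^esub> y) =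
        h [^] k \<odot>\<^bsub>M\<^esub> mon a \<ominus>\<^bsub>M\<^esub> q \<odot>\<^bsub>M\<^esub> (h [^] k \<odot>\<^bsub>M\<^esub> y)"
      using hk(2) q(1) y(1) am by (simp add: smult_diff_right smult_assoc1[symmetric] m_comm[of q])
    ultimately have "\<exists>c \<in> carrier R. h [^] k = q \<otimes> c"
      using free_divides[OF F a hk(2) q] by simp
    then show "\<exists>k::nat. \<exists>c \<in> carrier R. h [^] k = q \<otimes> c" by blast
  qed
qed

text \<open>Generic form of the fact that nested ideals with the same leading exponents coincide: an
  element of \<open>N'\<close> supported on monomials free for \<open>N\<close> has no possible
  leading term. The power of \<open>h\<close> is the price for reaching such support.\<close>

lemma torsion_subset_imp_power_mem:
  assumes N': "stable_submodule R M d x v N'" and "N \<subseteq> N'"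
    and sub: "stable_submodule.torsion R M d x v N' \<subseteq> torsion"
    and span: "carrier M = lin_span R M (N \<union> mon ` exps)"
  obtains h where "h \<in> carrier R" "h \<noteq> \<zero>" "\<And>y. y \<in> N' \<Longrightarrow> \<exists>k::nat. h [^] k \<odot>\<^bsub>M\<^esub> y \<in> N"
proof -
  interpret N': stable_submodule R M d x v N' by (rule N')
  have below: "below a \<subseteq> N'.below a" for a
    unfolding below_def N'.below_def by (rule lin_span_mono) (use \<open>N \<subseteq> N'\<close> in blast)
  have mem: "y \<in> N" if "finite F" "F \<subseteq> exps - torsion" "y \<in> lin_span R M (N \<union> mon ` F)" "y \<in> N'" for F y
    using that
  proof (induction arbitrary: y rule: finite_ranking_induct[where f = "\<lambda>b. (size b, b)"])
    case empty
    then show ?case using lin_span_least[OF N, of N] by auto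
  next
    case (insert c F)
    show ?case
    proof (cases "c \<in> F")
      case True
      then show ?thesis using insert.IH insert.prems by (simp add: insert_absorb)
    next
      case False
      have c: "c \<in> exps - torsion" "c \<in> exps" and F: "F \<subseteq> exps - torsion" "F \<subseteq> exps"
        using insert.prems(1) by auto
      have lt: "(size b, b) < (size c, c)" if "b \<in> F" for b
      proof -
        have "(size b, b) \<noteq> (size c, c)" using that False by auto
        then show ?thesis using insert.hyps(2)[OF that] by (rule order.not_eq_order_implies_strict)
      qed
      obtain p z where pz: "p \<in> carrier R" "z \<in> lin_span R M (N \<union> mon ` F)"
        "y = p \<odot>\<^bsub>M\<^esub> mon c \<oplus>\<^bsub>M\<^esub> z"
        using lin_span_insert_mon[OF c(2) F(2) insert.prems(2)] by metis
      have zc: "z \<in> below c" using lin_span_below[OF F(2) lt] pz(2) by blast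
      have z: "z \<in> carrier M" by (rule submodule_carrier[OF submodule_below zc])
      have "y \<ominus>\<^bsub>M\<^esub> z = p \<odot>\<^bsub>M\<^esub> mon c"
        using pz(1,3) z c(2) by (simp add: M.minus_eq M.a_assoc M.r_neg)
      moreover have "y \<ominus>\<^bsub>M\<^esub> z \<in> N'.below c"
        by (rule submodule_diff[OF N'.submodule_below]) (use insert.prems(3) N'.N_below zc below in blast)+
      ultimately have "p \<odot>\<^bsub>M\<^esub> mon c \<in> N'.below c" by simp
      \<comment> \<open>The exponent \<open>c\<close> is free for \<open>N\<close>, hence by
        \<open>sub\<close> also for \<open>N'\<close>.\<close>
      then have "p = \<zero>" using c sub pz(1) unfolding N'.torsion_def by blast
      then have "y = z" using pz(3) z c(2) by simp
      then show ?thesis using insert.IH[OF F(1), of y] pz(2) insert.prems(3) by simp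
    qed
  qed
  obtain h where h: "h \<in> carrier R" "h \<noteq> \<zero>" "\<And>a. a \<in> torsion \<Longrightarrow> h \<odot>\<^bsub>M\<^esub> mon a \<in> below a"
    using ex_common_annihilator by metis
  show thesis
  proof (rule that[OF h(1,2)])
    fix y assume y: "y \<in> N'"
    then have "y \<in> lin_span R M (N \<union> mon ` exps)" using span N'.N_closed by blast
    from pow_mem_lin_span_free[OF h(1,3) this] obtain k :: nat
      where k: "h [^] k \<odot>\<^bsub>M\<^esub> y \<in> lin_span R M (N \<union> mon ` (exps - torsion))" by metis
    obtain F where F: "finite F" "F \<subseteq> exps - torsion"
      "h [^] k \<odot>\<^bsub>M\<^esub> y \<in> lin_span R M (N \<union> mon ` F)"
      using lin_span_finite_support[OF N_closed free_closed k] by metis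
    have "h [^] k \<odot>\<^bsub>M\<^esub> y \<in> N'" using submodule_smult[OF N'.N _ y] h(1) by simp
    then show "\<exists>k::nat. h [^] k \<odot>\<^bsub>M\<^esub> y \<in> N" using mem[OF F] by blast
  qed
qed

end

section \<open>Modules over a polynomial ring from an endomorphism\<close>

lemma (in UP_ring) UP_induct [consumes 1, case_names monom add]:
  assumes p: "p \<in> carrier P"
    and monom: "\<And>a n. a \<in> carrier R \<Longrightarrow> Q (monom P a n)"
    and add: "\<And>p q. \<lbrakk>p \<in> carrier P; q \<in> carrier P; Q p; Q q\<rbrakk> \<Longrightarrow> Q (p \<oplus>\<^bsub>P\<^esub> q)"
  shows "Q p"
proof -
  have m: "(\<lambda>i. monom P (coeff P p i) i) \<in> S \<rightarrow> carrier P" for S :: "nat set"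
    using p by auto
  have "Q (\<Oplus>\<^bsub>P\<^esub> i \<in> {..n}. monom P (coeff P p i) i)" for n
  proof (induction n)
    case 0
    show ?case using m[of "{0}"] monom[of "coeff P p 0" 0] p by simp
  next
    case (Suc n)
    then show ?case
      using m[of "{..Suc n}"] m[of "{..n}"] p by (simp add: P.finsum_Suc add monom)
  qed
  then show ?thesis using up_repr[OF p] by metis
qed

lemma (in abelian_monoid) finsum_extend:
  assumes "m \<le> n" "\<And>i. f i \<in> carrier G" "\<And>i. m < i \<Longrightarrow> f i = \<zero>"
  shows "(\<Oplus>i\<in>{..n}. f i) = (\<Oplus>i\<in>{..m::nat}. f i)"
  using assms(1)
proof (induction n rule: dec_induct)
  case (step n)
  then show ?case using assms(2,3) by (simp add: finsum_Suc)
qed simp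

text \<open>Makes \<open>X\<close> act as \<open>f\<close>. The scalar multiplication repeats the
  sum in \<open>algebraic_map\<close>, so a non-zero polynomial that annihilates the module
  witnesses algebraicity by mere unfolding.\<close>

definition poly_module ::
    "('k, 'r) ring_scheme \<Rightarrow> ('k, 'm, 's) module_scheme \<Rightarrow> ('m \<Rightarrow> 'm) \<Rightarrow> (nat \<Rightarrow> 'k, 'm) module" where
  "poly_module R V f = \<lparr>carrier = carrier V, monoid.mult = monoid.mult V, one = one V, zero = zero V, add = add V,
     smult = (\<lambda>p m. \<Oplus>\<^bsub>V\<^esub>i \<in> {..deg R p}. coeff (UP R) p i \<odot>\<^bsub>V\<^esub> (f ^^ i) m)\<rparr>"

lemma poly_module_simps [simp]:
  "carrier (poly_module R V f) = carrier V"
  "\<zero>\<^bsub>poly_module R V f\<^esub> = \<zero>\<^bsub>V\<^esub>"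
  "add (poly_module R V f) = add V"
  by (simp_all add: poly_module_def)

lemma abelian_group_cong:
  assumes "abelian_group G" "carrier H = carrier G" "add H = add G" "\<zero>\<^bsub>H\<^esub> = \<zero>\<^bsub>G\<^esub>"
  shows "abelian_group H"
proof -
  interpret G: abelian_group G by (rule assms)
  show ?thesis
    by (rule abelian_groupI) (use assms in \<open>auto simp: G.a_ac intro: G.l_neg\<close>)
qed

locale module_endomorphism = R?: cring R + left_module R M
  for R (structure) and M (structure) +
  fixes f
  assumes f: "f \<in> module_End R M"
begin

lemma f_closed [simp]: "m \<in> carrier M \<Longrightarrow> f m \<in> carrier M"
  using f by (auto simp: module_End_def)

lemma f_add: "\<lbrakk>m \<in> carrier M; n \<in> carrier M\<rbrakk> \<Longrightarrow> f (m \<oplus>\<^bsub>M\<^esub> n) = f m \<oplus>\<^bsub>M\<^esub> f n"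
  using f by (simp add: module_End_def)

lemma f_smult: "\<lbrakk>a \<in> carrier R; m \<in> carrier M\<rbrakk> \<Longrightarrow> f (a \<odot>\<^bsub>M\<^esub> m) = a \<odot>\<^bsub>M\<^esub> f m"
  using f by (simp add: module_End_def)

lemma fpow_closed [simp]: "m \<in> carrier M \<Longrightarrow> (f ^^ i) m \<in> carrier M"
  by (induction i) auto

lemma fpow_add: "\<lbrakk>m \<in> carrier M; n \<in> carrier M\<rbrakk> \<Longrightarrow> (f ^^ i) (m \<oplus>\<^bsub>M\<^esub> n) = (f ^^ i) m \<oplus>\<^bsub>M\<^esub> (f ^^ i) n"
  by (induction i) (auto simp: f_add)

lemma fpow_smult: "\<lbrakk>a \<in> carrier R; m \<in> carrier M\<rbrakk> \<Longrightarrow> (f ^^ i) (a \<odot>\<^bsub>M\<^esub> m) = a \<odot>\<^bsub>M\<^esub> (f ^^ i) m"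
  by (induction i) (auto simp: f_smult)

abbreviation P where "P \<equiv> UP R"

sublocale P: UP_cring R P
  by unfold_locales

abbreviation pact (infixr "\<star>" 75) where "p \<star> m \<equiv> p \<odot>\<^bsub>poly_module R M f\<^esub> m"

text \<open>Any bound on the degree may replace the degree itself, so that sums for different
  polynomials can be taken over a common range.\<close>

lemma pact_eq:
  assumes "p \<in> carrier P" "m \<in> carrier M" "deg R p \<le> n"
  shows "p \<star> m = (\<Oplus>\<^bsub>M\<^esub>i \<in> {..n}. coeff P p i \<odot>\<^bsub>M\<^esub> (f ^^ i) m)"
proof -
  have "(\<Oplus>\<^bsub>M\<^esub>i \<in> {..n}. coeff P p i \<odot>\<^bsub>M\<^esub> (f ^^ i) m) =
      (\<Oplus>\<^bsub>M\<^esub>i \<in> {..deg R p}. coeff P p i \<odot>\<^bsub>M\<^esub> (f ^^ i) m)"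
    by (rule M.finsum_extend) (use assms P.deg_aboveD in auto)
  then show ?thesis by (simp add: poly_module_def)
qed

lemma pact_closed [simp]: "\<lbrakk>p \<in> carrier P; m \<in> carrier M\<rbrakk> \<Longrightarrow> p \<star> m \<in> carrier M"
  by (simp add: pact_eq[OF _ _ order_refl])

lemma pact_add_left:
  assumes "p \<in> carrier P" "q \<in> carrier P" "m \<in> carrier M"
  shows "(p \<oplus>\<^bsub>P\<^esub> q) \<star> m = p \<star> m \<oplus>\<^bsub>M\<^esub> q \<star> m"
proof -
  let ?n = "max (deg R (p \<oplus>\<^bsub>P\<^esub> q)) (max (deg R p) (deg R q))"
  show ?thesis
    using assms by (simp add: pact_eq[where n = ?n] smult_l_distr M.finsum_addf)
qed

lemma pact_add_right:
  assumes "p \<in> carrier P" "m \<in> carrier M" "n \<in> carrier M"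
  shows "p \<star> (m \<oplus>\<^bsub>M\<^esub> n) = p \<star> m \<oplus>\<^bsub>M\<^esub> p \<star> n"
  using assms by (simp add: pact_eq[OF _ _ order_refl] fpow_add smult_r_distr M.finsum_addf)

lemma pact_monom:
  assumes a: "a \<in> carrier R" and m: "m \<in> carrier M"
  shows "monom P a n \<star> m = a \<odot>\<^bsub>M\<^esub> (f ^^ n) m"
proof -
  have "monom P a n \<star> m =
      (\<Oplus>\<^bsub>M\<^esub>i \<in> {..n}. coeff P (monom P a n) i \<odot>\<^bsub>M\<^esub> (f ^^ i) m)"
    by (rule pact_eq) (use assms P.deg_monom_le in auto)
  also have "\<dots> = (\<Oplus>\<^bsub>M\<^esub>i \<in> {..n}. if n = i then a \<odot>\<^bsub>M\<^esub> (f ^^ i) m else \<zero>\<^bsub>M\<^esub>)"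
    using assms by (intro M.finsum_cong) (auto simp: simp_implies_def)
  also have "\<dots> = a \<odot>\<^bsub>M\<^esub> (f ^^ n) m"
    by (rule M.finsum_singleton) (use assms in auto)
  finally show ?thesis .
qed

lemma pact_mult:
  assumes p: "p \<in> carrier P" and q: "q \<in> carrier P" and m: "m \<in> carrier M"
  shows "(p \<otimes>\<^bsub>P\<^esub> q) \<star> m = p \<star> (q \<star> m)"
  using p
proof (induction p rule: P.UP_induct)
  case (monom a n)
  from q show ?case
  proof (induction q rule: P.UP_induct)
    case (monom b k)
    then show ?case
      using \<open>a \<in> carrier R\<close> m 
      by (simp add: pact_monom fpow_smult smult_assoc1 funpow_add del: P.monom_mult flip: P.monom_mult)
  next
    case (add q r)
    then show ?case
      using \<open>a \<in> carrier R\<close> m by (simp add: P.r_distr pact_add_left pact_add_right)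
  qed
next
  case (add p r)
  then show ?case using q m by (simp add: P.l_distr pact_add_left)
qed

lemma poly_module: "left_module P (poly_module R M f)"
proof (intro left_module.intro left_module_axioms.intro)
  show "ring P" by (rule P.P.ring_axioms)
  show "abelian_group (poly_module R M f)"
    by (rule abelian_group_cong[OF M.abelian_group_axioms]) simp_all
  show "\<one>\<^bsub>P\<^esub> \<star> m = m" if "m \<in> carrier (poly_module R M f)" for m
    using that pact_monom[of \<one> m 0] by simp
qed (simp_all add: pact_add_left pact_add_right pact_mult)

end

section \<open>Almost commutative algebras acting on modules\<close>

lemma module_imp_left_module:
  assumes "module R M"
  shows "left_module R M"
proof -
  interpret module R M by (rule assms)
  show ?thesis
    by unfold_locales (simp_all add: smult_l_distr smult_r_distr smult_assoc1)
qed

lemma a_minus_cong: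
  assumes "carrier H = carrier G" "add H = add G" "\<zero>\<^bsub>H\<^esub> = \<zero>\<^bsub>G\<^esub>"
  shows "a_minus H = a_minus G"
  using assms by (intro ext) (simp add: a_minus_def a_inv_def m_inv_def)

context k_algebra
begin

lemma B_left_module: "left_module K B"
  by (rule module_imp_left_module[OF module_axioms])

lemma scalar_closed [simp]: "c \<in> carrier K \<Longrightarrow> scalar B c \<in> carrier B"
  by (simp add: scalar_def)

lemma scalar_mult: "\<lbrakk>c \<in> carrier K; b \<in> carrier B\<rbrakk> \<Longrightarrow> scalar B c \<otimes>\<^bsub>B\<^esub> b = c \<odot>\<^bsub>B\<^esub> b"
  by (simp add: scalar_def smult_mult_l)

lemma mult_scalar: "\<lbrakk>c \<in> carrier K; b \<in> carrier B\<rbrakk> \<Longrightarrow> b \<otimes>\<^bsub>B\<^esub> scalar B c = c \<odot>\<^bsub>B\<^esub> b"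
  by (simp add: scalar_def smult_mult_r)

lemma scalar_one: "scalar B \<one>\<^bsub>K\<^esub> = \<one>\<^bsub>B\<^esub>"
  by (simp add: scalar_def)

lemma scalar_add:
  "\<lbrakk>c \<in> carrier K; e \<in> carrier K\<rbrakk> \<Longrightarrow> scalar B (c \<oplus>\<^bsub>K\<^esub> e) = scalar B c \<oplus>\<^bsub>B\<^esub> scalar B e"
  by (simp add: scalar_def smult_l_distr)

lemma scalar_scalar:
  "\<lbrakk>c \<in> carrier K; e \<in> carrier K\<rbrakk> \<Longrightarrow> scalar B (c \<otimes>\<^bsub>K\<^esub> e) = scalar B c \<otimes>\<^bsub>B\<^esub> scalar B e"
  by (simp add: scalar_mult) (simp add: scalar_def smult_assoc1)

end

lemma restrict_scalars_simps [simp]: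
  "carrier (restrict_scalars h V) = carrier V"
  "\<zero>\<^bsub>restrict_scalars h V\<^esub> = \<zero>\<^bsub>V\<^esub>"
  "add (restrict_scalars h V) = add V"
  "c \<odot>\<^bsub>restrict_scalars h V\<^esub> m = h c \<odot>\<^bsub>V\<^esub> m"
  by (simp_all add: restrict_scalars_def)

lemma (in k_algebra) restrict_scalars_left_module:
  assumes "left_module B V"
  shows "left_module K (restrict_scalars (scalar B) V)"
proof -
  interpret V: left_module B V by (rule assms)
  show ?thesis
  proof (intro left_module.intro left_module_axioms.intro)
    show "abelian_group (restrict_scalars (scalar B) V)"
      by (rule abelian_group_cong[OF V.M.abelian_group_axioms]) simp_all
  qed (simp_all add: K.ring_axioms scalar_add scalar_scalar scalar_one
      V.smult_l_distr V.smult_r_distr V.smult_assoc1)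
qed

text \<open>
  The module \<open>V\<close> over \<open>B\<close> carries a second structure \<open>W\<close>, over a commutative domain \<open>A\<close>, that extends
  the one over \<open>k\<close> and commutes with \<open>B\<close>. It is used for \<open>A = k[X]\<close> and for \<open>A = k\<close>.
\<close>

locale two_actions = almost_commutative_algebra K B \<gg> + V: left_module B V +
    A: "domain" A + W: left_module A W
  for K (structure) and B (structure) and \<gg> and V and A and W +
  assumes carrier_W: "carrier W = carrier V"
    and add_W: "add W = add V"
    and zero_W: "\<zero>\<^bsub>W\<^esub> = \<zero>\<^bsub>V\<^esub>"
    and scalar_W: "c \<in> carrier K \<Longrightarrow>
      \<exists>p \<in> carrier A. \<forall>m \<in> carrier V. scalar B c \<odot>\<^bsub>V\<^esub> m = p \<odot>\<^bsub>W\<^esub> m"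
    and smult_commute: "\<lbrakk>b \<in> carrier B; p \<in> carrier A; m \<in> carrier V\<rbrakk> \<Longrightarrow>
      b \<odot>\<^bsub>V\<^esub> (p \<odot>\<^bsub>W\<^esub> m) = p \<odot>\<^bsub>W\<^esub> (b \<odot>\<^bsub>V\<^esub> m)"
begin

lemma minus_W: "a_minus W = a_minus V"
  by (rule a_minus_cong[OF carrier_W add_W zero_W])

lemma lin_span_action:
  assumes Y: "submodule Y A W" and S: "S \<subseteq> carrier B" "b \<in> lin_span K B S"
    and m: "m \<in> carrier V" and Sm: "\<And>s. s \<in> S \<Longrightarrow> s \<odot>\<^bsub>V\<^esub> m \<in> Y"
  shows "b \<odot>\<^bsub>V\<^esub> m \<in> Y"
proof -
  interpret KB: left_module K B by (rule B_left_module)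
  show ?thesis
    using S
  proof (induction rule: KB.lin_span_induct)
    case zero
    show ?case using W.submodule_zero[OF Y] m zero_W by simp
  next
    case (add b c)
    then show ?case using W.submodule_add[OF Y] m add_W by (simp add: V.smult_l_distr)
  next
    case (smult c b)
    obtain p where p: "p \<in> carrier A" "\<And>m. m \<in> carrier V \<Longrightarrow> scalar B c \<odot>\<^bsub>V\<^esub> m = p \<odot>\<^bsub>W\<^esub> m"
      using scalar_W[OF smult(1)] by blast
    have "(c \<odot>\<^bsub>B\<^esub> b) \<odot>\<^bsub>V\<^esub> m = p \<odot>\<^bsub>W\<^esub> (b \<odot>\<^bsub>V\<^esub> m)"
      using p(2)[of "b \<odot>\<^bsub>V\<^esub> m"] smult(1,2) m
      by (simp add: scalar_mult[symmetric] V.smult_assoc1)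
    then show ?case using W.submodule_smult[OF Y p(1)] smult by simp
  qed (rule Sm)
qed

text \<open>Stability passes from generators to their products, and from these to spans by
  \<open>lin_span_action\<close>, applied first to each power and then to the sum of all
  powers.\<close>

lemma stable_under_B:
  assumes Y: "submodule Y A W" and gY: "\<And>u m. \<lbrakk>u \<in> \<gg>; m \<in> Y\<rbrakk> \<Longrightarrow> u \<odot>\<^bsub>V\<^esub> m \<in> Y"
    and b: "b \<in> carrier B" and m: "m \<in> Y"
  shows "b \<odot>\<^bsub>V\<^esub> m \<in> Y"
proof -
  have YV: "y \<in> carrier V" if "y \<in> Y" for y
    using W.submodule_carrier[OF Y that] carrier_W by simp
  have g: "\<gg> \<subseteq> carrier B"
    using finite_dim left_module.submodule_subset[OF B_left_module] unfolding finite_dim_subspace_def by blast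
  have prod: "foldr (\<otimes>\<^bsub>B\<^esub>) xs \<one>\<^bsub>B\<^esub> \<in> carrier B \<and> foldr (\<otimes>\<^bsub>B\<^esub>) xs \<one>\<^bsub>B\<^esub> \<odot>\<^bsub>V\<^esub> m \<in> Y"
    if "set xs \<subseteq> \<gg>" for xs
    using that
  proof (induction xs)
    case Nil
    show ?case using m YV by simp
  next
    case (Cons u xs)
    then have "u \<in> carrier B" using g by auto
    then show ?case using Cons gY m YV by (simp add: V.smult_assoc1)
  qed
  have prods: "{foldr (\<otimes>\<^bsub>B\<^esub>) xs \<one>\<^bsub>B\<^esub> |xs. set xs \<subseteq> \<gg> \<and> length xs = n} \<subseteq> carrier B" for n
    using prod by blast
  have "subspace_power K B \<gg> n \<subseteq> carrier B" for n
    unfolding subspace_power_def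
    by (rule left_module.submodule_subset[OF B_left_module
          left_module.submodule_lin_span[OF B_left_module prods]])
  then have carr: "(\<Union>n. subspace_power K B \<gg> n) \<subseteq> carrier B" by blast
  have power: "s \<odot>\<^bsub>V\<^esub> m \<in> Y" if "s \<in> subspace_power K B \<gg> n" for s n
    by (rule lin_span_action[OF Y prods that[unfolded subspace_power_def] YV[OF m]])
      (use prod in blast)
  show ?thesis
    by (rule lin_span_action[OF Y carr _ YV[OF m]]) (use b generates power in blast)+
qed

lemma submodule_W_imp_V:
  assumes Y: "submodule Y A W" and gY: "\<And>u m. \<lbrakk>u \<in> \<gg>; m \<in> Y\<rbrakk> \<Longrightarrow> u \<odot>\<^bsub>V\<^esub> m \<in> Y"
  shows "submodule Y B V"
  by (rule V.submoduleI)
    (use W.submodule_subset[OF Y] W.submodule_zero[OF Y] W.submodule_add[OF Y] stable_under_B[OF Y gY]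
      carrier_W zero_W add_W in auto)

lemma ex_generators:
  obtains d :: nat and s where "\<And>i. i < d \<Longrightarrow> s i \<in> \<gg>" "\<gg> \<subseteq> carrier B" "\<gg> = lin_span K B (s ` {..<d})"
proof -
  obtain S where S: "finite S" "S \<subseteq> carrier B" "\<gg> = lin_span K B S" and sub: "submodule \<gg> K B"
    using finite_dim unfolding finite_dim_subspace_def by blast
  obtain d :: nat and s where ds: "S = s ` {i. i < d}"
    using finite_imp_nat_seg_image_inj_on[OF S(1)] by blast
  have "s i \<in> \<gg>" if "i < d" for i
    unfolding S(3) by (rule subsetD[OF left_module.lin_span_superset[OF B_left_module]])
      (use ds that in blast)
  moreover have "\<gg> \<subseteq> carrier B" by (rule left_module.submodule_subset[OF B_left_module sub])
  moreover have "\<gg> = lin_span K B (s ` {..<d})" using S(3) ds by (simp add: lessThan_def)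
  ultimately show thesis by (rule that)
qed

text \<open>Closure under commutators gives the pointwise commutator condition after application to
  a vector. The last clause is the way back, from stability under the finitely many generators to
  \<open>B\<close>-submodules.\<close>

lemma almost_commuting_generators:
  obtains d :: nat and s where "almost_commuting A W d (\<lambda>i m. s i \<odot>\<^bsub>V\<^esub> m)"
    "\<And>i. i < d \<Longrightarrow> s i \<in> carrier B"
    "\<And>Y. \<lbrakk>submodule Y A W; \<And>i m. \<lbrakk>i < d; m \<in> Y\<rbrakk> \<Longrightarrow> s i \<odot>\<^bsub>V\<^esub> m \<in> Y\<rbrakk> \<Longrightarrow> submodule Y B V"
proof -
  obtain d :: nat and s where s: "\<And>i. i < d \<Longrightarrow> s i \<in> \<gg>" and g: "\<gg> \<subseteq> carrier B"
    and span: "\<gg> = lin_span K B (s ` {..<d})" using ex_generators by metis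
  have sB: "s i \<in> carrier B" if "i < d" for i using s[OF that] g by blast
  have sS: "s ` {..<d} \<subseteq> carrier B" using sB by auto
  have "almost_commuting A W d (\<lambda>i m. s i \<odot>\<^bsub>V\<^esub> m)"
  proof (intro almost_commuting.intro almost_commuting_axioms.intro)
    show "domain A" by (rule A.domain_axioms)
    show "left_module A W" by (rule W.left_module_axioms)
  next
    fix i j m assume ij: "i < d" "j < d" and "m \<in> carrier W"
    then have m: "m \<in> carrier V" using carrier_W by simp
    let ?T = "lin_span A W ((\<lambda>l. s l \<odot>\<^bsub>V\<^esub> m) ` {..<d})"
    have im: "(\<lambda>l. s l \<odot>\<^bsub>V\<^esub> m) ` {..<d} \<subseteq> carrier W" using sB m carrier_W by auto
    have "s i \<otimes>\<^bsub>B\<^esub> s j \<ominus>\<^bsub>B\<^esub> s j \<otimes>\<^bsub>B\<^esub> s i \<in> lin_span K B (s ` {..<d})"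
      using commutator_closed[OF s[OF ij(1)] s[OF ij(2)]] span by simp
    then have "(s i \<otimes>\<^bsub>B\<^esub> s j \<ominus>\<^bsub>B\<^esub> s j \<otimes>\<^bsub>B\<^esub> s i) \<odot>\<^bsub>V\<^esub> m \<in> ?T"
      by (rule lin_span_action[OF W.submodule_lin_span[OF im] sS _ m])
        (use W.lin_span_superset[of "(\<lambda>l. s l \<odot>\<^bsub>V\<^esub> m) ` {..<d}"] in blast)
    then show "s i \<odot>\<^bsub>V\<^esub> (s j \<odot>\<^bsub>V\<^esub> m) \<ominus>\<^bsub>W\<^esub> s j \<odot>\<^bsub>V\<^esub> (s i \<odot>\<^bsub>V\<^esub> m) \<in> ?T"
      using sB ij m by (simp add: minus_W V.smult_diff_left V.smult_assoc1)
  qed (use sB in \<open>simp_all add: carrier_W add_W smult_commute V.smult_r_distr\<close>)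
  moreover have "submodule Y B V"
    if Y: "submodule Y A W" and sY: "\<And>i m. \<lbrakk>i < d; m \<in> Y\<rbrakk> \<Longrightarrow> s i \<odot>\<^bsub>V\<^esub> m \<in> Y" for Y
  proof (rule submodule_W_imp_V[OF Y])
    fix u m assume u: "u \<in> \<gg>" and m: "m \<in> Y"
    have mV: "m \<in> carrier V" using W.submodule_carrier[OF Y m] carrier_W by simp
    show "u \<odot>\<^bsub>V\<^esub> m \<in> Y"
      by (rule lin_span_action[OF Y sS _ mV]) (use u span sY m in auto)
  qed
  ultimately show thesis using that sB by blast
qed

end

section \<open>The generalised Quillen lemma\<close>

text \<open>The identity \<open>1 = q - X h\<close> makes \<open>q\<close> coprime to
  \<open>h\<close>, and \<open>q\<close> is not a unit because its degree is positive.\<close>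

lemma (in UP_domain) one_plus_X_mult_not_dvd_power:
  assumes h: "h \<in> carrier P" "h \<noteq> \<zero>\<^bsub>P\<^esub>"
    and q: "q = \<one>\<^bsub>P\<^esub> \<oplus>\<^bsub>P\<^esub> monom P \<one> 1 \<otimes>\<^bsub>P\<^esub> h"
  shows "q \<in> carrier P" "q \<noteq> \<zero>\<^bsub>P\<^esub>" "c \<in> carrier P \<Longrightarrow> h [^]\<^bsub>P\<^esub> (k::nat) \<noteq> q \<otimes>\<^bsub>P\<^esub> c"
proof -
  let ?X = "monom P \<one> 1"
  show qP: "q \<in> carrier P" using h by (simp add: q)
  \<comment> \<open>The summand \<open>1\<close> lives in degree 0, so the coefficient in degree
    \<open>deg R h + 1\<close> is the leading coefficient of \<open>h\<close>.\<close>
  have "coeff P q (deg R h + 1) = coeff P h (deg R h)"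
    using h coeff_monom_mult[of \<one> h 1 "deg R h"] by (simp add: q del: coeff_mult)
  then have top: "coeff P q (deg R h + 1) \<noteq> \<zero>" using lcoeff_nonzero2[OF h] by simp
  then show q0: "q \<noteq> \<zero>\<^bsub>P\<^esub>" by auto
  have degq: "deg R q \<ge> 1" using deg_aboveD[of q "deg R h + 1"] top qP by fastforce
  have "\<forall>c \<in> carrier P. h [^]\<^bsub>P\<^esub> k \<noteq> q \<otimes>\<^bsub>P\<^esub> c"
  proof (induction k)
    case 0
    show ?case
    proof (intro ballI notI)
      fix c assume c: "c \<in> carrier P" and eq: "h [^]\<^bsub>P\<^esub> (0::nat) = q \<otimes>\<^bsub>P\<^esub> c"
      then have eq': "q \<otimes>\<^bsub>P\<^esub> c = \<one>\<^bsub>P\<^esub>" by simp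
      then have "c \<noteq> \<zero>\<^bsub>P\<^esub>" using qP by auto
      then have "deg R q + deg R c = 0" using deg_mult[OF q0 _ qP c] eq' by simp
      then show False using degq by simp
    qed
  next
    case (Suc k)
    show ?case
    proof (intro ballI notI)
      fix c assume c: "c \<in> carrier P" and eq: "h [^]\<^bsub>P\<^esub> Suc k = q \<otimes>\<^bsub>P\<^esub> c"
      let ?H = "h [^]\<^bsub>P\<^esub> k"
      have H: "?H \<in> carrier P" "?X \<in> carrier P" using h by simp_all
      \<comment> \<open>Descent: multiplying \<open>1 = q - X h\<close> by the \<open>k\<close>-th
        power of \<open>h\<close> shows that if \<open>q\<close> divides the next power, it divides
        this one.\<close>
      have "q \<otimes>\<^bsub>P\<^esub> ?H = ?H \<oplus>\<^bsub>P\<^esub> ?X \<otimes>\<^bsub>P\<^esub> (?H \<otimes>\<^bsub>P\<^esub> h)"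
        using h H by (simp add: q P.l_distr P.m_assoc P.m_comm[of h ?H])
      then have "q \<otimes>\<^bsub>P\<^esub> ?H = ?H \<oplus>\<^bsub>P\<^esub> ?X \<otimes>\<^bsub>P\<^esub> (q \<otimes>\<^bsub>P\<^esub> c)" using eq by simp
      then have "?H = q \<otimes>\<^bsub>P\<^esub> ?H \<ominus>\<^bsub>P\<^esub> ?X \<otimes>\<^bsub>P\<^esub> (q \<otimes>\<^bsub>P\<^esub> c)"
        using H c qP by (simp add: P.minus_eq P.a_assoc P.r_neg)
      also have "\<dots> = q \<otimes>\<^bsub>P\<^esub> (?H \<ominus>\<^bsub>P\<^esub> ?X \<otimes>\<^bsub>P\<^esub> c)"
        using H c qP by (simp add: P.minus_eq P.r_distr P.r_minus P.m_lcomm)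
      finally show False using Suc.IH H c by auto
    qed
  qed
  then show "c \<in> carrier P \<Longrightarrow> h [^]\<^bsub>P\<^esub> k \<noteq> q \<otimes>\<^bsub>P\<^esub> c" by blast
qed

context almost_commutative_algebra
begin

lemma module_endomorphism_restrict_scalars:
  assumes V: "left_module B V" and f: "f \<in> module_End B V"
  shows "module_endomorphism K (restrict_scalars (scalar B) V) f"
proof -
  interpret KV: left_module K "restrict_scalars (scalar B) V"
    by (rule restrict_scalars_left_module[OF V])
  show ?thesis
  proof
    show "f \<in> module_End K (restrict_scalars (scalar B) V)"
      using f by (auto simp: module_End_def)
  qed
qed

text \<open>The hypotheses say that \<open>V / N\<close> is simple over \<open>B[X]\<close> with
  \<open>X\<close> acting as \<open>f\<close>. If no polynomial works, Schur's lemma makes every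
  non-zero one bijective on \<open>V / N\<close>, which generic freeness over \<open>k[X]\<close>
  excludes.\<close>

theorem maximal_stable_submodule_algebraic:
  assumes V: "left_module B V" and f: "f \<in> module_End B V"
    and N: "submodule N B V" "\<And>m. m \<in> N \<Longrightarrow> f m \<in> N" "N \<noteq> carrier V"
    and max: "\<And>U. \<lbrakk>submodule U B V; N \<subseteq> U; \<And>m. m \<in> U \<Longrightarrow> f m \<in> U\<rbrakk> \<Longrightarrow> U = N \<or> U = carrier V"
  obtains p where "p \<in> carrier (UP K)" "p \<noteq> \<zero>\<^bsub>UP K\<^esub>"
    "\<And>m. m \<in> carrier V \<Longrightarrow> p \<odot>\<^bsub>poly_module K (restrict_scalars (scalar B) V) f\<^esub> m \<in> N"
proof (rule ccontr)
  assume not: "\<not> thesis"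
  note witness = that
  let ?KV = "restrict_scalars (scalar B) V"
  let ?P = "UP K" and ?W = "poly_module K ?KV f"
  interpret V: left_module B V by (rule V)
  interpret E: module_endomorphism K ?KV f by (rule module_endomorphism_restrict_scalars[OF V f])
  interpret D: UP_domain K ?P by unfold_locales
  interpret PW: left_module ?P ?W by (rule E.poly_module)
  have f_closed: "f m \<in> carrier V" if "m \<in> carrier V" for m using E.f_closed that by simp
  have f_B: "f (b \<odot>\<^bsub>V\<^esub> m) = b \<odot>\<^bsub>V\<^esub> f m" if "b \<in> carrier B" "m \<in> carrier V" for b m
    using f that by (simp add: module_End_def)
  have f_add: "f (m \<oplus>\<^bsub>V\<^esub> n) = f m \<oplus>\<^bsub>V\<^esub> f n" if "m \<in> carrier V" "n \<in> carrier V" for m n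
    using E.f_add that by simp
  have fpow_closed: "(f ^^ i) m \<in> carrier V" if "m \<in> carrier V" for m i
    using E.fpow_closed that by simp
  have fpow_B: "(f ^^ i) (b \<odot>\<^bsub>V\<^esub> m) = b \<odot>\<^bsub>V\<^esub> (f ^^ i) m" if "b \<in> carrier B" "m \<in> carrier V" for b m i
    by (induction i) (use that fpow_closed f_B in auto)
  have X: "monom ?P \<one>\<^bsub>K\<^esub> 1 \<odot>\<^bsub>?W\<^esub> m = f m" if "m \<in> carrier V" for m
    using E.pact_monom[of "\<one>\<^bsub>K\<^esub>" m 1] that f_closed by (simp add: scalar_one)
  have comm: "b \<odot>\<^bsub>V\<^esub> (p \<odot>\<^bsub>?W\<^esub> m) = p \<odot>\<^bsub>?W\<^esub> (b \<odot>\<^bsub>V\<^esub> m)"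
    if "p \<in> carrier ?P" and b: "b \<in> carrier B" and m: "m \<in> carrier V" for b p m
    using that(1)
  proof (induction p rule: E.P.UP_induct)
    case (monom a n)
    have "b \<odot>\<^bsub>V\<^esub> (scalar B a \<odot>\<^bsub>V\<^esub> (f ^^ n) m) = scalar B a \<odot>\<^bsub>V\<^esub> (b \<odot>\<^bsub>V\<^esub> (f ^^ n) m)"
      using monom b m fpow_closed by (simp add: scalar_mult mult_scalar flip: V.smult_assoc1)
    then show ?case using E.pact_monom[of a _ n] monom b m fpow_B by simp
  next
    case (add p q)
    then show ?case
      using E.pact_closed E.pact_add_left[of p q] b m by (simp add: V.smult_r_distr)
  qed
  interpret two_actions K B \<gg> V ?P ?W
  proof
    fix c assume c: "c \<in> carrier K"
    show "\<exists>p\<in>carrier ?P. \<forall>m\<in>carrier V. scalar B c \<odot>\<^bsub>V\<^esub> m = p \<odot>\<^bsub>?W\<^esub> m"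
      by (rule bexI[of _ "monom ?P c 0"]) (use E.pact_monom[of c _ 0] c in simp_all)
  qed (simp_all add: comm)
  have W_submodule: "submodule U ?P ?W" if U: "submodule U B V" and fU: "\<And>m. m \<in> U \<Longrightarrow> f m \<in> U" for U
  proof (rule PW.submoduleI)
    fix p m assume p: "p \<in> carrier ?P" and m: "m \<in> U"
    have mV: "m \<in> carrier V" by (rule V.submodule_carrier[OF U m])
    have fpU: "(f ^^ i) m \<in> U" for i by (induction i) (use fU m in auto)
    from p show "p \<odot>\<^bsub>?W\<^esub> m \<in> U"
    proof (induction p rule: E.P.UP_induct)
      case (monom a n)
      then show ?case using E.pact_monom[of a m n] V.submodule_smult[OF U _ fpU] mV by simp
    next
      case (add p q)
      then show ?case using E.pact_add_left[of p q m] V.submodule_add[OF U] mV by simp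
    qed
  qed (use V.submodule_subset[OF U] V.submodule_zero[OF U] V.submodule_add[OF U] in auto)
  have V_stable: "f m \<in> U" if U: "submodule U ?P ?W" and "m \<in> U" for U m
    using PW.submodule_smult[OF U, of "monom ?P \<one>\<^bsub>K\<^esub> 1" m] X PW.submodule_carrier[OF U] that by simp
  have NW: "submodule N ?P ?W" by (rule W_submodule[OF N(1,2)])
  have p_f: "p \<odot>\<^bsub>?W\<^esub> f m = f (p \<odot>\<^bsub>?W\<^esub> m)" if p: "p \<in> carrier ?P" and m: "m \<in> carrier V" for p m
  proof -
    have "p \<odot>\<^bsub>?W\<^esub> (monom ?P \<one>\<^bsub>K\<^esub> 1 \<odot>\<^bsub>?W\<^esub> m) = monom ?P \<one>\<^bsub>K\<^esub> 1 \<odot>\<^bsub>?W\<^esub> (p \<odot>\<^bsub>?W\<^esub> m)"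
      using p m E.P.P.m_comm[of p "monom ?P \<one>\<^bsub>K\<^esub> 1"] by (simp flip: PW.smult_assoc1)
    then show ?thesis using X p m PW.smult_closed[of p m] by simp
  qed
  have nonzero: "\<exists>m \<in> carrier V. p \<odot>\<^bsub>?W\<^esub> m \<notin> N" if "p \<in> carrier ?P" "p \<noteq> \<zero>\<^bsub>?P\<^esub>" for p
    using not witness[OF that] by blast
  \<comment> \<open>First half of Schur's lemma: the kernel of \<open>p\<close> on
    \<open>V / N\<close> is stable and not everything.\<close>
  have inj: "m \<in> N" if p: "p \<in> carrier ?P" "p \<noteq> \<zero>\<^bsub>?P\<^esub>" and m: "m \<in> carrier V" "p \<odot>\<^bsub>?W\<^esub> m \<in> N" for p m
  proof -
    let ?U = "{m \<in> carrier V. p \<odot>\<^bsub>?W\<^esub> m \<in> N}"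
    have "submodule ?U B V"
    proof (rule V.submoduleI)
      show "\<zero>\<^bsub>V\<^esub> \<in> ?U" using PW.smult_zero_right[OF p(1)] V.submodule_zero[OF N(1)] by simp
      show "x \<oplus>\<^bsub>V\<^esub> y \<in> ?U" if "x \<in> ?U" "y \<in> ?U" for x y
        using that PW.smult_r_distr[OF p(1), of x y] V.submodule_add[OF N(1)] by simp
      show "b \<odot>\<^bsub>V\<^esub> x \<in> ?U" if "b \<in> carrier B" "x \<in> ?U" for b x
        using that V.submodule_smult[OF N(1), of b "p \<odot>\<^bsub>?W\<^esub> x"] comm[OF p(1), of b x] by simp
    qed simp
    moreover have "N \<subseteq> ?U"
    proof
      show "x \<in> ?U" if "x \<in> N" for x
        using PW.submodule_smult[OF NW p(1) that] V.submodule_carrier[OF N(1) that] by simp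
    qed
    moreover have "f x \<in> ?U" if "x \<in> ?U" for x
      using that p_f[OF p(1), of x] N(2)[of "p \<odot>\<^bsub>?W\<^esub> x"] f_closed[of x] by simp
    ultimately have "?U = N \<or> ?U = carrier V" by (rule max)
    moreover have "?U \<noteq> carrier V" using nonzero[OF p] by blast
    ultimately show ?thesis using m by blast
  qed
  \<comment> \<open>Second half of Schur's lemma: the preimage in \<open>V\<close> of the image of
    \<open>p\<close> on \<open>V / N\<close> is stable and strictly larger than
    \<open>N\<close>.\<close>
  have surj: "\<exists>y \<in> carrier V. m \<ominus>\<^bsub>V\<^esub> p \<odot>\<^bsub>?W\<^esub> y \<in> N"
    if p: "p \<in> carrier ?P" "p \<noteq> \<zero>\<^bsub>?P\<^esub>" and m: "m \<in> carrier V" for p m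
  proof -
    have pc: "p \<odot>\<^bsub>?W\<^esub> y \<in> carrier V" if "y \<in> carrier V" for y
      using PW.smult_closed[OF p(1)] that by simp
    let ?U = "{m \<in> carrier V. \<exists>y \<in> carrier V. m \<ominus>\<^bsub>V\<^esub> p \<odot>\<^bsub>?W\<^esub> y \<in> N}"
    have UI: "x \<in> ?U" if "x \<in> carrier V" "y \<in> carrier V" "x \<ominus>\<^bsub>V\<^esub> p \<odot>\<^bsub>?W\<^esub> y \<in> N" for x y
      using that by blast
    have "submodule ?U B V"
    proof (rule V.submoduleI)
      show "\<zero>\<^bsub>V\<^esub> \<in> ?U"
        by (rule UI[of _ "\<zero>\<^bsub>V\<^esub>"])
          (use PW.smult_zero_right[OF p(1)] V.submodule_zero[OF N(1)] in \<open>simp_all add: V.M.minus_eq\<close>)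
      show "x \<oplus>\<^bsub>V\<^esub> y \<in> ?U" if xy: "x \<in> ?U" "y \<in> ?U" for x y
      proof -
        obtain x' y' where *: "x' \<in> carrier V" "x \<ominus>\<^bsub>V\<^esub> p \<odot>\<^bsub>?W\<^esub> x' \<in> N"
          "y' \<in> carrier V" "y \<ominus>\<^bsub>V\<^esub> p \<odot>\<^bsub>?W\<^esub> y' \<in> N" and c: "x \<in> carrier V" "y \<in> carrier V"
          using xy by blast
        have "(x \<ominus>\<^bsub>V\<^esub> p \<odot>\<^bsub>?W\<^esub> x') \<oplus>\<^bsub>V\<^esub> (y \<ominus>\<^bsub>V\<^esub> p \<odot>\<^bsub>?W\<^esub> y') \<in> N"
          by (rule V.submodule_add[OF N(1) *(2,4)])
        moreover have "(x \<ominus>\<^bsub>V\<^esub> p \<odot>\<^bsub>?W\<^esub> x') \<oplus>\<^bsub>V\<^esub> (y \<ominus>\<^bsub>V\<^esub> p \<odot>\<^bsub>?W\<^esub> y') =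
            (x \<oplus>\<^bsub>V\<^esub> y) \<ominus>\<^bsub>V\<^esub> p \<odot>\<^bsub>?W\<^esub> (x' \<oplus>\<^bsub>V\<^esub> y')"
          using PW.smult_r_distr[OF p(1), of x' y'] *(1,3)
            V.M.diff_add_diff[OF c(1) pc[OF *(1)] c(2) pc[OF *(3)]] by simp
        ultimately show ?thesis using *(1,3) c by (intro UI[of _ "x' \<oplus>\<^bsub>V\<^esub> y'"]) simp_all
      qed
      show "b \<odot>\<^bsub>V\<^esub> x \<in> ?U" if b: "b \<in> carrier B" and x: "x \<in> ?U" for b x
      proof -
        obtain x' where *: "x' \<in> carrier V" "x \<ominus>\<^bsub>V\<^esub> p \<odot>\<^bsub>?W\<^esub> x' \<in> N" and c: "x \<in> carrier V"
          using x by blast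
        have "b \<odot>\<^bsub>V\<^esub> (x \<ominus>\<^bsub>V\<^esub> p \<odot>\<^bsub>?W\<^esub> x') \<in> N" by (rule V.submodule_smult[OF N(1) b *(2)])
        then have "b \<odot>\<^bsub>V\<^esub> x \<ominus>\<^bsub>V\<^esub> p \<odot>\<^bsub>?W\<^esub> (b \<odot>\<^bsub>V\<^esub> x') \<in> N"
          using b *(1) c pc comm[OF p(1) b *(1)] by (simp add: V.smult_diff_right)
        then show ?thesis using b *(1) c by (intro UI[of _ "b \<odot>\<^bsub>V\<^esub> x'"]) simp_all
      qed
    qed simp
    moreover have "N \<subseteq> ?U"
    proof
      fix x assume x: "x \<in> N"
      show "x \<in> ?U"
        by (rule UI[of _ "\<zero>\<^bsub>V\<^esub>"])
          (use PW.smult_zero_right[OF p(1)] V.submodule_carrier[OF N(1) x] x in \<open>simp_all add: V.M.minus_eq\<close>)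
    qed
    moreover have "f x \<in> ?U" if x: "x \<in> ?U" for x
    proof -
      obtain x' where *: "x' \<in> carrier V" "x \<ominus>\<^bsub>V\<^esub> p \<odot>\<^bsub>?W\<^esub> x' \<in> N" and c: "x \<in> carrier V"
        using x by blast
      have "f (x \<ominus>\<^bsub>V\<^esub> p \<odot>\<^bsub>?W\<^esub> x') = f x \<ominus>\<^bsub>V\<^esub> f (p \<odot>\<^bsub>?W\<^esub> x')"
        using PW.smult_diff_right[of "monom ?P \<one>\<^bsub>K\<^esub> 1" x "p \<odot>\<^bsub>?W\<^esub> x'"] c pc[OF *(1)]
          X[OF c] X[OF pc[OF *(1)]] X[of "x \<ominus>\<^bsub>V\<^esub> p \<odot>\<^bsub>?W\<^esub> x'"] by (simp add: minus_W)
      then have "f x \<ominus>\<^bsub>V\<^esub> p \<odot>\<^bsub>?W\<^esub> f x' \<in> N" using N(2)[OF *(2)] p_f[OF p(1) *(1)] by simp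
      then show ?thesis using f_closed c *(1) by (intro UI[of _ "f x'"]) simp_all
    qed
    ultimately have "?U = N \<or> ?U = carrier V" by (rule max)
    moreover have "\<exists>z \<in> ?U. z \<notin> N"
    proof -
      obtain y where y: "y \<in> carrier V" "p \<odot>\<^bsub>?W\<^esub> y \<notin> N" using nonzero[OF p] by blast
      have "p \<odot>\<^bsub>?W\<^esub> y \<in> ?U"
        by (rule UI[of _ y]) (use pc y(1) V.submodule_zero[OF N(1)] in \<open>simp_all add: V.M.minus_eq V.M.r_neg\<close>)
      then show ?thesis using y(2) by blast
    qed
    ultimately show ?thesis using m by blast
  qed
  \<comment> \<open>Any vector outside \<open>N\<close> generates \<open>V\<close> modulo
    \<open>N\<close> over \<open>B\<close> and \<open>k[X]\<close>, by maximality of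
    \<open>N\<close>.\<close>
  obtain v where v: "v \<in> carrier V" "v \<notin> N"
    using V.submodule_subset[OF N(1)] N(3) by blast
  obtain d :: nat and s where ac: "almost_commuting ?P ?W d (\<lambda>i m. s i \<odot>\<^bsub>V\<^esub> m)"
    and s: "\<And>i. i < d \<Longrightarrow> s i \<in> carrier B"
    and sub: "\<And>Y. \<lbrakk>submodule Y ?P ?W; \<And>i m. \<lbrakk>i < d; m \<in> Y\<rbrakk> \<Longrightarrow> s i \<odot>\<^bsub>V\<^esub> m \<in> Y\<rbrakk> \<Longrightarrow> submodule Y B V"
    using almost_commuting_generators by metis
  interpret S: stable_submodule ?P ?W d "\<lambda>i m. s i \<odot>\<^bsub>V\<^esub> m" v N
    by (intro stable_submodule.intro stable_submodule_axioms.intro ac)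
      (use v NW s V.submodule_smult[OF N(1)] in auto)
  let ?Z = "lin_span ?P ?W (N \<union> S.mon ` S.exps)"
  have ZV: "submodule ?Z B V" by (rule sub[OF S.submodule_span_mon S.x_span_mon])
  have NZ: "N \<union> S.mon ` S.exps \<subseteq> ?Z" by (rule PW.lin_span_superset)
  have "v \<in> S.mon ` S.exps"
    by (rule image_eqI[of _ _ "{#}"]) (simp_all add: S.mon_empty S.exps_def)
  then have "v \<in> ?Z" using NZ by blast
  moreover have "?Z = N \<or> ?Z = carrier V"
    by (rule max[OF ZV]) (use NZ V_stable[OF S.submodule_span_mon] in auto)
  ultimately have Z: "carrier ?W = ?Z" using v(2) by auto
  have "N \<noteq> carrier ?W" using N(3) by simp
  then obtain h where h: "h \<in> carrier ?P" "h \<noteq> \<zero>\<^bsub>?P\<^esub>"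
    "\<And>q. \<lbrakk>q \<in> carrier ?P; q \<noteq> \<zero>\<^bsub>?P\<^esub>\<rbrakk> \<Longrightarrow> \<exists>k::nat. \<exists>c \<in> carrier ?P. h [^]\<^bsub>?P\<^esub> k = q \<otimes>\<^bsub>?P\<^esub> c"
    using S.divisible_imp_divides_power[OF Z] inj surj by (simp add: minus_W) metis
  show False
    using h(3)[OF D.one_plus_X_mult_not_dvd_power(1,2)[OF h(1,2) refl]]
      D.one_plus_X_mult_not_dvd_power(3)[OF h(1,2) refl] by blast
qed

lemma endomorphism_algebraic:
  assumes V: "left_module B V" and f: "f \<in> module_End B V" and ne: "carrier V \<noteq> {\<zero>\<^bsub>V\<^esub>}"
    and triv: "\<And>U. \<lbrakk>submodule U B V; \<And>m. m \<in> U \<Longrightarrow> f m \<in> U\<rbrakk> \<Longrightarrow> U = {\<zero>\<^bsub>V\<^esub>} \<or> U = carrier V"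
  shows "algebraic_map K (restrict_scalars (scalar B) V) f"
proof -
  interpret V: left_module B V by (rule V)
  have "\<forall>a \<in> carrier B. \<forall>x \<in> carrier V. f (a \<odot>\<^bsub>V\<^esub> x) = a \<odot>\<^bsub>V\<^esub> f x"
    and "f \<in> carrier V \<rightarrow> carrier V" using f unfolding module_End_def by blast+
  note this(1)[rule_format, OF B.zero_closed V.M.zero_closed] and funcset_mem[OF this(2) V.M.zero_closed]
  then have f0: "f \<zero>\<^bsub>V\<^esub> = \<zero>\<^bsub>V\<^esub>" by simp
  obtain p where p: "p \<in> carrier (UP K)" "p \<noteq> \<zero>\<^bsub>UP K\<^esub>"
    "\<And>m. m \<in> carrier V \<Longrightarrow> p \<odot>\<^bsub>poly_module K (restrict_scalars (scalar B) V) f\<^esub> m \<in> {\<zero>\<^bsub>V\<^esub>}"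
    by (rule maximal_stable_submodule_algebraic[OF V f V.submodule_zero_set _ ne[symmetric]])
      (use f0 triv in auto)
  show ?thesis
    unfolding algebraic_map_def by (rule bexI[OF _ p(1)]) (use p(2,3) in \<open>auto simp: poly_module_def\<close>)
qed

lemma module_End_algebraic:
  assumes "simple_module B V" "f \<in> module_End B V"
  shows "algebraic_map K (restrict_scalars (scalar B) V) f"
proof -
  interpret V: simple_module B V by (rule assms)
  show ?thesis
    by (rule endomorphism_algebraic[OF V.left_module_axioms assms(2) V.nonzero])
      (rule V.submodule_trivial)
qed

text \<open>Viewed over \<open>B\<close> through constant polynomials, \<open>M\<close> has the
  action of \<open>X\<close> as an endomorphism because \<open>X\<close> is central, and the
  \<open>X\<close>-stable \<open>B\<close>-submodules are \<open>B[X]\<close>-submodules.\<close>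

lemma poly_var_algebraic:
  fixes M :: "(nat \<Rightarrow> 'c, 'm) module"
  assumes "simple_module (UP B) M"
  shows "algebraic_map K (restrict_scalars (poly_scalar B) M) (\<lambda>m. poly_var B \<odot>\<^bsub>M\<^esub> m)"
proof -
  interpret M: simple_module "UP B" M by (rule assms)
  interpret U: UP_ring B "UP B" by unfold_locales
  let ?V = "restrict_scalars (\<lambda>b. monom (UP B) b 0) M"
  let ?f = "\<lambda>m. poly_var B \<odot>\<^bsub>M\<^esub> m"
  have one: "monom (UP B) \<one>\<^bsub>B\<^esub> 0 = \<one>\<^bsub>UP B\<^esub>" by (rule U.monom_one)
  have mult: "monom (UP B) a n \<otimes>\<^bsub>UP B\<^esub> monom (UP B) b k = monom (UP B) (a \<otimes>\<^bsub>B\<^esub> b) (n + k)"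
    if "a \<in> carrier B" "b \<in> carrier B" for a b n k
    using U.monom_mult[OF that] by simp
  have X: "poly_var B \<in> carrier (UP B)" by (simp add: poly_var_def)
  have V: "left_module B ?V"
  proof (intro left_module.intro left_module_axioms.intro)
    show "abelian_group ?V" by (rule abelian_group_cong[OF M.M.abelian_group_axioms]) simp_all
  next
    fix a b x assume "a \<in> carrier B" "b \<in> carrier B" "x \<in> carrier ?V"
    then show "(a \<otimes>\<^bsub>B\<^esub> b) \<odot>\<^bsub>?V\<^esub> x = a \<odot>\<^bsub>?V\<^esub> (b \<odot>\<^bsub>?V\<^esub> x)"
      using mult[of a b 0 0] M.smult_assoc1[of "monom (UP B) a 0" "monom (UP B) b 0" x] by simp
  qed (simp_all add: B.ring_axioms one M.smult_l_distr M.smult_r_distr)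
  have f: "?f \<in> module_End B ?V"
    unfolding module_End_def
  proof (intro CollectI conjI ballI)
    fix a m assume am: "a \<in> carrier B" "m \<in> carrier ?V"
    have "poly_var B \<otimes>\<^bsub>UP B\<^esub> monom (UP B) a 0 = monom (UP B) a 0 \<otimes>\<^bsub>UP B\<^esub> poly_var B"
      using mult[of "\<one>\<^bsub>B\<^esub>" a 1 0] mult[of a "\<one>\<^bsub>B\<^esub>" 0 1] am(1) by (simp add: poly_var_def)
    then show "?f (a \<odot>\<^bsub>?V\<^esub> m) = a \<odot>\<^bsub>?V\<^esub> ?f m"
      using am X by (simp flip: M.smult_assoc1)
  qed (use X M.smult_r_distr in auto)
  have pow: "(?f ^^ n) m = monom (UP B) \<one>\<^bsub>B\<^esub> n \<odot>\<^bsub>M\<^esub> m" if "m \<in> carrier M" for n m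
  proof (induction n)
    case 0
    show ?case using that one by simp
  next
    case (Suc n)
    have "poly_var B \<otimes>\<^bsub>UP B\<^esub> monom (UP B) \<one>\<^bsub>B\<^esub> n = monom (UP B) \<one>\<^bsub>B\<^esub> (Suc n)"
      using mult[of "\<one>\<^bsub>B\<^esub>" "\<one>\<^bsub>B\<^esub>" 1 n] by (simp add: poly_var_def)
    then show ?case using Suc that X M.smult_assoc1[OF X, of "monom (UP B) \<one>\<^bsub>B\<^esub> n" m] by simp
  qed
  have "algebraic_map K (restrict_scalars (scalar B) ?V) ?f"
  proof (rule endomorphism_algebraic[OF V f])
    show "carrier ?V \<noteq> {\<zero>\<^bsub>?V\<^esub>}" using M.nonzero by simp
  next
    fix U assume U: "submodule U B ?V" and fU: "\<And>m. m \<in> U \<Longrightarrow> ?f m \<in> U"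
    interpret V: left_module B ?V by (rule V)
    have "submodule U (UP B) M"
    proof (rule M.submoduleI)
      fix p m assume p: "p \<in> carrier (UP B)" and m: "m \<in> U"
      have mM: "m \<in> carrier M" using V.submodule_carrier[OF U m] by simp
      from p show "p \<odot>\<^bsub>M\<^esub> m \<in> U"
      proof (induction p rule: U.UP_induct)
        case (monom a n)
        have "(?f ^^ n) m \<in> U" by (induction n) (use fU m in auto)
        then have "a \<odot>\<^bsub>?V\<^esub> (?f ^^ n) m \<in> U" by (rule V.submodule_smult[OF U monom])
        moreover have "a \<odot>\<^bsub>?V\<^esub> (?f ^^ n) m = monom (UP B) a n \<odot>\<^bsub>M\<^esub> m"
          using mult[of a "\<one>\<^bsub>B\<^esub>" 0 n] monom mM pow[OF mM]
            M.smult_assoc1[of "monom (UP B) a 0" "monom (UP B) \<one>\<^bsub>B\<^esub> n" m] by simp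
        ultimately show ?case by simp
      next
        case (add p q)
        then show ?case using V.submodule_add[OF U] M.smult_l_distr[of p q m] mM by simp
      qed
    qed (use V.submodule_subset[OF U] V.submodule_zero[OF U] V.submodule_add[OF U] in auto)
    then show "U = {\<zero>\<^bsub>?V\<^esub>} \<or> U = carrier ?V" using M.submodule_trivial by simp
  qed
  moreover have "restrict_scalars (scalar B) ?V = restrict_scalars (poly_scalar B) M"
    by (simp add: restrict_scalars_def poly_scalar_def)
  ultimately show ?thesis by simp
qed

end

section \<open>Left ideals and maximal submodules\<close>

text \<open>Left ideals become submodules of this module, so that they share the lemmas on
  submodules.\<close>

definition regular_module :: "('a, 'r) ring_scheme \<Rightarrow> ('a, 'a) module" where
  "regular_module R = \<lparr>carrier = carrier R, monoid.mult = monoid.mult R, one = one R,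
     zero = zero R, add = add R, smult = monoid.mult R\<rparr>"

lemma regular_module_simps [simp]:
  "carrier (regular_module R) = carrier R"
  "\<zero>\<^bsub>regular_module R\<^esub> = \<zero>\<^bsub>R\<^esub>"
  "add (regular_module R) = add R"
  "smult (regular_module R) = monoid.mult R"
  by (simp_all add: regular_module_def)

lemma (in ring) regular_left_module: "left_module R (regular_module R)"
proof (intro left_module.intro left_module_axioms.intro)
  show "abelian_group (regular_module R)"
    by (rule abelian_group_cong[OF abelian_group_axioms]) simp_all
qed (simp_all add: ring_axioms l_distr r_distr m_assoc)

lemma (in ring) ideal_imp_submodule:
  assumes "ideal I R"
  shows "submodule I R (regular_module R)"
proof -
  interpret I: ideal I R by (rule assms)
  show ?thesis
    by (rule left_module.submoduleI[OF regular_left_module]) (auto simp: I.I_l_closed)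
qed

text \<open>Maximal condition for left ideals. Inclusion of left ideals gives inclusion of their
  leading exponents; a left ideal whose exponent set is maximal is itself maximal, because over a
  field equal exponents force equality.\<close>

lemma (in almost_commutative_algebra) left_noetherian:
  assumes ne: "L0 \<in> \<L>" and sub: "\<And>L. L \<in> \<L> \<Longrightarrow> submodule L B (regular_module B)"
  obtains L where "L \<in> \<L>" "\<And>L'. \<lbrakk>L' \<in> \<L>; L \<subseteq> L'\<rbrakk> \<Longrightarrow> L' = L"
proof -
  interpret V: left_module B "regular_module B" by (rule B.regular_left_module)
  interpret KB: left_module K B by (rule B_left_module)
  have scal: "\<exists>p \<in> carrier K. \<forall>m \<in> carrier B. scalar B c \<otimes>\<^bsub>B\<^esub> m = p \<odot>\<^bsub>B\<^esub> m" if "c \<in> carrier K" for c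
    using that scalar_mult by blast
  interpret two_actions K B \<gg> "regular_module B" K B
    by unfold_locales (simp_all add: smult_mult_r scal)
  obtain d :: nat and s where gen:
    "almost_commuting K B d (\<lambda>i m. s i \<odot>\<^bsub>regular_module B\<^esub> m)"
    "\<And>i. i < d \<Longrightarrow> s i \<in> carrier B"
    "\<And>Y. \<lbrakk>submodule Y K B; \<And>i m. \<lbrakk>i < d; m \<in> Y\<rbrakk> \<Longrightarrow> s i \<odot>\<^bsub>regular_module B\<^esub> m \<in> Y\<rbrakk> \<Longrightarrow>
      submodule Y B (regular_module B)"
    using almost_commuting_generators by metis
  note ac = gen(1)[unfolded regular_module_simps] and s = gen(2)
    and subB = gen(3)[unfolded regular_module_simps]
  let ?x = "\<lambda>i m. s i \<otimes>\<^bsub>B\<^esub> m"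
  have subK: "submodule L K B" if L: "L \<in> \<L>" for L
  proof (rule KB.submoduleI)
    fix c m assume "c \<in> carrier K" "m \<in> L"
    then show "c \<odot>\<^bsub>B\<^esub> m \<in> L"
      using V.submodule_smult[OF sub[OF L], of "scalar B c" m] V.submodule_carrier[OF sub[OF L]]
      by (simp add: scalar_mult)
  qed (use V.submodule_subset[OF sub[OF L]] V.submodule_zero[OF sub[OF L]]
      V.submodule_add[OF sub[OF L]] in auto)
  have st: "stable_submodule K B d ?x \<one>\<^bsub>B\<^esub> L" if L: "L \<in> \<L>" for L
    by (intro stable_submodule.intro stable_submodule_axioms.intro ac subK[OF L])
      (use s V.submodule_smult[OF sub[OF L]] in auto)
  let ?tor = "stable_submodule.torsion K B d ?x \<one>\<^bsub>B\<^esub>"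
  have "\<exists>U \<in> ?tor ` \<L>. \<forall>V \<in> ?tor ` \<L>. U \<subseteq> V \<longrightarrow> V = U"
  proof -
    have D: "set_mset a \<subseteq> {..<d}" if "U \<in> ?tor ` \<L>" "a \<in> U" for U a
    proof -
      obtain L where "L \<in> \<L>" "a \<in> ?tor L" using \<open>U \<in> ?tor ` \<L>\<close> \<open>a \<in> U\<close> by blast
      then show ?thesis
        using stable_submodule.torsion_exps[OF st] stable_submodule.exps_def[OF st] by blast
    qed
    have up: "b \<in> U" if "U \<in> ?tor ` \<L>" "a \<in> U" "a \<subseteq># b" "set_mset b \<subseteq> {..<d}" for U a b
    proof -
      obtain L where L: "L \<in> \<L>" "U = ?tor L" using \<open>U \<in> ?tor ` \<L>\<close> by blast
      have "b \<in> stable_submodule.exps d" using that(4) stable_submodule.exps_def[OF st[OF L(1)]] by blast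
      then show ?thesis using stable_submodule.torsion_upclosed[OF st[OF L(1)]] that(2,3) L(2) by blast
    qed
    show ?thesis
    proof (rule dickson_maximal[of "{..<d}" "?tor ` \<L>" "?tor L0"])
      show "\<exists>U \<in> ?tor ` \<L>. \<forall>V \<in> ?tor ` \<L>. U \<subseteq> V \<longrightarrow> V = U"
        if "U \<in> ?tor ` \<L>" "\<And>V. \<lbrakk>V \<in> ?tor ` \<L>; U \<subseteq> V\<rbrakk> \<Longrightarrow> V = U" for U
        by (rule bexI[OF _ that(1)]) (intro ballI impI that(2))
    qed (rule finite_lessThan, erule (1) D, erule (3) up, rule imageI[OF ne])
  qed
  then obtain L where L: "L \<in> \<L>" "\<And>L'. \<lbrakk>L' \<in> \<L>; ?tor L \<subseteq> ?tor L'\<rbrakk> \<Longrightarrow> ?tor L' = ?tor L" by blast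
  show thesis
  proof (rule that[OF L(1)])
    fix L' assume L': "L' \<in> \<L>" "L \<subseteq> L'"
    interpret S: stable_submodule K B d ?x "\<one>\<^bsub>B\<^esub>" L by (rule st[OF L(1)])
    interpret S': stable_submodule K B d ?x "\<one>\<^bsub>B\<^esub>" L' by (rule st[OF L'(1)])
    have "S.below a \<subseteq> S'.below a" for a
      unfolding S.below_def S'.below_def by (rule KB.lin_span_mono) (use L'(2) in blast)
    then have "S.torsion \<subseteq> S'.torsion"
      unfolding S.torsion_def S'.torsion_def by blast
    then have "S'.torsion \<subseteq> S.torsion" using L(2)[OF L'(1)] by simp
    moreover have "carrier B = lin_span K B (L \<union> S.mon ` S.exps)"
    proof -
      let ?Z = "lin_span K B (L \<union> S.mon ` S.exps)"
      have Z: "submodule ?Z B (regular_module B)"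
        by (rule subB[OF S.submodule_span_mon S.x_span_mon])
      have "\<one>\<^bsub>B\<^esub> \<in> S.mon ` S.exps"
        by (rule image_eqI[of _ _ "{#}"]) (simp_all add: S.mon_empty S.exps_def)
      then have "\<one>\<^bsub>B\<^esub> \<in> ?Z" using KB.lin_span_superset[of "L \<union> S.mon ` S.exps"] by blast
      then have "b \<in> ?Z" if "b \<in> carrier B" for b
        using V.submodule_smult[OF Z that, of "\<one>\<^bsub>B\<^esub>"] that by simp
      then show ?thesis using KB.submodule_subset[OF S.submodule_span_mon] by blast
    qed
    ultimately obtain h where h: "h \<in> carrier K" "h \<noteq> \<zero>\<^bsub>K\<^esub>"
      "\<And>y. y \<in> L' \<Longrightarrow> \<exists>k::nat. h [^]\<^bsub>K\<^esub> k \<odot>\<^bsub>B\<^esub> y \<in> L"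
      using S.torsion_subset_imp_power_mem[OF st[OF L'(1)] L'(2)] by metis
    have "y \<in> L" if y: "y \<in> L'" for y
    proof -
      obtain k :: nat where k: "h [^]\<^bsub>K\<^esub> k \<odot>\<^bsub>B\<^esub> y \<in> L" using h(3)[OF y] by blast
      have yB: "y \<in> carrier B" by (rule KB.submodule_carrier[OF subK[OF L'(1)] y])
      \<comment> \<open>Here the domain is the field \<open>k\<close>, so the power of
        \<open>h\<close> can be cancelled.\<close>
      have "h [^]\<^bsub>K\<^esub> k \<noteq> \<zero>\<^bsub>K\<^esub>" using h(1,2) by (induction k) (auto dest: K.integral)
      then have u: "h [^]\<^bsub>K\<^esub> k \<in> Units K" using h(1) K.field_Units by simp
      have "inv\<^bsub>K\<^esub> (h [^]\<^bsub>K\<^esub> k) \<odot>\<^bsub>B\<^esub> (h [^]\<^bsub>K\<^esub> k \<odot>\<^bsub>B\<^esub> y) = y"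
        using K.Units_l_inv[OF u] K.Units_inv_closed[OF u] h(1) yB
        by (simp flip: KB.smult_assoc1)
      then show ?thesis
        using KB.submodule_smult[OF subK[OF L(1)] K.Units_inv_closed[OF u] k] by simp
    qed
    then show "L' = L" using L'(2) by blast
  qed
qed

text \<open>Zorn's lemma. Finiteness of \<open>X\<close> ensures that the union of a chain still
  omits part of \<open>X\<close>, since otherwise a single member would contain all of
  \<open>X\<close>. With \<open>X\<close> a set of generators, maximal proper submodules
  result.\<close>

lemma ex_maximal_not_containing:
  fixes Q :: "'a set \<Rightarrow> bool"
  assumes U0: "Q U0" "\<not> X \<subseteq> U0" and X: "finite X"
    and union: "\<And>\<C>. \<lbrakk>\<C> \<noteq> {}; \<And>A. A \<in> \<C> \<Longrightarrow> Q A; \<And>A A'. \<lbrakk>A \<in> \<C>; A' \<in> \<C>\<rbrakk> \<Longrightarrow> A \<subseteq> A' \<or> A' \<subseteq> A\<rbrakk> \<Longrightarrow> Q (\<Union>\<C>)"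
  obtains U where "Q U" "U0 \<subseteq> U" "\<not> X \<subseteq> U" "\<And>U'. \<lbrakk>Q U'; U \<subseteq> U'; \<not> X \<subseteq> U'\<rbrakk> \<Longrightarrow> U' = U"
proof -
  let ?\<A> = "{U. Q U \<and> U0 \<subseteq> U \<and> \<not> X \<subseteq> U}"
  have "\<exists>U \<in> ?\<A>. \<forall>U' \<in> ?\<A>. U \<subseteq> U' \<longrightarrow> U' = U"
  proof (rule subset_Zorn_nonempty)
    show "?\<A> \<noteq> {}" using U0 by blast
  next
    fix \<C> assume ne: "\<C> \<noteq> {}" and ch: "subset.chain ?\<A> \<C>"
    then have C: "\<C> \<subseteq> ?\<A>" "\<And>A A'. \<lbrakk>A \<in> \<C>; A' \<in> \<C>\<rbrakk> \<Longrightarrow> A \<subseteq> A' \<or> A' \<subseteq> A"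
      by (auto simp: subset_chain_def)
    have "Q (\<Union>\<C>)" by (rule union[OF ne]) (use C in blast)+
    moreover have "\<not> X \<subseteq> \<Union>\<C>"
    proof
      assume "X \<subseteq> \<Union>\<C>"
      from finite_subset_Union_chain[OF X this ne ch] obtain A where "A \<in> \<C>" "X \<subseteq> A" .
      then show False using C(1) by blast
    qed
    ultimately show "\<Union>\<C> \<in> ?\<A>" using ne C(1) by blast
  qed
  then obtain U where "U \<in> ?\<A>" and max: "\<forall>U' \<in> ?\<A>. U \<subseteq> U' \<longrightarrow> U' = U" ..
  then have U: "Q U" "U0 \<subseteq> U" "\<not> X \<subseteq> U" by simp_all
  show thesis
  proof (rule that[OF U])
    fix U' assume "Q U'" "U \<subseteq> U'" "\<not> X \<subseteq> U'"
    then show "U' = U" using max U(2) by simp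
  qed
qed

context left_module
begin

lemma submodule_Union_chain:
  assumes "\<C> \<noteq> {}" and sub: "\<And>A. A \<in> \<C> \<Longrightarrow> submodule A R M"
    and ch: "\<And>A A'. \<lbrakk>A \<in> \<C>; A' \<in> \<C>\<rbrakk> \<Longrightarrow> A \<subseteq> A' \<or> A' \<subseteq> A"
  shows "submodule (\<Union>\<C>) R M"
proof (rule submoduleI)
  show "\<Union>\<C> \<subseteq> carrier M" using submodule_subset[OF sub] by blast
  show "\<zero>\<^bsub>M\<^esub> \<in> \<Union>\<C>" using assms(1) submodule_zero[OF sub] by blast
next
  fix x y assume "x \<in> \<Union>\<C>" "y \<in> \<Union>\<C>"
  then obtain A A' where A: "A \<in> \<C>" "x \<in> A" "A' \<in> \<C>" "y \<in> A'" by blast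
  from ch[OF A(1,3)] show "x \<oplus>\<^bsub>M\<^esub> y \<in> \<Union>\<C>"
  proof
    assume "A \<subseteq> A'"
    then show ?thesis using submodule_add[OF sub[OF A(3)], of x y] A by blast
  next
    assume "A' \<subseteq> A"
    then show ?thesis using submodule_add[OF sub[OF A(1)], of x y] A by blast
  qed
next
  fix a x assume "a \<in> carrier R" "x \<in> \<Union>\<C>"
  then show "a \<odot>\<^bsub>M\<^esub> x \<in> \<Union>\<C>" using submodule_smult[OF sub] by blast
qed

lemma submodule_finsum:
  assumes N: "submodule N R M" and "finite A" "\<And>i. i \<in> A \<Longrightarrow> g i \<in> N"
  shows "(\<Oplus>\<^bsub>M\<^esub>i\<in>A. g i) \<in> N"
  using assms(2,3)
proof (induction A)
  case empty
  show ?case using submodule_zero[OF N] by simp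
next
  case (insert i A)
  have "g \<in> A \<rightarrow> carrier M" "g i \<in> carrier M" using insert.prems submodule_carrier[OF N] by auto
  then show ?case using insert submodule_add[OF N] by simp
qed

text \<open>The annihilator of the simple module \<open>M / N\<close>.\<close>

lemma maximal_submodule_primitive:
  assumes N: "submodule N R M" "N \<noteq> carrier M"
    and max: "\<And>U. \<lbrakk>submodule U R M; N \<subseteq> U\<rbrakk> \<Longrightarrow> U = N \<or> U = carrier M"
  shows "primitive_ideal R {b \<in> carrier R. \<forall>m \<in> carrier M. b \<odot>\<^bsub>M\<^esub> m \<in> N}"
proof -
  \<comment> \<open>The coset of \<open>m\<close> modulo \<open>N\<close>, as a set.\<close>
  define \<psi> where "\<psi> m = {y \<in> carrier M. y \<ominus>\<^bsub>M\<^esub> m \<in> N}" for m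
  have self: "m \<in> \<psi> m" if "m \<in> carrier M" for m
    using that submodule_zero[OF N(1)] by (simp add: \<psi>_def M.minus_eq M.r_neg)
  have \<psi>_eq: "\<psi> m = \<psi> n \<longleftrightarrow> m \<ominus>\<^bsub>M\<^esub> n \<in> N" if mn: "m \<in> carrier M" "n \<in> carrier M" for m n
  proof
    assume "\<psi> m = \<psi> n"
    then have "m \<in> \<psi> n" using self[OF mn(1)] by simp
    then show "m \<ominus>\<^bsub>M\<^esub> n \<in> N" by (simp add: \<psi>_def)
  next
    assume *: "m \<ominus>\<^bsub>M\<^esub> n \<in> N"
    have **: "n \<ominus>\<^bsub>M\<^esub> m \<in> N" by (rule submodule_diff_sym[OF N(1) * mn])
    have "y \<ominus>\<^bsub>M\<^esub> m \<in> N \<longleftrightarrow> y \<ominus>\<^bsub>M\<^esub> n \<in> N" if "y \<in> carrier M" for y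
      using submodule_diff_trans[OF N(1) _ * that mn] submodule_diff_trans[OF N(1) _ ** that mn(2,1)]
      by blast
    then show "\<psi> m = \<psi> n" unfolding \<psi>_def by blast
  qed
  \<comment> \<open>A choice of representatives, through which the operations on cosets are defined;
    the choice matters only modulo \<open>N\<close>.\<close>
  define \<phi> where "\<phi> S = (SOME m. m \<in> carrier M \<and> \<psi> m = S)" for S
  have \<phi>: "\<phi> (\<psi> m) \<in> carrier M" "\<phi> (\<psi> m) \<ominus>\<^bsub>M\<^esub> m \<in> N" if m: "m \<in> carrier M" for m
  proof -
    have "\<phi> (\<psi> m) \<in> carrier M \<and> \<psi> (\<phi> (\<psi> m)) = \<psi> m"
      unfolding \<phi>_def by (rule someI[of _ m]) (simp add: m)
    then show "\<phi> (\<psi> m) \<in> carrier M" "\<phi> (\<psi> m) \<ominus>\<^bsub>M\<^esub> m \<in> N" using \<psi>_eq m by blast+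
  qed
  define Q :: "('a, 'c set) module" where
    "Q = \<lparr>carrier = \<psi> ` carrier M, monoid.mult = undefined, one = undefined, zero = \<psi> \<zero>\<^bsub>M\<^esub>,
      add = (\<lambda>S T. \<psi> (\<phi> S \<oplus>\<^bsub>M\<^esub> \<phi> T)), smult = (\<lambda>a S. \<psi> (a \<odot>\<^bsub>M\<^esub> \<phi> S))\<rparr>"
  have Q_carrier: "carrier Q = \<psi> ` carrier M" and Q_zero: "\<zero>\<^bsub>Q\<^esub> = \<psi> \<zero>\<^bsub>M\<^esub>"
    by (simp_all add: Q_def)
  have Q_add: "\<psi> m \<oplus>\<^bsub>Q\<^esub> \<psi> n = \<psi> (m \<oplus>\<^bsub>M\<^esub> n)" if mn: "m \<in> carrier M" "n \<in> carrier M" for m n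
  proof -
    have "(\<phi> (\<psi> m) \<oplus>\<^bsub>M\<^esub> \<phi> (\<psi> n)) \<ominus>\<^bsub>M\<^esub> (m \<oplus>\<^bsub>M\<^esub> n) \<in> N"
      using submodule_add[OF N(1) \<phi>(2)[OF mn(1)] \<phi>(2)[OF mn(2)]]
        M.diff_add_diff[OF \<phi>(1)[OF mn(1)] mn(1) \<phi>(1)[OF mn(2)] mn(2)] by simp
    then show ?thesis using \<psi>_eq \<phi>(1) mn by (simp add: Q_def)
  qed
  have Q_smult: "a \<odot>\<^bsub>Q\<^esub> \<psi> m = \<psi> (a \<odot>\<^bsub>M\<^esub> m)" if am: "a \<in> carrier R" "m \<in> carrier M" for a m
  proof -
    have "a \<odot>\<^bsub>M\<^esub> \<phi> (\<psi> m) \<ominus>\<^bsub>M\<^esub> a \<odot>\<^bsub>M\<^esub> m \<in> N"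
      using submodule_smult[OF N(1) am(1) \<phi>(2)[OF am(2)]] smult_diff_right[OF am(1) \<phi>(1)[OF am(2)] am(2)]
      by simp
    then show ?thesis using \<psi>_eq \<phi>(1) am by (simp add: Q_def)
  qed
  have zero_iff: "\<psi> m = \<zero>\<^bsub>Q\<^esub> \<longleftrightarrow> m \<in> N" if "m \<in> carrier M" for m
    using that \<psi>_eq[OF that M.zero_closed] by (simp add: Q_zero M.minus_eq)
  have Q: "left_module R Q"
  proof (intro left_module.intro left_module_axioms.intro)
    show "abelian_group Q"
    proof (rule abelian_groupI)
      fix u assume "u \<in> carrier Q"
      then obtain m where m: "m \<in> carrier M" "u = \<psi> m" by (auto simp: Q_carrier)
      have "\<psi> (\<ominus>\<^bsub>M\<^esub> m) \<oplus>\<^bsub>Q\<^esub> u = \<zero>\<^bsub>Q\<^esub>"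
        using m by (simp add: Q_add Q_zero M.l_neg)
      then show "\<exists>w\<in>carrier Q. w \<oplus>\<^bsub>Q\<^esub> u = \<zero>\<^bsub>Q\<^esub>" using m by (auto simp: Q_carrier)
    qed (auto simp: Q_carrier Q_zero Q_add M.a_ac)
  qed (auto simp: R.ring_axioms Q_carrier Q_add Q_smult smult_l_distr smult_r_distr smult_assoc1)
  interpret Q: left_module R Q by (rule Q)
  have simple: "simple_module R Q"
  proof (intro simple_module.intro simple_module_axioms.intro Q)
    obtain m where m: "m \<in> carrier M" "m \<notin> N" using submodule_subset[OF N(1)] N(2) by blast
    then have "\<psi> m \<in> carrier Q" "\<psi> m \<noteq> \<zero>\<^bsub>Q\<^esub>" using zero_iff by (auto simp: Q_carrier)
    then show "carrier Q \<noteq> {\<zero>\<^bsub>Q\<^esub>}" by auto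
  next
    fix U assume U: "submodule U R Q"
    let ?W = "{m \<in> carrier M. \<psi> m \<in> U}"
    have U_eq: "U = \<psi> ` ?W" using Q.submodule_subset[OF U] by (auto simp: Q_carrier)
    have W: "submodule ?W R M"
    proof (rule submoduleI)
      show "\<zero>\<^bsub>M\<^esub> \<in> ?W" using Q.submodule_zero[OF U] by (simp add: Q_zero)
      show "x \<oplus>\<^bsub>M\<^esub> y \<in> ?W" if "x \<in> ?W" "y \<in> ?W" for x y
        using that Q.submodule_add[OF U, of "\<psi> x" "\<psi> y"] by (simp add: Q_add)
      show "a \<odot>\<^bsub>M\<^esub> x \<in> ?W" if "a \<in> carrier R" "x \<in> ?W" for a x
        using that Q.submodule_smult[OF U, of a "\<psi> x"] by (simp add: Q_smult)
    qed simp
    have "N \<subseteq> ?W"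
    proof
      fix m assume m: "m \<in> N"
      then have "m \<in> carrier M" by (rule submodule_carrier[OF N(1)])
      moreover from this have "\<psi> m = \<zero>\<^bsub>Q\<^esub>" using m zero_iff by simp
      ultimately show "m \<in> ?W" using Q.submodule_zero[OF U] by simp
    qed
    from max[OF W this] show "U = {\<zero>\<^bsub>Q\<^esub>} \<or> U = carrier Q"
    proof
      assume "?W = N"
      then have "U = \<psi> ` N" using U_eq by simp
      also have "\<dots> = {\<zero>\<^bsub>Q\<^esub>}"
        using zero_iff submodule_carrier[OF N(1)] submodule_zero[OF N(1)] by (auto simp: image_iff)
      finally show ?thesis ..
    next
      assume "?W = carrier M"
      then show ?thesis using U_eq by (simp add: Q_carrier)
    qed
  qed
  have "annihilator R Q = {b \<in> carrier R. \<forall>m \<in> carrier M. b \<odot>\<^bsub>M\<^esub> m \<in> N}"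
    unfolding annihilator_def Q_carrier by (simp add: Q_smult zero_iff cong: conj_cong)
  then show ?thesis using primitive_ideal_annihilator[OF simple] by simp
qed

end

lemma primitive_ideal_mult_closed:
  assumes "primitive_ideal R Q" "r \<in> Q" "b \<in> carrier R"
  shows "r \<otimes>\<^bsub>R\<^esub> b \<in> Q"
proof -
  obtain M :: "('a, 'a set) module" where M: "simple_module R M" "Q = annihilator R M"
    using assms(1) unfolding primitive_ideal_def by blast
  interpret M: simple_module R M by (rule M)
  show ?thesis
    using assms(2,3) by (auto simp: M(2) annihilator_def M.smult_assoc1)
qed

section \<open>The Jacobson property\<close>

declare One_nat_def [simp del]

context UP_ring
begin

lemma UP_left_module: "left_module R P"
  by (intro left_module.intro left_module_axioms.intro R.ring_axioms P.abelian_group_axioms)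
    (simp_all add: UP_smult_l_distr UP_smult_r_distr UP_smult_assoc1)

lemma coeff_X_mult_0: "q \<in> carrier P \<Longrightarrow> coeff P (monom P \<one> 1 \<otimes>\<^bsub>P\<^esub> q) 0 = \<zero>"
  by simp

lemma coeff_X_mult_Suc: "q \<in> carrier P \<Longrightarrow> coeff P (monom P \<one> 1 \<otimes>\<^bsub>P\<^esub> q) (Suc n) = coeff P q n"
  using coeff_monom_mult[of \<one> q 1 n] by (simp add: Suc_eq_plus1 del: coeff_mult)

lemma coeff_mult_monom_0: "\<lbrakk>r \<in> carrier R; p \<in> carrier P\<rbrakk> \<Longrightarrow> coeff P (p \<otimes>\<^bsub>P\<^esub> monom P r 1) 0 = \<zero>"
  by simp

text \<open>The factor \<open>r\<close> stays on the right, as \<open>B\<close> need not be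
  commutative. This yields the recursion for the coefficients of a left inverse of
  \<open>1 - rX\<close>.\<close>

lemma coeff_mult_monom_Suc:
  assumes r: "r \<in> carrier R" and p: "p \<in> carrier P"
  shows "coeff P (p \<otimes>\<^bsub>P\<^esub> monom P r 1) (Suc n) = coeff P p n \<otimes> r"
  using p
proof (induction p rule: UP_induct)
  case (monom a k)
  have "coeff P (monom P a k \<otimes>\<^bsub>P\<^esub> monom P r 1) (Suc n) = coeff P (monom P (a \<otimes> r) (k + 1)) (n + 1)"
    using monom r by (simp only: monom_mult Suc_eq_plus1)
  then show ?case using monom r by (simp del: monom_mult coeff_mult)
next
  case (add p q)
  then show ?case using r by (simp add: P.l_distr R.l_distr del: coeff_mult)
qed

lemma X_mult_smult:
  assumes "a \<in> carrier R" "q \<in> carrier P"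
  shows "monom P \<one> 1 \<otimes>\<^bsub>P\<^esub> (a \<odot>\<^bsub>P\<^esub> q) = a \<odot>\<^bsub>P\<^esub> (monom P \<one> 1 \<otimes>\<^bsub>P\<^esub> q)"
proof (rule up_eqI)
  fix n
  show "coeff P (monom P \<one> 1 \<otimes>\<^bsub>P\<^esub> (a \<odot>\<^bsub>P\<^esub> q)) n = coeff P (a \<odot>\<^bsub>P\<^esub> (monom P \<one> 1 \<otimes>\<^bsub>P\<^esub> q)) n"
    by (cases n) (use assms in \<open>simp_all add: coeff_X_mult_0 coeff_X_mult_Suc del: coeff_mult\<close>)
qed (use assms in simp_all)

lemma X_mult_monom: "monom P \<one> 1 \<otimes>\<^bsub>P\<^esub> monom P \<one> i = monom P \<one> (Suc i)"
  using monom_mult[of \<one> \<one> 1 i] by (simp add: Suc_eq_plus1_left)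

lemma submodule_eq_carrier:
  assumes U: "submodule U R P" and "\<And>i. monom P \<one> i \<in> U"
  shows "U = carrier P"
proof -
  interpret V: left_module R P by (rule UP_left_module)
  have "p \<in> U" if "p \<in> carrier P" for p
    using that
  proof (induction p rule: UP_induct)
    case (monom a n)
    then have "monom P a n = a \<odot>\<^bsub>P\<^esub> monom P \<one> n" using monom_mult_smult[of a \<one> n] by simp
    then show ?case using V.submodule_smult[OF U monom assms(2)[of n]] by simp
  next
    case (add p q)
    then show ?case by (simp add: V.submodule_add[OF U])
  qed
  then show ?thesis using V.submodule_subset[OF U] by blast
qed

end

lemma finsum_record_cong:
  assumes "carrier H = carrier G" "add H = add G" "\<zero>\<^bsub>H\<^esub> = \<zero>\<^bsub>G\<^esub>"
  shows "finsum H g S = finsum G g S"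
  using assms by (simp add: finsum_def finprod_def)

lemma finsum_restrict_scalars: "finsum (restrict_scalars h V) g S = finsum V g S"
  by (rule finsum_record_cong) simp_all

context almost_commutative_algebra
begin

text \<open>Once \<open>X\<close> is algebraic on \<open>B[X] / N\<close>, that module is finitely generated over \<open>B\<close>.\<close>

lemma algebraic_imp_bounded_generators:
  assumes p: "p \<in> carrier (UP K)" "p \<noteq> \<zero>\<^bsub>UP K\<^esub>"
    and pN: "\<And>m. m \<in> carrier (UP B) \<Longrightarrow>
      p \<odot>\<^bsub>poly_module K (restrict_scalars (scalar B) (UP B)) (\<lambda>q. monom (UP B) \<one>\<^bsub>B\<^esub> 1 \<otimes>\<^bsub>UP B\<^esub> q)\<^esub> m \<in> N"
    and U: "submodule U B (UP B)" "N \<subseteq> U" "\<And>i. i \<le> deg K p \<Longrightarrow> monom (UP B) \<one>\<^bsub>B\<^esub> i \<in> U"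
  shows "U = carrier (UP B)"
proof -
  interpret U: UP_ring B "UP B" by unfold_locales
  interpret UK: UP_domain K "UP K" by unfold_locales
  interpret V: left_module B "UP B" by (rule U.UP_left_module)
  let ?f = "\<lambda>q. monom (UP B) \<one>\<^bsub>B\<^esub> 1 \<otimes>\<^bsub>UP B\<^esub> q" and ?x = "\<lambda>i. monom (UP B) \<one>\<^bsub>B\<^esub> i"
  let ?D = "deg K p"
  let ?c = "coeff (UP K) p"
  have pow: "(?f ^^ l) (?x j) = ?x (l + j)" for l j
    by (induction l) (simp_all add: U.X_mult_monom)
  have lc: "?c ?D \<in> carrier K" "?c ?D \<noteq> \<zero>\<^bsub>K\<^esub>"
    using p UK.lcoeff_nonzero2 by auto
  have "?x i \<in> U" for i
  proof (induction i rule: less_induct)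
    case (less i)
    show ?case
    proof (cases "i \<le> ?D")
      case False
      \<comment> \<open>Applying \<open>p\<close> to the \<open>j\<close>-th power of
        \<open>X\<close> gives an element of \<open>N\<close> whose top term is a multiple of the
        \<open>i\<close>-th power and whose other terms are covered by induction.\<close>
      define j where "j = i - ?D"
      have i: "i = ?D + j" using False by (simp add: j_def)
      let ?t = "\<lambda>l. scalar B (?c l) \<odot>\<^bsub>UP B\<^esub> ?x (l + j)"
      have tc: "?t l \<in> carrier (UP B)" for l using p(1) by simp
      have "(\<Oplus>\<^bsub>UP B\<^esub>l\<in>{..?D}. ?t l) \<in> U"
        using pN[of "?x j"] U(2) by (auto simp: poly_module_def pow finsum_restrict_scalars)
      moreover have "{..?D} = insert ?D {..<?D}" by auto
      ultimately have "?t ?D \<oplus>\<^bsub>UP B\<^esub> (\<Oplus>\<^bsub>UP B\<^esub>l\<in>{..<?D}. ?t l) \<in> U"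
        using tc by simp
      moreover have low: "(\<Oplus>\<^bsub>UP B\<^esub>l\<in>{..<?D}. ?t l) \<in> U"
        by (rule V.submodule_finsum[OF U(1)])
          (use i p(1) less.IH V.submodule_smult[OF U(1)] in auto)
      ultimately have "?t ?D \<oplus>\<^bsub>UP B\<^esub> (\<Oplus>\<^bsub>UP B\<^esub>l\<in>{..<?D}. ?t l) \<ominus>\<^bsub>UP B\<^esub> (\<Oplus>\<^bsub>UP B\<^esub>l\<in>{..<?D}. ?t l) \<in> U"
        by (rule V.submodule_diff[OF U(1)])
      then have "?t ?D \<in> U"
        using tc[of ?D] V.submodule_carrier[OF U(1) low]
        by (simp add: U.P.minus_eq U.P.a_assoc U.P.r_neg)
      \<comment> \<open>The leading coefficient lies in the field \<open>k\<close>, so it can be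
        divided out although \<open>B\<close> is only a ring.\<close>
      have u: "?c ?D \<in> Units K" using lc K.field_Units by simp
      have "scalar B (inv\<^bsub>K\<^esub> ?c ?D) \<odot>\<^bsub>UP B\<^esub> ?t ?D \<in> U"
        by (rule V.submodule_smult[OF U(1) scalar_closed[OF K.Units_inv_closed[OF u]] \<open>?t ?D \<in> U\<close>])
      moreover have "scalar B (inv\<^bsub>K\<^esub> ?c ?D) \<odot>\<^bsub>UP B\<^esub> ?t ?D = ?x i"
      proof -
        have "scalar B (inv\<^bsub>K\<^esub> ?c ?D) \<otimes>\<^bsub>B\<^esub> scalar B (?c ?D) = \<one>\<^bsub>B\<^esub>"
          using K.Units_l_inv[OF u] K.Units_inv_closed[OF u] lc(1) scalar_one
            scalar_scalar[of "inv\<^bsub>K\<^esub> ?c ?D" "?c ?D"] by simp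
        then show ?thesis
          using V.smult_assoc1[of "scalar B (inv\<^bsub>K\<^esub> ?c ?D)" "scalar B (?c ?D)" "?x (?D + j)"]
            K.Units_inv_closed[OF u] lc(1) i by simp
      qed
      ultimately show ?thesis by simp
    qed (rule U(3))
  qed
  then show ?thesis by (rule U.submodule_eq_carrier[OF U(1)])
qed

text \<open>
  Rabinowitsch trick: otherwise \<open>1 - rX\<close> is not left invertible modulo \<open>I\<close>, and \<open>r\<close> acts invertibly
  on a simple quotient of \<open>B[X] / B[X](1 - rX)\<close> killed by \<open>I\<close>, which is finitely generated over \<open>B\<close>.
\<close>

lemma nilpotent_modulo:
  assumes I: "ideal I B" and r: "r \<in> carrier B"
    and rQ: "\<And>Q. \<lbrakk>primitive_ideal B Q; I \<subseteq> Q\<rbrakk> \<Longrightarrow> r \<in> Q"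
  shows "\<exists>n::nat. r [^]\<^bsub>B\<^esub> n \<in> I"
proof -
  interpret I: ideal I B by (rule I)
  interpret U: UP_ring B "UP B" by unfold_locales
  interpret V: left_module B "UP B" by (rule U.UP_left_module)
  interpret Reg: left_module B "regular_module B" by (rule B.regular_left_module)
  have IR: "submodule I B (regular_module B)" by (rule B.ideal_imp_submodule[OF I])
  have regminus: "a_minus (regular_module B) = a_minus B" by (rule a_minus_cong) simp_all
  let ?P = "UP B"
  let ?x = "\<lambda>i. monom ?P \<one>\<^bsub>B\<^esub> i" and ?f = "\<lambda>q. monom ?P \<one>\<^bsub>B\<^esub> 1 \<otimes>\<^bsub>?P\<^esub> q"
  let ?e = "\<one>\<^bsub>?P\<^esub> \<ominus>\<^bsub>?P\<^esub> monom ?P r 1"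
  \<comment> \<open>The polynomials with coefficients in \<open>I\<close>.\<close>
  let ?IX = "{q \<in> carrier ?P. \<forall>n. coeff ?P q n \<in> I}"
  \<comment> \<open>The left ideal \<open>I[X] + B[X](1 - rX)\<close> of \<open>B[X]\<close>.
    Whether it contains 1 decides between the two cases below.\<close>
  let ?N0 = "{q \<in> carrier ?P. \<exists>p \<in> carrier ?P. q \<ominus>\<^bsub>?P\<^esub> p \<otimes>\<^bsub>?P\<^esub> ?e \<in> ?IX}"
  have f: "?f \<in> module_End B ?P"
    unfolding module_End_def using U.X_mult_smult by (auto simp: U.P.r_distr)
  have e: "?e \<in> carrier ?P" using r by simp
  have f_diff: "?f (p \<ominus>\<^bsub>?P\<^esub> q) = ?f p \<ominus>\<^bsub>?P\<^esub> ?f q" if "p \<in> carrier ?P" "q \<in> carrier ?P" for p q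
    using that by (simp add: U.P.minus_eq U.P.r_distr U.P.r_minus)
  have IX: "submodule ?IX B ?P"
    by (rule V.submoduleI) (use I.I_l_closed I.a_closed I.zero_closed in auto)
  have f_IX: "?f q \<in> ?IX" if q: "q \<in> ?IX" for q
  proof -
    have qP: "q \<in> carrier ?P" and qI: "\<And>n. coeff ?P q n \<in> I" using q by auto
    have "coeff ?P (?f q) n \<in> I" for n
      by (cases n)
        (use qI I.zero_closed in \<open>simp_all only: U.coeff_X_mult_0[OF qP] U.coeff_X_mult_Suc[OF qP]\<close>)
    then show ?thesis using qP by simp
  qed
  have N0I: "q \<in> ?N0" if "q \<in> carrier ?P" "p \<in> carrier ?P" "q \<ominus>\<^bsub>?P\<^esub> p \<otimes>\<^bsub>?P\<^esub> ?e \<in> ?IX" for p q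
    using that by blast
  have N0E: "\<exists>p \<in> carrier ?P. q \<ominus>\<^bsub>?P\<^esub> p \<otimes>\<^bsub>?P\<^esub> ?e \<in> ?IX" "q \<in> carrier ?P" if "q \<in> ?N0" for q
    using that by blast+
  have IX_N0: "q \<in> ?N0" if q: "q \<in> ?IX" for q
    by (rule N0I[of _ "\<zero>\<^bsub>?P\<^esub>"]) (use q e in \<open>simp_all add: U.P.minus_eq\<close>)
  have N0: "submodule ?N0 B ?P"
  proof (rule V.submoduleI)
    show "\<zero>\<^bsub>?P\<^esub> \<in> ?N0" by (rule IX_N0[OF V.submodule_zero[OF IX]])
  next
    fix q q' assume q: "q \<in> ?N0" "q' \<in> ?N0"
    obtain p where p: "p \<in> carrier ?P" "q \<ominus>\<^bsub>?P\<^esub> p \<otimes>\<^bsub>?P\<^esub> ?e \<in> ?IX" using N0E(1)[OF q(1)] ..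
    obtain p' where p': "p' \<in> carrier ?P" "q' \<ominus>\<^bsub>?P\<^esub> p' \<otimes>\<^bsub>?P\<^esub> ?e \<in> ?IX" using N0E(1)[OF q(2)] ..
    note c = N0E(2)[OF q(1)] N0E(2)[OF q(2)]
    have "(q \<ominus>\<^bsub>?P\<^esub> p \<otimes>\<^bsub>?P\<^esub> ?e) \<oplus>\<^bsub>?P\<^esub> (q' \<ominus>\<^bsub>?P\<^esub> p' \<otimes>\<^bsub>?P\<^esub> ?e) =
        (q \<oplus>\<^bsub>?P\<^esub> q') \<ominus>\<^bsub>?P\<^esub> (p \<oplus>\<^bsub>?P\<^esub> p') \<otimes>\<^bsub>?P\<^esub> ?e"
      using U.P.diff_add_diff[of q "p \<otimes>\<^bsub>?P\<^esub> ?e" q' "p' \<otimes>\<^bsub>?P\<^esub> ?e"] c p(1) p'(1) e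
      by (simp only: U.P.l_distr U.P.m_closed)
    then show "q \<oplus>\<^bsub>?P\<^esub> q' \<in> ?N0"
      using V.submodule_add[OF IX p(2) p'(2)] c p(1) p'(1)
      by (intro N0I[of _ "p \<oplus>\<^bsub>?P\<^esub> p'"]) simp_all
  next
    fix b q assume b: "b \<in> carrier B" and q: "q \<in> ?N0"
    obtain p where p: "p \<in> carrier ?P" "q \<ominus>\<^bsub>?P\<^esub> p \<otimes>\<^bsub>?P\<^esub> ?e \<in> ?IX" using N0E(1)[OF q] ..
    note c = N0E(2)[OF q]
    have "b \<odot>\<^bsub>?P\<^esub> (q \<ominus>\<^bsub>?P\<^esub> p \<otimes>\<^bsub>?P\<^esub> ?e) = b \<odot>\<^bsub>?P\<^esub> q \<ominus>\<^bsub>?P\<^esub> (b \<odot>\<^bsub>?P\<^esub> p) \<otimes>\<^bsub>?P\<^esub> ?e"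
      using V.smult_diff_right[OF b c U.P.m_closed[OF p(1) e]] U.UP_smult_assoc2[OF b p(1) e] by simp
    then show "b \<odot>\<^bsub>?P\<^esub> q \<in> ?N0"
      using V.submodule_smult[OF IX b p(2)] b c p(1) by (intro N0I[of _ "b \<odot>\<^bsub>?P\<^esub> p"]) simp_all
  qed simp
  have f_N0: "?f q \<in> ?N0" if q: "q \<in> ?N0" for q
  proof -
    obtain p where p: "p \<in> carrier ?P" "q \<ominus>\<^bsub>?P\<^esub> p \<otimes>\<^bsub>?P\<^esub> ?e \<in> ?IX" using N0E(1)[OF q] ..
    note c = N0E(2)[OF q]
    have "?f (q \<ominus>\<^bsub>?P\<^esub> p \<otimes>\<^bsub>?P\<^esub> ?e) = ?f q \<ominus>\<^bsub>?P\<^esub> ?f p \<otimes>\<^bsub>?P\<^esub> ?e"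
      using f_diff[OF c U.P.m_closed[OF p(1) e]] U.P.m_assoc[OF _ p(1) e, of "?x 1"] by simp
    then show ?thesis
      using f_IX[OF p(2)] c p(1) by (intro N0I[of _ "?f p"]) simp_all
  qed
  have e_N0: "?e \<in> ?N0"
    by (rule N0I[of _ "\<one>\<^bsub>?P\<^esub>"]) (use e V.submodule_zero[OF IX] in \<open>simp_all add: U.P.minus_eq U.P.r_neg\<close>)
  show ?thesis
  proof (cases "\<one>\<^bsub>?P\<^esub> \<in> ?N0")
    case True
    then obtain p where p: "p \<in> carrier ?P" "\<one>\<^bsub>?P\<^esub> \<ominus>\<^bsub>?P\<^esub> p \<otimes>\<^bsub>?P\<^esub> ?e \<in> ?IX"
      using N0E(1) by blast
    have pe: "p \<otimes>\<^bsub>?P\<^esub> ?e = p \<ominus>\<^bsub>?P\<^esub> p \<otimes>\<^bsub>?P\<^esub> monom ?P r 1"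
      using p(1) r by (simp add: U.P.minus_eq U.P.r_distr U.P.r_minus)
    let ?c = "coeff ?P p"
    have cB: "?c n \<in> carrier B" for n using p(1) by simp
    have co: "coeff ?P \<one>\<^bsub>?P\<^esub> n \<ominus>\<^bsub>B\<^esub> (?c n \<ominus>\<^bsub>B\<^esub> coeff ?P (p \<otimes>\<^bsub>?P\<^esub> monom ?P r 1) n) \<in> I" for n
    proof -
      have "coeff ?P (\<one>\<^bsub>?P\<^esub> \<ominus>\<^bsub>?P\<^esub> p \<otimes>\<^bsub>?P\<^esub> ?e) n \<in> I" using p(2) by blast
      then show ?thesis
        using p(1) r unfolding pe by (simp del: U.coeff_mult U.coeff_one)
    qed
    \<comment> \<open>From \<open>1 = p (1 - rX)\<close> modulo \<open>I[X]\<close> the coefficients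
      of \<open>p\<close> satisfy \<open>c_0 = 1\<close> and \<open>c_(n+1) = c_n r\<close> modulo
      \<open>I\<close>: the geometric series, which must break off.\<close>
    have pow: "?c n \<ominus>\<^bsub>B\<^esub> r [^]\<^bsub>B\<^esub> n \<in> I" for n
    proof (induction n)
      case 0
      have "\<one>\<^bsub>B\<^esub> \<ominus>\<^bsub>B\<^esub> ?c 0 \<in> I"
        using co[of 0] U.coeff_mult_monom_0[OF r p(1)] cB by (simp add: B.minus_eq del: U.coeff_mult)
      then show ?case
        using Reg.submodule_diff_sym[OF IR, of "\<one>\<^bsub>B\<^esub>" "?c 0"] cB by (simp add: regminus)
    next
      case (Suc n)
      have rn: "r [^]\<^bsub>B\<^esub> n \<in> carrier B" using r by simp
      have "\<zero>\<^bsub>B\<^esub> \<ominus>\<^bsub>B\<^esub> (?c (Suc n) \<ominus>\<^bsub>B\<^esub> ?c n \<otimes>\<^bsub>B\<^esub> r) \<in> I"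
        using co[of "Suc n"] U.coeff_mult_monom_Suc[OF r p(1), of n] by (simp del: U.coeff_mult)
      then have "?c (Suc n) \<ominus>\<^bsub>B\<^esub> ?c n \<otimes>\<^bsub>B\<^esub> r \<in> I"
        using Reg.submodule_diff_sym[OF IR, of "\<zero>\<^bsub>B\<^esub>" "?c (Suc n) \<ominus>\<^bsub>B\<^esub> ?c n \<otimes>\<^bsub>B\<^esub> r"] cB r
        by (simp add: regminus B.minus_eq)
      moreover have "(?c n \<ominus>\<^bsub>B\<^esub> r [^]\<^bsub>B\<^esub> n) \<otimes>\<^bsub>B\<^esub> r \<in> I" by (rule I.I_r_closed[OF Suc r])
      then have "?c n \<otimes>\<^bsub>B\<^esub> r \<ominus>\<^bsub>B\<^esub> r [^]\<^bsub>B\<^esub> Suc n \<in> I"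
        using cB rn r by (simp add: B.minus_eq B.l_distr B.l_minus)
      ultimately show ?case
        using Reg.submodule_diff_trans[OF IR, of "?c (Suc n)" "?c n \<otimes>\<^bsub>B\<^esub> r" "r [^]\<^bsub>B\<^esub> Suc n"] cB r
        by (simp add: regminus)
    qed
    \<comment> \<open>One beyond the degree, where the coefficient of \<open>p\<close>
      vanishes.\<close>
    let ?n = "Suc (deg B p)"
    have "?c ?n = \<zero>\<^bsub>B\<^esub>" using U.deg_aboveD[of p ?n] p(1) by simp
    then have "\<zero>\<^bsub>B\<^esub> \<ominus>\<^bsub>B\<^esub> r [^]\<^bsub>B\<^esub> ?n \<in> I" using pow[of ?n] by simp
    then have "r [^]\<^bsub>B\<^esub> ?n \<in> I"
      using Reg.submodule_diff_iff[OF IR, of "\<zero>\<^bsub>B\<^esub>" "r [^]\<^bsub>B\<^esub> ?n"] r I.zero_closed by (simp add: regminus)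
    then show ?thesis ..
  next
    case False
    \<comment> \<open>The \<open>B\<close>-submodules closed under \<open>X\<close>, that is, the
      left ideals of \<open>B[X]\<close>; \<open>N\<close> below is a maximal one containing
      \<open>?N0\<close>.\<close>
    let ?st = "\<lambda>U. submodule U B ?P \<and> (\<forall>m \<in> U. ?f m \<in> U)"
    obtain N where N: "?st N" "?N0 \<subseteq> N" "\<one>\<^bsub>?P\<^esub> \<notin> N"
      and Nmax: "\<And>U. \<lbrakk>?st U; N \<subseteq> U; \<one>\<^bsub>?P\<^esub> \<notin> U\<rbrakk> \<Longrightarrow> U = N"
    proof (rule ex_maximal_not_containing[of ?st ?N0 "{\<one>\<^bsub>?P\<^esub>}"])
      show "?st ?N0" using N0 f_N0 by blast
      show "?st (\<Union>\<C>)" if "\<C> \<noteq> {}" "\<And>A. A \<in> \<C> \<Longrightarrow> ?st A"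
        "\<And>A A'. \<lbrakk>A \<in> \<C>; A' \<in> \<C>\<rbrakk> \<Longrightarrow> A \<subseteq> A' \<or> A' \<subseteq> A" for \<C>
        using V.submodule_Union_chain[OF that(1) _ that(3)] that(2) by blast
    qed (use False in auto)
    have Ns: "submodule N B ?P" and fN: "\<And>m. m \<in> N \<Longrightarrow> ?f m \<in> N" using N(1) by blast+
    have full: "U = carrier ?P" if U: "submodule U B ?P" "\<And>m. m \<in> U \<Longrightarrow> ?f m \<in> U" "\<one>\<^bsub>?P\<^esub> \<in> U" for U
    proof (rule U.submodule_eq_carrier[OF U(1)])
      show "?x i \<in> U" for i
        by (induction i) (use U(3) U(2)[of "?x _"] in \<open>simp_all add: U.X_mult_monom\<close>)
    qed
    have Nmax': "U = N \<or> U = carrier ?P"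
      if "submodule U B ?P" "N \<subseteq> U" "\<And>m. m \<in> U \<Longrightarrow> ?f m \<in> U" for U
      using full[OF that(1,3)] Nmax[of U] that by blast
    have N_ne: "N \<noteq> carrier ?P" using N(3) U.P.one_closed by blast
    let ?act = "\<lambda>p m. p \<odot>\<^bsub>poly_module K (restrict_scalars (scalar B) ?P) ?f\<^esub> m"
    have "\<exists>p \<in> carrier (UP K). p \<noteq> \<zero>\<^bsub>UP K\<^esub> \<and> (\<forall>m \<in> carrier ?P. ?act p m \<in> N)" (is ?ex)
    proof (rule maximal_stable_submodule_algebraic[OF U.UP_left_module f Ns])
      show "U = N \<or> U = carrier ?P"
        if "submodule U B ?P" "N \<subseteq> U" "\<And>m. m \<in> U \<Longrightarrow> ?f m \<in> U" for U
        by (rule Nmax'[OF that])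
      show ?ex if "p \<in> carrier (UP K)" "p \<noteq> \<zero>\<^bsub>UP K\<^esub>"
        "\<And>m. m \<in> carrier ?P \<Longrightarrow> ?act p m \<in> N" for p
        using that by blast
    qed (rule fN N_ne; assumption?)+
    then obtain p where p: "p \<in> carrier (UP K)" "p \<noteq> \<zero>\<^bsub>UP K\<^esub>"
      "\<And>m. m \<in> carrier ?P \<Longrightarrow> ?act p m \<in> N" by blast
    \<comment> \<open>Together with \<open>N\<close> these powers of \<open>X\<close> generate
      \<open>B[X]\<close> over \<open>B\<close>, by algebraicity of \<open>X\<close> modulo
      \<open>N\<close>.\<close>
    let ?X = "?x ` {..deg K p}"
    have one_X: "\<one>\<^bsub>?P\<^esub> \<in> ?X" by (rule image_eqI[of _ _ 0]) simp_all
    obtain N' where N': "submodule N' B ?P" "N \<subseteq> N'" "\<not> ?X \<subseteq> N'"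
      and N'max: "\<And>U. \<lbrakk>submodule U B ?P; N' \<subseteq> U; \<not> ?X \<subseteq> U\<rbrakk> \<Longrightarrow> U = N'"
    proof (rule ex_maximal_not_containing[of "\<lambda>U. submodule U B ?P" N ?X])
      show "\<not> ?X \<subseteq> N" using N(3) one_X by blast
      show "submodule (\<Union>\<C>) B ?P" if "\<C> \<noteq> {}" "\<And>A. A \<in> \<C> \<Longrightarrow> submodule A B ?P"
        "\<And>A A'. \<lbrakk>A \<in> \<C>; A' \<in> \<C>\<rbrakk> \<Longrightarrow> A \<subseteq> A' \<or> A' \<subseteq> A" for \<C>
        by (rule V.submodule_Union_chain[OF that])
    qed (use Ns in auto)
    have N'_ne: "N' \<noteq> carrier ?P" using N'(3) by auto
    have N'max': "U = N' \<or> U = carrier ?P" if U: "submodule U B ?P" "N' \<subseteq> U" for U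
    proof (cases "?X \<subseteq> U")
      case True
      have "U = carrier ?P"
        by (rule algebraic_imp_bounded_generators[OF p U(1)]) (use U(2) N'(2) True in auto)
      then show ?thesis ..
    qed (use N'max[OF U] in blast)
    let ?Q = "{b \<in> carrier B. \<forall>m \<in> carrier ?P. b \<odot>\<^bsub>?P\<^esub> m \<in> N'}"
    have "primitive_ideal B ?Q" by (rule V.maximal_submodule_primitive[OF N'(1) N'_ne N'max'])
    \<comment> \<open>Multiplying any polynomial by an element of \<open>I\<close> lands in
      \<open>I[X]\<close>, which lies in \<open>?N0\<close>, hence in \<open>N\<close> and in
      \<open>N'\<close>.\<close>
    moreover have "I \<subseteq> ?Q"
    proof
      fix b assume b: "b \<in> I"
      then have bB: "b \<in> carrier B" by (rule I.Icarr)
      have "b \<odot>\<^bsub>?P\<^esub> m \<in> ?IX" if "m \<in> carrier ?P" for m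
        using that bB I.I_r_closed[OF b] by simp
      then have "b \<odot>\<^bsub>?P\<^esub> m \<in> N'" if "m \<in> carrier ?P" for m
        using subsetD[OF N'(2) subsetD[OF N(2) IX_N0]] that by blast
      then show "b \<in> ?Q" using bB by simp
    qed
    ultimately have rQ': "r \<in> ?Q" by (rule rQ)
    have fc: "?f m \<in> carrier ?P" if "m \<in> carrier ?P" for m using that by simp
    have fpc: "(?f ^^ i) m \<in> carrier ?P" if "m \<in> carrier ?P" for m i
      by (induction i) (use that fc in auto)
    have fp_add: "(?f ^^ i) (m \<oplus>\<^bsub>?P\<^esub> n) = (?f ^^ i) m \<oplus>\<^bsub>?P\<^esub> (?f ^^ i) n"
      if "m \<in> carrier ?P" "n \<in> carrier ?P" for m n i
      by (induction i) (use that fpc in \<open>simp_all add: U.P.r_distr\<close>)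
    have fp_smult: "(?f ^^ i) (b \<odot>\<^bsub>?P\<^esub> m) = b \<odot>\<^bsub>?P\<^esub> (?f ^^ i) m"
      if "b \<in> carrier B" "m \<in> carrier ?P" for b m i
      by (induction i) (use that fpc in \<open>simp_all add: U.X_mult_smult\<close>)
    \<comment> \<open>The largest \<open>X\<close>-stable submodule inside \<open>N'\<close>. It
      contains \<open>N\<close> and is proper, so it equals \<open>N\<close> by maximality; this
      transfers information about the \<open>B\<close>-module quotient by \<open>N'\<close> back to
      \<open>N\<close>.\<close>
    let ?N2 = "{m \<in> carrier ?P. \<forall>i. (?f ^^ i) m \<in> N'}"
    have N2: "submodule ?N2 B ?P"
    proof (rule V.submoduleI)
      have "(?f ^^ i) \<zero>\<^bsub>?P\<^esub> = \<zero>\<^bsub>?P\<^esub>" for i by (induction i) simp_all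
      then show "\<zero>\<^bsub>?P\<^esub> \<in> ?N2" using V.submodule_zero[OF N'(1)] by simp
      show "x \<oplus>\<^bsub>?P\<^esub> y \<in> ?N2" if "x \<in> ?N2" "y \<in> ?N2" for x y
        using that by (simp add: fp_add V.submodule_add[OF N'(1)])
      show "b \<odot>\<^bsub>?P\<^esub> x \<in> ?N2" if "b \<in> carrier B" "x \<in> ?N2" for b x
        using that by (simp add: fp_smult V.submodule_smult[OF N'(1)])
    qed simp
    have f_N2: "?f m \<in> ?N2" if m: "m \<in> ?N2" for m
    proof -
      have "(?f ^^ i) (?f m) \<in> N'" for i
      proof -
        have "(?f ^^ Suc i) m \<in> N'" using m by blast
        then show ?thesis by (simp only: funpow_Suc_right o_apply)
      qed
      then show ?thesis using m fc by simp
    qed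
    have N_N2: "N \<subseteq> ?N2"
    proof
      fix m assume m: "m \<in> N"
      have "(?f ^^ i) m \<in> N" for i by (induction i) (use m fN in auto)
      then show "m \<in> ?N2" using N'(2) V.submodule_carrier[OF Ns m] by blast
    qed
    have "?N2 \<subseteq> N'"
    proof
      fix m assume "m \<in> ?N2"
      then have "(?f ^^ 0) m \<in> N'" by blast
      then show "m \<in> N'" by simp
    qed
    then have "?N2 \<noteq> carrier ?P" using N'_ne V.submodule_subset[OF N'(1)] by blast
    then have N2_N: "?N2 = N" using Nmax'[OF N2 N_N2 f_N2] by blast
    \<comment> \<open>Since \<open>r\<close> kills the quotient by \<open>N'\<close>, all products
      of \<open>r\<close> with powers of \<open>X\<close> lie in \<open>N'\<close>. Hence
      \<open>r\<close> and then \<open>rX\<close> lie in \<open>N\<close>, which also contains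
      \<open>1 - rX\<close>.\<close>
    have "r \<odot>\<^bsub>?P\<^esub> \<one>\<^bsub>?P\<^esub> \<in> ?N2"
      using rQ' r fpc[OF U.P.one_closed] by (simp add: fp_smult)
    then have "?f (r \<odot>\<^bsub>?P\<^esub> \<one>\<^bsub>?P\<^esub>) \<in> N" using N2_N fN by blast
    moreover have "?f (r \<odot>\<^bsub>?P\<^esub> \<one>\<^bsub>?P\<^esub>) = monom ?P r 1"
      using r U.monom_mult_smult[of r "\<one>\<^bsub>B\<^esub>" 1] by (simp add: U.X_mult_smult)
    ultimately have "monom ?P r 1 \<in> N" by simp
    moreover have "?e \<in> N" using e_N0 N(2) by blast
    ultimately have "\<one>\<^bsub>?P\<^esub> \<in> N"
      using V.submodule_diff_iff[OF Ns _ U.P.one_closed U.monom_closed[OF r]] by blast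
    then show ?thesis using N(3) by blast
  qed
qed

section \<open>Nil one-sided ideals modulo a prime ideal\<close>

lemma mult_pow_mult:
  assumes "s \<in> carrier B" "y \<in> carrier B"
  shows "(s \<otimes>\<^bsub>B\<^esub> y) [^]\<^bsub>B\<^esub> n \<otimes>\<^bsub>B\<^esub> s = s \<otimes>\<^bsub>B\<^esub> (y \<otimes>\<^bsub>B\<^esub> s) [^]\<^bsub>B\<^esub> (n::nat)"
proof (induction n)
  case (Suc n)
  have c: "(s \<otimes>\<^bsub>B\<^esub> y) [^]\<^bsub>B\<^esub> n \<in> carrier B" "(y \<otimes>\<^bsub>B\<^esub> s) [^]\<^bsub>B\<^esub> n \<in> carrier B" using assms by simp_all
  have "(s \<otimes>\<^bsub>B\<^esub> y) [^]\<^bsub>B\<^esub> Suc n \<otimes>\<^bsub>B\<^esub> s = ((s \<otimes>\<^bsub>B\<^esub> y) [^]\<^bsub>B\<^esub> n \<otimes>\<^bsub>B\<^esub> s) \<otimes>\<^bsub>B\<^esub> (y \<otimes>\<^bsub>B\<^esub> s)"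
    using assms c by (simp add: B.m_assoc)
  also have "\<dots> = s \<otimes>\<^bsub>B\<^esub> (y \<otimes>\<^bsub>B\<^esub> s) [^]\<^bsub>B\<^esub> Suc n"
    using assms c Suc by (simp add: B.m_assoc)
  finally show ?case .
qed (use assms in simp)

text \<open>Instead of the ideal generated by \<open>s\<close>, two annihilators are used:
  \<open>?J2\<close> holds the \<open>y\<close> with \<open>s B y\<close> inside \<open>P\<close>,
  and \<open>?J1\<close> the \<open>z\<close> with \<open>z ?J2\<close> inside \<open>P\<close>.
  Both are two-sided, their product lies in \<open>P\<close> by construction, and each contains
  \<open>s\<close>.\<close>

lemma prime_ideal_elementwise:
  assumes P: "nc_prime_ideal B P" and s: "s \<in> carrier B"
    and sBs: "\<And>b. b \<in> carrier B \<Longrightarrow> s \<otimes>\<^bsub>B\<^esub> b \<otimes>\<^bsub>B\<^esub> s \<in> P"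
  shows "s \<in> P"
proof -
  have "ideal P B" using P by (simp add: nc_prime_ideal_def)
  then interpret P: ideal P B .
  let ?J2 = "{y \<in> carrier B. \<forall>b \<in> carrier B. s \<otimes>\<^bsub>B\<^esub> b \<otimes>\<^bsub>B\<^esub> y \<in> P}"
  let ?J1 = "{z \<in> carrier B. \<forall>y \<in> ?J2. z \<otimes>\<^bsub>B\<^esub> y \<in> P}"
  have J2_l: "b \<otimes>\<^bsub>B\<^esub> y \<in> ?J2" if y: "y \<in> ?J2" and b: "b \<in> carrier B" for y b
  proof -
    have "s \<otimes>\<^bsub>B\<^esub> c \<otimes>\<^bsub>B\<^esub> (b \<otimes>\<^bsub>B\<^esub> y) \<in> P" if c: "c \<in> carrier B" for c
    proof -
      have "s \<otimes>\<^bsub>B\<^esub> (c \<otimes>\<^bsub>B\<^esub> b) \<otimes>\<^bsub>B\<^esub> y \<in> P" using y b c by simp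
      then show ?thesis using s y b c by (simp add: B.m_assoc)
    qed
    then show ?thesis using y b by simp
  qed
  have J2: "ideal ?J2 B"
  proof (rule idealI[OF B.ring_axioms])
    show "subgroup ?J2 (add_monoid B)"
      by (rule B.add.subgroupI)
        (use s B.zero_closed P.zero_closed P.a_inv_closed P.a_closed in \<open>auto simp: B.r_distr B.r_minus\<close>)
    show "b \<otimes>\<^bsub>B\<^esub> y \<in> ?J2" if "y \<in> ?J2" "b \<in> carrier B" for y b by (rule J2_l[OF that])
    show "y \<otimes>\<^bsub>B\<^esub> b \<in> ?J2" if y: "y \<in> ?J2" and b: "b \<in> carrier B" for y b
    proof -
      have "s \<otimes>\<^bsub>B\<^esub> c \<otimes>\<^bsub>B\<^esub> (y \<otimes>\<^bsub>B\<^esub> b) \<in> P" if c: "c \<in> carrier B" for c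
      proof -
        have "s \<otimes>\<^bsub>B\<^esub> c \<otimes>\<^bsub>B\<^esub> y \<otimes>\<^bsub>B\<^esub> b \<in> P" using y b c P.I_r_closed by simp
        then show ?thesis using s y b c by (simp add: B.m_assoc)
      qed
      then show ?thesis using y b by simp
    qed
  qed
  have J1: "ideal ?J1 B"
  proof (rule idealI[OF B.ring_axioms])
    show "subgroup ?J1 (add_monoid B)"
      by (rule B.add.subgroupI)
        (use B.zero_closed P.zero_closed P.a_inv_closed P.a_closed in \<open>auto simp: B.l_distr B.l_minus\<close>)
    show "b \<otimes>\<^bsub>B\<^esub> z \<in> ?J1" if z: "z \<in> ?J1" and b: "b \<in> carrier B" for z b
    proof -
      have "b \<otimes>\<^bsub>B\<^esub> z \<otimes>\<^bsub>B\<^esub> y \<in> P" if y: "y \<in> ?J2" for y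
      proof -
        have "z \<otimes>\<^bsub>B\<^esub> y \<in> P" "y \<in> carrier B" using z y by blast+
        then show ?thesis using z b P.I_l_closed[of "z \<otimes>\<^bsub>B\<^esub> y" b] by (simp add: B.m_assoc)
      qed
      then show ?thesis using z b by simp
    qed
    show "z \<otimes>\<^bsub>B\<^esub> b \<in> ?J1" if z: "z \<in> ?J1" and b: "b \<in> carrier B" for z b
    proof -
      have "z \<otimes>\<^bsub>B\<^esub> b \<otimes>\<^bsub>B\<^esub> y \<in> P" if y: "y \<in> ?J2" for y
      proof -
        have "z \<otimes>\<^bsub>B\<^esub> (b \<otimes>\<^bsub>B\<^esub> y) \<in> P" using z J2_l[OF y b] by blast
        moreover have "y \<in> carrier B" using y by blast
        ultimately show ?thesis using z b by (simp add: B.m_assoc)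
      qed
      then show ?thesis using z b by simp
    qed
  qed
  have "?J1 \<cdot>\<^bsub>B\<^esub> ?J2 \<subseteq> P"
  proof
    fix w assume "w \<in> ?J1 \<cdot>\<^bsub>B\<^esub> ?J2"
    then show "w \<in> P"
      by (induction rule: ideal_prod.induct) (blast, rule P.a_closed)
  qed
  then have "?J1 \<subseteq> P \<or> ?J2 \<subseteq> P" using P J1 J2 by (simp add: nc_prime_ideal_def)
  moreover have "s \<in> ?J2" using s sBs by simp
  moreover have "s \<in> ?J1"
  proof -
    have "s \<otimes>\<^bsub>B\<^esub> y \<in> P" if y: "y \<in> ?J2" for y
    proof -
      have "s \<otimes>\<^bsub>B\<^esub> \<one>\<^bsub>B\<^esub> \<otimes>\<^bsub>B\<^esub> y \<in> P" using y B.one_closed by blast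
      then show ?thesis using s by simp
    qed
    then show ?thesis using s by simp
  qed
  ultimately show ?thesis by blast
qed

text \<open>
  Utumi's argument: take \<open>s\<close> outside \<open>P\<close> with maximal left annihilator modulo \<open>P\<close>.
  If \<open>s y s \<notin> P\<close>, then the last power with \<open>(s y)\<^sup>n s \<notin> P\<close> has the same left annihilator, which
  contains \<open>s y\<close>.
\<close>

lemma prime_contains_nil:
  assumes P: "nc_prime_ideal B P" and JB: "J \<subseteq> carrier B"
    and J_mult: "\<And>s b. \<lbrakk>s \<in> J; b \<in> carrier B\<rbrakk> \<Longrightarrow> s \<otimes>\<^bsub>B\<^esub> b \<in> J"
    and nil: "\<And>s. s \<in> J \<Longrightarrow> \<exists>n::nat. s [^]\<^bsub>B\<^esub> n \<in> P"
  shows "J \<subseteq> P"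
proof (rule ccontr)
  assume "\<not> J \<subseteq> P"
  then obtain s0 where s0: "s0 \<in> J - P" by blast
  have "ideal P B" using P by (simp add: nc_prime_ideal_def)
  then interpret P: ideal P B .
  \<comment> \<open>The left annihilator of \<open>s\<close> modulo \<open>P\<close>, a left ideal
    to which the maximal condition applies.\<close>
  let ?l = "\<lambda>s. {y \<in> carrier B. y \<otimes>\<^bsub>B\<^esub> s \<in> P}"
  have sub: "submodule (?l s) B (regular_module B)" if "s \<in> carrier B" for s
    by (rule left_module.submoduleI[OF B.regular_left_module])
      (use that P.zero_closed P.a_closed P.I_l_closed in \<open>auto simp: B.l_distr B.m_assoc\<close>)
  have "\<exists>L \<in> ?l ` (J - P). \<forall>L' \<in> ?l ` (J - P). L \<subseteq> L' \<longrightarrow> L' = L" (is ?max)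
  proof (rule left_noetherian[of "?l s0" "?l ` (J - P)"])
    show "?l s0 \<in> ?l ` (J - P)" by (rule imageI[OF s0])
    show "submodule L B (regular_module B)" if L: "L \<in> ?l ` (J - P)" for L
    proof -
      obtain s where "s \<in> J - P" "L = ?l s" using L by (rule imageE)
      then show ?thesis using sub[of s] JB by blast
    qed
    show ?max if "L \<in> ?l ` (J - P)" "\<And>L'. \<lbrakk>L' \<in> ?l ` (J - P); L \<subseteq> L'\<rbrakk> \<Longrightarrow> L' = L" for L
      by (rule bexI[OF _ that(1)]) (intro ballI impI that(2))
  qed
  then obtain L where L: "L \<in> ?l ` (J - P)"
    and Lmax: "\<forall>L' \<in> ?l ` (J - P). L \<subseteq> L' \<longrightarrow> L' = L" ..
  from L obtain s where "s \<in> J - P" "L = ?l s" by (rule imageE)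
  then have s: "s \<in> J" "s \<notin> P" "L = ?l s" by simp_all
  have sB: "s \<in> carrier B" using s(1) JB by blast
  have "s \<otimes>\<^bsub>B\<^esub> y \<otimes>\<^bsub>B\<^esub> s \<in> P" if y: "y \<in> carrier B" for y
  proof (rule ccontr)
    assume not: "s \<otimes>\<^bsub>B\<^esub> y \<otimes>\<^bsub>B\<^esub> s \<notin> P"
    let ?t = "\<lambda>n. (s \<otimes>\<^bsub>B\<^esub> y) [^]\<^bsub>B\<^esub> (n::nat) \<otimes>\<^bsub>B\<^esub> s"
    have tB: "?t n \<in> carrier B" for n using sB y by simp
    obtain n :: nat where "(s \<otimes>\<^bsub>B\<^esub> y) [^]\<^bsub>B\<^esub> n \<in> P" using nil[OF J_mult[OF s(1) y]] by blast
    then have n: "?t n \<in> P" by (rule P.I_r_closed[OF _ sB])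
    define m where "m = (LEAST n. ?t n \<in> P)"
    have m: "?t m \<in> P" unfolding m_def by (rule LeastI[of "\<lambda>n. ?t n \<in> P", OF n])
    have least: "?t k \<notin> P" if "k < m" for k
      using not_less_Least[of k "\<lambda>n. ?t n \<in> P"] that unfolding m_def by blast
    \<comment> \<open>For exponent 0 the product is \<open>s\<close> itself, which is outside
      \<open>P\<close>.\<close>
    have "m \<noteq> 0"
    proof
      assume "m = 0"
      then show False using m s(2) sB by simp
    qed
    then obtain k where k: "m = Suc k" using not0_implies_Suc by blast
    \<comment> \<open>Pulling \<open>s\<close> to the front shows that \<open>?t k\<close> is a
      right multiple of \<open>s\<close>: it stays in \<open>J\<close>, and whatever annihilates
      \<open>s\<close> modulo \<open>P\<close> annihilates it too.\<close>
    have eq: "?t k = s \<otimes>\<^bsub>B\<^esub> (y \<otimes>\<^bsub>B\<^esub> s) [^]\<^bsub>B\<^esub> k" by (rule mult_pow_mult[OF sB y])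
    have yk: "(y \<otimes>\<^bsub>B\<^esub> s) [^]\<^bsub>B\<^esub> k \<in> carrier B" using sB y by simp
    have "?t k \<in> J" unfolding eq by (rule J_mult[OF s(1) yk])
    then have "?l (?t k) \<in> ?l ` (J - P)" using least[of k] k by (intro imageI) simp
    moreover have "L \<subseteq> ?l (?t k)"
    proof
      fix z assume "z \<in> L"
      then have z: "z \<in> carrier B" "z \<otimes>\<^bsub>B\<^esub> s \<in> P" using s(3) by blast+
      have "z \<otimes>\<^bsub>B\<^esub> s \<otimes>\<^bsub>B\<^esub> (y \<otimes>\<^bsub>B\<^esub> s) [^]\<^bsub>B\<^esub> k \<in> P" by (rule P.I_r_closed[OF z(2) yk])
      then show "z \<in> ?l (?t k)" unfolding eq using z(1) sB yk by (simp add: B.m_assoc)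
    qed
    ultimately have "?l (?t k) = L" by (rule Lmax[rule_format])
    \<comment> \<open>One more factor \<open>s y\<close> turns \<open>?t k\<close> into
      \<open>?t m\<close>, which is in \<open>P\<close>. By maximality \<open>s y\<close> then
      annihilates \<open>s\<close> as well, contrary to \<open>not\<close>.\<close>
    moreover have "s \<otimes>\<^bsub>B\<^esub> y \<in> ?l (?t k)"
    proof -
      have "(s \<otimes>\<^bsub>B\<^esub> y) \<otimes>\<^bsub>B\<^esub> ((s \<otimes>\<^bsub>B\<^esub> y) [^]\<^bsub>B\<^esub> k) = (s \<otimes>\<^bsub>B\<^esub> y) [^]\<^bsub>B\<^esub> Suc k"
        using B.nat_pow_Suc2[of "s \<otimes>\<^bsub>B\<^esub> y" k] sB y by simp
      then have "(s \<otimes>\<^bsub>B\<^esub> y) \<otimes>\<^bsub>B\<^esub> ?t k = ?t m"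
        using sB y unfolding k by (simp only: B.m_assoc[symmetric] B.m_closed B.nat_pow_closed)
      then show ?thesis using m sB y by simp
    qed
    ultimately show False using not s(3) by blast
  qed
  then have "s \<in> P" by (rule prime_ideal_elementwise[OF P sB])
  then show False using s(2) by blast
qed

text \<open>The intersection is closed under right multiplication, and each of its elements is
  nilpotent modulo \<open>P\<close> by \<open>nilpotent_modulo\<close>; so
  \<open>prime_contains_nil\<close> applies.\<close>

lemma prime_ideal_eq_Inter_primitive:
  assumes P: "nc_prime_ideal B P"
  shows "P = carrier B \<inter> \<Inter>{Q. primitive_ideal B Q \<and> P \<subseteq> Q}"
proof -
  let ?J = "carrier B \<inter> \<Inter>{Q. primitive_ideal B Q \<and> P \<subseteq> Q}"
  have I: "ideal P B" using P by (simp add: nc_prime_ideal_def)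
  have "?J \<subseteq> P"
  proof (rule prime_contains_nil[OF P])
    show "s \<otimes>\<^bsub>B\<^esub> b \<in> ?J" if s: "s \<in> ?J" and b: "b \<in> carrier B" for s b
    proof -
      have "s \<otimes>\<^bsub>B\<^esub> b \<in> Q" if "primitive_ideal B Q" "P \<subseteq> Q" for Q
        by (rule primitive_ideal_mult_closed[OF that(1) _ b]) (use s that in simp)
      then show ?thesis using s b by simp
    qed
    show "\<exists>n::nat. s [^]\<^bsub>B\<^esub> n \<in> P" if "s \<in> ?J" for s
      by (rule nilpotent_modulo[OF I]) (use that in simp_all)
  qed simp
  moreover have "P \<subseteq> ?J" using ideal.Icarr[OF I] by blast
  ultimately show ?thesis by blast
qed

text \<open>A semiprime ideal is an intersection of primes, each of them an intersection of
  primitive ideals, all of which contain the semiprime ideal.\<close>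

theorem jacobson: "jacobson_algebra B"
  unfolding jacobson_algebra_def semiprimitive_ideal_def
proof (intro allI impI exI conjI)
  fix I assume "semiprime_ideal B I"
  then have I: "I = carrier B \<inter> \<Inter>{P. nc_prime_ideal B P \<and> I \<subseteq> P}"
    by (simp add: semiprime_ideal_def)
  let ?S = "{Q. primitive_ideal B Q \<and> I \<subseteq> Q}"
  show "\<forall>Q \<in> ?S. primitive_ideal B Q" by blast
  show "I = carrier B \<inter> \<Inter>?S"
  proof
    show "I \<subseteq> carrier B \<inter> \<Inter>?S" using I by blast
    have "b \<in> P" if b: "b \<in> carrier B \<inter> \<Inter>?S" and P: "nc_prime_ideal B P" "I \<subseteq> P" for b P
    proof -
      have "b \<in> carrier B \<inter> \<Inter>{Q. primitive_ideal B Q \<and> P \<subseteq> Q}" using b P(2) by blast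
      then show ?thesis using prime_ideal_eq_Inter_primitive[OF P(1)] by simp
    qed
    then have "carrier B \<inter> \<Inter>?S \<subseteq> carrier B \<inter> \<Inter>{P. nc_prime_ideal B P \<and> I \<subseteq> P}" by blast
    then show "carrier B \<inter> \<Inter>?S \<subseteq> I" using I by simp
  qed
qed

end

theorem theorem15:
  fixes K :: "'k ring" and B :: "('k, 'b) module" and \<gg> :: "'b set"
  assumes "almost_commutative_algebra K B \<gg>"
  shows "(\<forall>M :: (nat \<Rightarrow> 'b, 'm) module. simple_module (UP B) M \<longrightarrow>
            algebraic_map K (restrict_scalars (poly_scalar B) M) (\<lambda>m. poly_var B \<odot>\<^bsub>M\<^esub> m))
       \<and> jacobson_algebra B
       \<and> (\<forall>M :: ('b, 'n) module. simple_module B M \<longrightarrow>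
            (\<forall>f \<in> module_End B M. algebraic_map K (restrict_scalars (scalar B) M) f))"
proof -
  interpret almost_commutative_algebra K B \<gg> by (rule assms)
  show ?thesis
    using poly_var_algebraic jacobson module_End_algebraic by blast
qed

end
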